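(* Let $n,t\ge1$ be integers. The sequence $\mathcal{G}_{n}(t,(n+t-1)_\downarrow)$ is a universal cycle for $\mathbf{Multiset}(n,t)$ using adjusted difference representatives. Using $\mathcal{O}(nt^3)$ space, this sequence can be ranked in $\mathcal{O}(n^2t^3)$ time and unranked in $\mathcal{O}(n^2t^4\log n)$ time.
   Context: $\mathbf{Multiset}(n,t)$ is the set of $t$-multisets of $\{0,1,\ldots,n-1\}$. The difference representative of a multiset $\{m_1\le m_2\le\cdots\le m_t\}$ is the length-$t$ string whose first symbol is $m_1$ and whose $j$-th symbol is $m_j-m_{j-1}$ for $1<j\le t$; the adjusted difference representative is obtained by adding $1$ to every symbol. A universal cycle for $\mathbf{Multiset}(n,t)$ using adjusted difference representatives is a cyclic sequence of length $\binom{n+t-1}{t}$ in which the adjusted difference representative of each $t$-multiset occurs exactly once as a length-$t$ cyclic substring. Notation: $\mathbf{S}_k(m)$ is the set of length-$m$ strings over $\{\mathtt{1},\ldots,\mathtt{k}\}$; weight is the sum of symbols; $\mathbf{S}_k(m,v^\uparrow)$ are those of weight at least $v$. A necklace is a string lexicographically smallest among its rotations; $\mathbf{N}_k(m,v^\uparrow)=(\alpha_1,\ldots,\alpha_p)$ lists the necklaces of $\mathbf{S}_k(m,v^\uparrow)$ in lexicographic order; $\mathrm{ap}(\mathbf{s})$ is the shortest $\mathbf{u}$ with $\mathbf{s}=\mathbf{u}^j$, $j\ge1$; $\mathcal{G}_k(m,v^\uparrow)=\mathrm{ap}(\alpha_1)\cdots\mathrm{ap}(\alpha_p)$. The complement $\mathrm{comp}$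 replaces each symbol $\mathtt{x}$ by $\mathtt{k}-\mathtt{x}+1$, and $\mathcal{G}_k(m,v_\downarrow)=\mathrm{comp}(\mathcal{G}_k(m,(km-v+m)^\uparrow))$. Ranking: given a multiset, output the 1-based starting index of its adjusted difference representative in the cyclic sequence; unranking: given an index, output the multiset whose representative starts there. Complexity is in the unit-cost RAM model. *)

theory Defs
  imports Complex_Main "HOL-Library.Multiset" "HOL-Library.List_Lexorder"
begin

section \<open>Strings, necklaces and the concatenation sequences\<close>

definition strings :: "nat \<Rightarrow> nat \<Rightarrow> nat list set" where
  "strings k m = {s. length s = m \<and> set s \<subseteq> {1..k}}"

definition strings_up :: "nat \<Rightarrow> nat \<Rightarrow> nat \<Rightarrow> nat list set" where
  "strings_up k m v = {s \<in> strings k m. v \<le> sum_list s}"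

text \<open>The order on lists is the lexicographic one of \<^theory>\<open>HOL-Library.List_Lexorder\<close>,
  here and in the listing of the necklaces.\<close>

definition is_necklace :: "nat list \<Rightarrow> bool" where
  "is_necklace s \<longleftrightarrow> (\<forall>r. s \<le> rotate r s)"

definition necklaces_up :: "nat \<Rightarrow> nat \<Rightarrow> nat \<Rightarrow> nat list list" where
  "necklaces_up k m v = sorted_list_of_set {s \<in> strings_up k m v. is_necklace s}"

definition aperiodic_prefix :: "nat list \<Rightarrow> nat list" where
  "aperiodic_prefix s = (ARG_MIN length u. \<exists>j\<ge>1. s = concat (replicate j u))"

definition G_up :: "nat \<Rightarrow> nat \<Rightarrow> nat \<Rightarrow> nat list" where
  "G_up k m v = concat (map aperiodic_prefix (necklaces_up k m v))"

definition complement :: "nat \<Rightarrow> nat list \<Rightarrow> nat list" where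
  "complement k s = map (\<lambda>x. k - x + 1) s"

text \<open>The bound below is \<open>k m - v + m\<close>, rearranged so that the truncated subtraction on the
  naturals is exact whenever \<open>v \<le> k m + m\<close>; this includes \<open>k = n\<close>, \<open>m = t\<close>, \<open>v = n + t - 1\<close>
  for \<open>n, t \<ge> 1\<close>.\<close>

definition G_down :: "nat \<Rightarrow> nat \<Rightarrow> nat \<Rightarrow> nat list" where
  "G_down k m v = complement k (G_up k m (k * m + m - v))"

section \<open>Multisets and universal cycles\<close>

definition multisets :: "nat \<Rightarrow> nat \<Rightarrow> nat multiset set" where
  "multisets n t = {M. size M = t \<and> set_mset M \<subseteq> {0..<n}}"

definition difference_rep :: "nat multiset \<Rightarrow> nat list" where
  "difference_rep M =
     (let ms = sorted_list_of_multiset M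
      in map (\<lambda>j. if j = 0 then ms ! 0 else ms ! j - ms ! (j - 1)) [0..<size M])"

definition adjusted_difference_rep :: "nat multiset \<Rightarrow> nat list" where
  "adjusted_difference_rep M = map Suc (difference_rep M)"

text \<open>The cyclic substring of length \<open>t\<close> starting at the 1-based index \<open>i\<close>. It may wrap around
  more than once: for \<open>n = 1\<close> the universal cycle has length 1, whatever \<open>t\<close> is.\<close>

definition cyclic_substring :: "nat list \<Rightarrow> nat \<Rightarrow> nat \<Rightarrow> nat list" where
  "cyclic_substring u t i = map (\<lambda>j. u ! ((i - 1 + j) mod length u)) [0..<t]"

definition occurs_at :: "nat list \<Rightarrow> nat multiset \<Rightarrow> nat \<Rightarrow> bool" where
  "occurs_at u M i \<longleftrightarrow>
     i \<in> {1..length u} \<and> cyclic_substring u (size M) i = adjusted_difference_rep M"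

definition universal_cycle :: "nat \<Rightarrow> nat \<Rightarrow> nat list \<Rightarrow> bool" where
  "universal_cycle n t u \<longleftrightarrow>
     length u = (n + t - 1) choose t \<and> (\<forall>M \<in> multisets n t. \<exists>!i. occurs_at u M i)"

section \<open>Unit-cost random access machines\<close>

text \<open>A random access machine in the style of Aho, Hopcroft and Ullman under the uniform cost
  criterion: registers hold natural numbers and are initially 0, indirect addressing is
  available, input is read sequentially from a read-only tape and output is appended to a
  write-only tape. Every instruction costs one time unit, and the space used is the number of
  distinct registers accessed during the run. Subtraction is truncated at 0, division is
  integer division with \<open>x div 0 = 0\<close>, and reading past the end of the input gives 0. The
  machine halts when the program counter leaves the program.\<close>

datatype instr =
    Const nat nat    \<comment> \<open>\<open>R[i] := c\<close>\<close>
  | Add nat nat nat  \<comment> \<open>\<open>R[i] := R[j] + R[k]\<close>, and similarly for the next three\<close>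
  | Sub nat nat nat
  | Mul nat nat nat
  | Div nat nat nat
  | Load nat nat     \<comment> \<open>\<open>R[i] := R[R[j]]\<close>\<close>
  | Store nat nat    \<comment> \<open>\<open>R[R[i]] := R[j]\<close>\<close>
  | Jump nat
  | JumpZero nat nat \<comment> \<open>go to instruction \<open>l\<close> if \<open>R[i] = 0\<close>\<close>
  | Read nat
  | Write nat

type_synonym program = "instr list"

record config =
  pc :: nat
  reg :: "nat \<Rightarrow> nat"
  inp :: "nat list"
  out :: "nat list"

definition halted :: "program \<Rightarrow> config \<Rightarrow> bool" where
  "halted P c \<longleftrightarrow> length P \<le> pc c"

definition set_reg :: "nat \<Rightarrow> nat \<Rightarrow> config \<Rightarrow> config" where
  "set_reg i x c = c\<lparr>pc := pc c + 1, reg := (reg c)(i := x)\<rparr>"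

fun exec :: "instr \<Rightarrow> config \<Rightarrow> config" where
  "exec (Const i x) c = set_reg i x c"
| "exec (Add i j k) c = set_reg i (reg c j + reg c k) c"
| "exec (Sub i j k) c = set_reg i (reg c j - reg c k) c"
| "exec (Mul i j k) c = set_reg i (reg c j * reg c k) c"
| "exec (Div i j k) c = set_reg i (reg c j div reg c k) c"
| "exec (Load i j) c = set_reg i (reg c (reg c j)) c"
| "exec (Store i j) c = set_reg (reg c i) (reg c j) c"
| "exec (Jump l) c = c\<lparr>pc := l\<rparr>"
| "exec (JumpZero i l) c = c\<lparr>pc := (if reg c i = 0 then l else pc c + 1)\<rparr>"
| "exec (Read i) c =
     (set_reg i (case inp c of [] \<Rightarrow> 0 | x # _ \<Rightarrow> x) c)\<lparr>inp := tl (inp c)\<rparr>"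
| "exec (Write i) c = c\<lparr>pc := pc c + 1, out := out c @ [reg c i]\<rparr>"

fun accessed :: "instr \<Rightarrow> config \<Rightarrow> nat set" where
  "accessed (Const i x) c = {i}"
| "accessed (Add i j k) c = {i, j, k}"
| "accessed (Sub i j k) c = {i, j, k}"
| "accessed (Mul i j k) c = {i, j, k}"
| "accessed (Div i j k) c = {i, j, k}"
| "accessed (Load i j) c = {i, j, reg c j}"
| "accessed (Store i j) c = {i, j, reg c i}"
| "accessed (Jump l) c = {}"
| "accessed (JumpZero i l) c = {i}"
| "accessed (Read i) c = {i}"
| "accessed (Write i) c = {i}"

definition step :: "program \<Rightarrow> config \<Rightarrow> config" where
  "step P c = (if halted P c then c else exec (P ! pc c) c)"

definition step_accessed :: "program \<Rightarrow> config \<Rightarrow> nat set" where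
  "step_accessed P c = (if halted P c then {} else accessed (P ! pc c) c)"

definition config_after :: "program \<Rightarrow> nat list \<Rightarrow> nat \<Rightarrow> config" where
  "config_after P xs s = (step P ^^ s) \<lparr>pc = 0, reg = (\<lambda>_. 0), inp = xs, out = []\<rparr>"

text \<open>On input \<open>xs\<close> the program halts with output \<open>ys\<close>, within time \<open>T\<close> and space \<open>S\<close>.\<close>

definition computes_within ::
    "program \<Rightarrow> nat list \<Rightarrow> nat list \<Rightarrow> real \<Rightarrow> real \<Rightarrow> bool" where
  "computes_within P xs ys T S \<longleftrightarrow>
     (\<exists>s. real s \<le> T
        \<and> halted P (config_after P xs s)
        \<and> out (config_after P xs s) = ys
        \<and> real (card (\<Union>r<s. step_accessed P (config_after P xs r))) \<le> S)"

section \<open>Ranking and unranking\<close>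

text \<open>One program has to serve all \<open>n, t \<ge> 1\<close>. It is given \<open>n\<close>, \<open>t\<close> and the multiset (as its
  elements in nondecreasing order) or the index; time and space bounds may depend on \<open>n, t\<close>
  and cover any precomputation.\<close>

definition ranks_within ::
    "program \<Rightarrow> (nat \<Rightarrow> nat \<Rightarrow> nat list) \<Rightarrow> (nat \<Rightarrow> nat \<Rightarrow> real) \<Rightarrow> (nat \<Rightarrow> nat \<Rightarrow> real) \<Rightarrow> bool" where
  "ranks_within P u T S \<longleftrightarrow>
     (\<forall>n\<ge>1. \<forall>t\<ge>1. \<forall>M \<in> multisets n t. \<forall>i. occurs_at (u n t) M i \<longrightarrow>
        computes_within P (n # t # sorted_list_of_multiset M) [i] (T n t) (S n t))"

definition unranks_within ::
    "program \<Rightarrow> (nat \<Rightarrow> nat \<Rightarrow> nat list) \<Rightarrow> (nat \<Rightarrow> nat \<Rightarrow> real) \<Rightarrow> (nat \<Rightarrow> nat \<Rightarrow> real) \<Rightarrow> bool" where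
  "unranks_within P u T S \<longleftrightarrow>
     (\<forall>n\<ge>1. \<forall>t\<ge>1. \<forall>M \<in> multisets n t. \<forall>i. occurs_at (u n t) M i \<longrightarrow>
        computes_within P [n, t, i] (sorted_list_of_multiset M) (T n t) (S n t))"

text \<open>\<open>log n\<close> inside a big-O bound. It is the binary logarithm for \<open>n \<ge> 2\<close>; for \<open>n = 1\<close> it is 1
  instead of 0, since no algorithm runs in time 0.\<close>

definition log_factor :: "nat \<Rightarrow> real" where
  "log_factor n = max 1 (log 2 (real n))"

end

theory Submission
  imports Defs
begin

text \<open>
  Write a string as \<open>w\<close> with \<open>w\<^sub>i = n - s\<^sub>i\<close>. The strings that matter become the words \<open>w\<close> of length
  \<open>t\<close> with sum less than \<open>n\<close>, and the sequence becomes the concatenation of the aperiodic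
  prefixes of the lexicographically largest rotations, in decreasing order. The successor of a
  necklace agrees with it up to its last nonzero symbol. Hence a word \<open>y x\<close> whose largest
  rotation is \<open>x y\<close> occurs across the end of \<open>x y\<close> if \<open>y\<close> is not zero, and otherwise across
  the end of the last necklace whose prefix of length \<open>|x|\<close> exceeds \<open>x\<close>. As there are as many
  positions as words, every word occurs exactly once.

  The position of the end of a necklace \<open>z\<close> is the number of words with a rotation that is at least
  \<open>z\<close>. The words with all rotations below a prenecklace \<open>z\<close> are the circular concatenations of
  blocks, a block being a prefix of \<open>z\<close> followed by a symbol smaller than the next one of \<open>z\<close>.
  Cutting at the block that contains position 0 expresses their generating function by that of
  linear concatenations, which satisfies a convolution recurrence of length \<open>t\<close>. The machine
  evaluates the generating functions at a large number \<open>X\<close>, one register per polynomial, and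
  reads off the sum of the coefficients below degree \<open>n\<close> by reducing modulo \<open>X\<^sup>n\<close> and then modulo
  \<open>X - 1\<close>. Unranking finds the necklace at a position by greedy search.
\<close>

subsection \<open>Lexicographic order\<close>

text \<open>The obstacle is the cost of one count: words have to be separated by their sum, so every
  coefficient of the recurrence is a polynomial. In the unit-cost model a number of any size is
  multiplied in one step; packing a polynomial into one number therefore brings a count down to time
  O(n t + t^2) with O(t) registers. Unranking can then afford to try all symbols at every position.
  The second obstacle is a word \<open>y x\<close> with \<open>y\<close> zero, where the necklace
  across whose end the word occurs is not at hand. The necklaces whose prefix exceeds
  \<open>x\<close> form an initial segment of the list, and this segment is cut off by a single
  prenecklace that is easy to find (\<open>bump_threshold\<close>). Counting works for every
  prenecklace, so it also gives the end of this segment. Positions are measured from the end of the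
  sequence: for a necklace \<open>b\<close>, the number \<open>below n b\<close> is the number of
  symbols after its aperiodic prefix. Necklaces thus correspond to intervals of length
  \<open>period b\<close> starting at \<open>below n b\<close>, and both machines compute with these
  only.\<close>

lemma append_less_append_iff:
  fixes a b c d :: "nat list"
  assumes "length a = length b"
  shows "a @ c < b @ d \<longleftrightarrow> a < b \<or> a = b \<and> c < d"
  using assms by (induction a b rule: list_induct2) auto

lemma append_le_append_iff:
  fixes a b c d :: "nat list"
  assumes "length a = length b"
  shows "a @ c \<le> b @ d \<longleftrightarrow> a < b \<or> a = b \<and> c \<le> d"
  using assms by (induction a b rule: list_induct2) auto

lemma take_le_take:
  fixes a b :: "nat list"
  assumes "length a = length b" "a \<le> b"
  shows "take k a \<le> take k b"
proof -
  have "take k a @ drop k a \<le> take k b @ drop k b" using assms by simp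
  then show ?thesis using assms append_le_append_iff[of "take k a" "take k b" "drop k a" "drop k b"]
    by (auto simp del: append_take_drop_id)
qed

lemma less_if_take_less:
  fixes a b :: "nat list"
  assumes "length a = length b" "take k a < take k b"
  shows "a < b"
proof -
  have "take k a @ drop k a < take k b @ drop k b"
    using assms append_less_append_iff[of "take k a" "take k b" "drop k a" "drop k b"]
    by (simp del: append_take_drop_id)
  then show ?thesis by simp
qed

lemma replicate_zero_le:
  fixes a :: "nat list"
  shows "length a = k \<Longrightarrow> replicate k 0 \<le> a"
  by (induction k arbitrary: a) (auto simp: length_Suc_conv)

text \<open>The two words may differ in length: suffixes, rotations and concatenations are all
  compared with the same \<open>z\<close>, and the comparison is decided at one position
  \<open>m\<close>, whatever follows it.\<close>

definition mismatch :: "nat list \<Rightarrow> nat list \<Rightarrow> nat \<Rightarrow> bool" where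
  "mismatch z u m \<longleftrightarrow> m < length z \<and> m < length u \<and> take m u = take m z \<and> u ! m < z ! m"

lemma mismatch_unique:
  assumes "mismatch z u m" "mismatch z u m'"
  shows "m = m'"
proof -
  have *: False if "mismatch z u i" "mismatch z u j" "i < j" for i j
  proof -
    have "take j u ! i = take j z ! i" using that by (simp add: mismatch_def)
    then show False using that by (simp add: mismatch_def)
  qed
  then show ?thesis using assms by (meson nat_neq_iff)
qed

lemma mismatch_if_less:
  "length u = length z \<Longrightarrow> u < z \<Longrightarrow> \<exists>m. mismatch z u m"
proof (induction u z rule: list_induct2)
  case Nil
  then show ?case by simp
next
  case (Cons x xs y ys)
  then consider "x < y" | "x = y" "xs < ys" by auto
  then show ?case
  proof cases
    case 1
    then show ?thesis by (intro exI[of _ 0]) (simp add: mismatch_def)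
  next
    case 2
    then obtain m where "mismatch ys xs m" using Cons.IH by blast
    with 2 show ?thesis by (intro exI[of _ "Suc m"]) (simp add: mismatch_def)
  qed
qed

lemma mismatch_if_take_less:
  assumes "take l u < take l z" "l \<le> length u" "l \<le> length z"
  shows "\<exists>m<l. mismatch z u m"
proof -
  obtain m where m: "mismatch (take l z) (take l u) m"
    using mismatch_if_less[of "take l u" "take l z"] assms by auto
  then have "m < l" using assms by (simp add: mismatch_def)
  with m show ?thesis by (intro exI[of _ m]) (auto simp: mismatch_def)
qed

lemma take_less_if_mismatch:
  assumes "mismatch z u m"
  shows "take (Suc m) u < take (Suc m) z"
  using assms append_less_append_iff[of "take m u" "take m z" "[u ! m]" "[z ! m]"]
  by (auto simp: mismatch_def take_Suc_conv_app_nth)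

lemma less_if_mismatch:
  assumes "mismatch z u m" "length u = length z"
  shows "u < z"
  using less_if_take_less[OF assms(2) take_less_if_mismatch[OF assms(1)]] .

lemma mismatch_append: "mismatch z u m \<Longrightarrow> mismatch z (u @ v) m"
  by (auto simp: mismatch_def nth_append)

subsection \<open>Prenecklaces\<close>

text \<open>A prenecklace (a prefix of a necklace) for the reversed order, characterized by
  comparing each suffix with the prefix of the same length. Unlike the property of being the largest
  rotation, it passes to prefixes.\<close>

definition pren :: "nat list \<Rightarrow> bool" where
  "pren w \<longleftrightarrow> (\<forall>i\<le>length w. drop i w \<le> take (length w - i) w)"

lemma pren_suffix_le:
  assumes "pren z" "e \<le> k" "k \<le> length z"
  shows "drop e (take k z) \<le> take (k - e) z"
proof -
  have "take (k - e) (drop e z) \<le> take (k - e) (take (length z - e) z)"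
    using assms by (intro take_le_take) (auto simp: pren_def)
  moreover have "min (k - e) (length z - e) = k - e" using assms by simp
  ultimately show ?thesis by (simp add: drop_take)
qed

lemma pren_take:
  assumes "pren z"
  shows "pren (take k z)"
proof (cases "k \<le> length z")
  case True
  then have "length (take k z) = k" "\<And>i. i \<le> k \<Longrightarrow> take (k - i) (take k z) = take (k - i) z"
    by simp_all
  then show ?thesis using pren_suffix_le[OF assms _ True] by (simp only: pren_def[of "take k z"]) simp
qed (use assms in simp)

text \<open>Lowering the last symbol makes every proper suffix strictly smaller, while the prefix of
  the same length ends before that symbol and does not change.\<close>

lemma pren_strict:
  assumes "pren (u @ [c])" "y < c" "0 < i" "i \<le> length u"
  shows "drop i (u @ [y]) < take (Suc (length u) - i) (u @ [y])"
proof -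
  have "drop i u @ [y] < drop i u @ [c]"
    using assms append_less_append_iff[of "drop i u" "drop i u"] by simp
  also have "\<dots> = drop i (u @ [c])" using assms by simp
  also have "\<dots> \<le> take (Suc (length u) - i) (u @ [c])"
    using assms(1,3,4) unfolding pren_def
    by (metis le_SucI length_append_singleton)
  also have "\<dots> = take (Suc (length u) - i) (u @ [y])" using assms by simp
  finally show ?thesis using assms by simp
qed

lemma pren_lower:
  assumes "pren (u @ [c])" "y \<le> c"
  shows "pren (u @ [y])"
proof (cases "y = c")
  case False
  then have yc: "y < c" using assms by simp
  show ?thesis unfolding pren_def
  proof (intro allI impI)
    fix i assume i: "i \<le> length (u @ [y])"
    consider "i = 0" | "0 < i" "i \<le> length u" | "i = Suc (length u)" using i by fastforce
    then show "drop i (u @ [y]) \<le> take (length (u @ [y]) - i) (u @ [y])"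
      using pren_strict[OF assms(1) yc] by cases (auto simp del: drop_append take_append simp: less_imp_le)
  qed
qed (use assms in simp)

text \<open>The appended symbols are the least ones: they decide a comparison only after a tie, and
  then in favour of the prefix.\<close>

lemma pren_append_zeros:
  assumes "pren u"
  shows "pren (u @ replicate k 0)"
  unfolding pren_def
proof (intro allI impI)
  fix i assume i: "i \<le> length (u @ replicate k 0)"
  let ?w = "u @ replicate k (0::nat)"
  show "drop i ?w \<le> take (length ?w - i) ?w"
  proof (cases "i \<le> length u")
    case True
    define m where "m = length u - i"
    have e: "length ?w - i = m + k" using True m_def by simp
    have t: "take (m + k) ?w = take m u @ take k (drop m ?w)"
      using take_add[of m k ?w] m_def by simp
    have "drop i u \<le> take m u" using assms True by (simp add: pren_def m_def)
    moreover have "replicate k 0 \<le> take k (drop m ?w)"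
      by (rule replicate_zero_le) (auto simp: m_def)
    moreover have "length (drop i u) = length (take m u)" by (simp add: m_def)
    ultimately have "drop i u @ replicate k 0 \<le> take (m + k) ?w"
      unfolding t using append_le_append_iff by (metis order_le_less)
    then show ?thesis using True by (simp only: e drop_append) simp
  next
    case False
    then have "drop i ?w = replicate (length ?w - i) 0" by auto
    then show ?thesis using i by (simp only:) (intro replicate_zero_le, simp)
  qed
qed

text \<open>Cut after position \<open>m\<close>, a suffix of \<open>u\<close> is smaller than the
  corresponding suffix of \<open>z\<close>, which is at most a prefix of \<open>z\<close>. So
  \<open>u\<close> read from a later start falls below \<open>z\<close> at position \<open>m\<close>
  of \<open>u\<close> at the latest; the nesting of blocks rests on this.\<close>

lemma pren_mismatch_drop:
  assumes "pren z" "mismatch z u m" "e \<le> m"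
  shows "\<exists>m'\<le>m - e. mismatch z (drop e u) m'"
proof -
  have m: "m < length z" "m < length u" "take m u = take m z" "u ! m < z ! m"
    using assms(2) by (auto simp: mismatch_def)
  have "take (Suc m - e) (drop e u) = drop e (take (Suc m) u)" by (simp add: drop_take)
  also have "\<dots> = drop e (take m z) @ [u ! m]"
    using m assms(3) by (simp add: take_Suc_conv_app_nth)
  also have "\<dots> < drop e (take m z) @ [z ! m]"
    using m append_less_append_iff[of "drop e (take m z)" "drop e (take m z)"] by simp
  also have "\<dots> = drop e (take (Suc m) z)" using m assms(3) by (simp add: take_Suc_conv_app_nth)
  also have "\<dots> \<le> take (Suc m - e) z"
    using assms m by (intro pren_suffix_le) auto
  finally have "take (Suc m - e) (drop e u) < take (Suc m - e) z" .
  moreover have "Suc m - e \<le> length (drop e u)" "Suc m - e \<le> length z"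
    using m assms(3) by auto
  ultimately obtain m' where "m' < Suc m - e" "mismatch z (drop e u) m'"
    using mismatch_if_take_less by blast
  then show ?thesis using assms(3) by (intro exI[of _ m']) auto
qed

subsection \<open>Necklaces\<close>

definition max_rot :: "nat list \<Rightarrow> bool" where
  "max_rot w \<longleftrightarrow> (\<forall>r. rotate r w \<le> w)"

definition words :: "nat \<Rightarrow> nat \<Rightarrow> nat list set" where
  "words n t = {w. length w = t \<and> sum_list w < n}"

definition period :: "nat list \<Rightarrow> nat" where
  "period w = (LEAST d. 1 \<le> d \<and> rotate d w = w)"

lemma sum_list_rotate [simp]: "sum_list (rotate r (w::nat list)) = sum_list w"
  by (metis append_take_drop_id rotate_drop_take sum_list_append add.commute)

lemma rotate_in_words [simp]: "rotate r w \<in> words n t \<longleftrightarrow> w \<in> words n t"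
  by (simp add: words_def)

lemma length_in_words: "w \<in> words n t \<Longrightarrow> length w = t"
  by (simp add: words_def)

lemma rotate_eq_rotate_iff: "rotate k a = rotate k b \<longleftrightarrow> a = b"
  by (induction k) (use inj_rotate1 in \<open>auto dest: injD\<close>)

lemma max_rot_pren:
  assumes "max_rot w"
  shows "pren w"
  unfolding pren_def
proof (intro allI impI)
  fix i assume i: "i \<le> length w"
  have "rotate i w \<le> w" using assms by (simp add: max_rot_def)
  then have "take (length w - i) (rotate i w) \<le> take (length w - i) w"
    by (intro take_le_take) auto
  moreover have "take (length w - i) (rotate i w) = drop i w"
    using i by (cases "i = length w") (auto simp: rotate_drop_take)
  ultimately show "drop i w \<le> take (length w - i) w" by simp
qed

lemma max_rot_replicate: "max_rot (replicate t x)"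
proof -
  have "rotate r (replicate t x) = replicate t x" for r by (induction r) auto
  then show ?thesis by (simp add: max_rot_def)
qed

lemma max_rot_iff: "max_rot w \<longleftrightarrow> (\<forall>r<length w. rotate r w \<le> w)"
proof (cases "w = []")
  case False
  then show ?thesis unfolding max_rot_def
    by (metis length_greater_0_conv mod_less_divisor rotate_conv_mod)
qed (simp add: max_rot_def)

lemma max_rot_hd_ge:
  assumes "max_rot w" "x \<in> set w"
  shows "x \<le> hd w"
proof -
  obtain i where i: "i < length w" "w ! i = x" using assms(2) by (auto simp: in_set_conv_nth)
  have r: "rotate i w \<le> w" using assms by (simp add: max_rot_def)
  have "w \<noteq> []" using i by auto
  then obtain y ys where w: "w = y # ys" by (cases w) auto
  have "rotate i w \<noteq> []" using w by simp
  then obtain a as where a: "rotate i w = a # as" by (cases "rotate i w") auto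
  have "a = x" using hd_rotate_conv_nth[OF \<open>w \<noteq> []\<close>, of i] i a by simp
  then show ?thesis using r w a by auto
qed

text \<open>A rotation that starts inside \<open>u @ [y]\<close> loses strictly on the symbols up to
  \<open>y\<close>, by \<open>pren_strict\<close>. One that starts inside the zeros begins with 0,
  while the word begins with a positive symbol unless it is all zero.\<close>

lemma max_rot_lower:
  assumes "pren (u @ [c])" "y < c"
  shows "max_rot (u @ y # replicate k 0)"
  unfolding max_rot_iff
proof (intro allI impI)
  let ?w = "u @ y # replicate k (0::nat)"
  fix r assume r: "r < length ?w"
  consider "r = 0" | "0 < r" "r \<le> length u" | "length u < r" by linarith
  then show "rotate r ?w \<le> ?w"
  proof cases
    case 2
    define a where "a = drop r (u @ [y])"
    define b where "b = take (Suc (length u) - r) (u @ [y])"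
    have ab: "a < b" using pren_strict[OF assms] 2 by (simp add: a_def b_def)
    have "rotate r ?w = a @ (replicate k 0 @ take r u)"
      using r 2 by (simp add: rotate_drop_take a_def)
    moreover have "?w = b @ drop (Suc (length u) - r) (u @ [y]) @ replicate k 0"
      unfolding b_def using append_take_drop_id[of "Suc (length u) - r" "u @ [y]"]
      by (metis append.assoc append_Cons append_Nil)
    moreover have "length a = length b" using 2 by (simp add: a_def b_def)
    ultimately show ?thesis using ab append_le_append_iff by metis
  next
    case 3
    define k' where "k' = k - (r - Suc (length u))"
    have k': "k' > 0" "k' \<le> k" using r 3 by (auto simp: k'_def)
    have rw: "rotate r ?w = replicate k' 0 @ take r ?w"
    proof -
      have "drop r ?w = replicate k' 0" using 3 r by (cases "r - length u") (auto simp: k'_def)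
      then show ?thesis using r by (simp add: rotate_drop_take)
    qed
    obtain k'' where k'': "k' = Suc k''" using k' by (cases k') auto
    show ?thesis
    proof (cases u)
      case Nil
      show ?thesis
      proof (cases "y = 0")
        case True
        then have "?w = replicate (Suc k) 0" using Nil by simp
        moreover have "max_rot (replicate (Suc k) (0::nat))" by (rule max_rot_replicate)
        ultimately show ?thesis by (metis max_rot_def)
      next
        case False
        then show ?thesis unfolding rw k'' using Nil by auto
      qed
    next
      case (Cons v vs)
      have "drop (length u) (u @ [c]) \<le> take (length (u @ [c]) - length u) (u @ [c])"
        using assms(1) unfolding pren_def by (metis le_add1 length_append)
      then have "c \<le> v" using Cons by auto
      then show ?thesis unfolding rw k'' using Cons assms(2) by auto
    qed
  qed simp
qed

lemma ex_max_rot: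
  assumes "w \<noteq> []"
  shows "\<exists>r<length w. max_rot (rotate r w)"
proof -
  let ?A = "(\<lambda>r. rotate r w) ` {..<length w}"
  have "?A \<noteq> {}" using assms by auto
  then have "Max ?A \<in> ?A" by (intro Max_in) auto
  then obtain r where r: "r < length w" "rotate r w = Max ?A" by auto
  have "rotate s (rotate r w) \<le> rotate r w" for s
  proof -
    have "rotate s (rotate r w) = rotate ((s + r) mod length w) w"
      by (metis rotate_rotate rotate_conv_mod)
    then have "rotate s (rotate r w) \<in> ?A" using assms by auto
    then show ?thesis unfolding r(2) by (intro Max_ge) auto
  qed
  then show ?thesis using r(1) by (auto simp: max_rot_def)
qed

subsection \<open>Periods\<close>

lemma per_spec:
  assumes "w \<noteq> []"
  shows "1 \<le> period w" "rotate (period w) w = w" "period w \<le> length w"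
proof -
  have "1 \<le> length w \<and> rotate (length w) w = w"
    using assms by (simp add: Suc_leI)
  then have "1 \<le> period w \<and> rotate (period w) w = w" "period w \<le> length w"
    unfolding period_def by (rule LeastI, intro Least_le)
  then show "1 \<le> period w" "rotate (period w) w = w" "period w \<le> length w" by auto
qed

lemma per_least: "1 \<le> d \<Longrightarrow> rotate d w = w \<Longrightarrow> period w \<le> d"
  unfolding period_def by (rule Least_le) simp

lemma concat_replicate_rotate:
  assumes "w = concat (replicate j u)"
  shows "rotate (length u) w = w"
proof (cases j)
  case (Suc i)
  have "concat (replicate i u) @ u = u @ concat (replicate i u)"
    by (induction i) auto
  then show ?thesis using Suc assms rotate_append[of u "concat (replicate i u)"] by simp
qed (use assms in simp)

text \<open>Rotation by the period exchanges the prefix \<open>?u\<close> and the rest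
  \<open>?v\<close> without changing the word, so the two commute and are powers of a common
  \<open>zs\<close>. Rotating by \<open>length zs\<close> fixes \<open>w\<close>, and minimality of
  the period leaves only \<open>zs = ?u\<close>.\<close>

lemma per_power:
  assumes "w \<noteq> []"
  shows "\<exists>j\<ge>1. w = concat (replicate j (take (period w) w))"
proof -
  let ?u = "take (period w) w" and ?v = "drop (period w) w"
  have "?v @ ?u = w"
    using per_spec[OF assms] by (cases "period w = length w") (auto simp: rotate_drop_take)
  then have "?u @ ?v = ?v @ ?u" by simp
  then obtain m n zs where mn: "concat (replicate m zs) = ?u" "concat (replicate n zs) = ?v"
    using comm_append_are_replicate by blast
  have "concat (replicate (m + n) zs) = ?u @ ?v"
    unfolding replicate_add concat_append mn ..
  then have w: "w = concat (replicate (m + n) zs)" by simp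
  then have zs: "zs \<noteq> []" using assms by (auto simp: concat_replicate_trivial)
  then have "period w \<le> length zs"
    by (intro per_least concat_replicate_rotate[OF w]) (cases zs, auto)
  moreover have "length ?u = m * length zs" unfolding mn(1)[symmetric]
    by (simp add: length_concat sum_list_replicate)
  moreover have u: "length ?u = period w" using per_spec[OF assms] by simp
  ultimately have "m * length zs \<le> 1 * length zs" "m \<noteq> 0"
    using per_spec(1)[OF assms] by (simp, metis mult_0 not_one_le_zero)
  then have "m = 1" using zs by (simp only: mult_le_cancel2) simp
  then have "zs = ?u" using mn(1) by simp
  then show ?thesis using w \<open>m = 1\<close> by (intro exI[of _ "m + n"]) auto
qed

lemma aperiodic_prefix_eq:
  assumes "w \<noteq> []"
  shows "aperiodic_prefix w = take (period w) w"
proof -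
  let ?P = "\<lambda>u. \<exists>j\<ge>1. w = concat (replicate j u)"
  let ?a = "aperiodic_prefix w"
  have "?P ?a \<and> (\<forall>y. ?P y \<longrightarrow> length ?a \<le> length y)"
    unfolding aperiodic_prefix_def by (rule arg_min_nat_lemma) (rule per_power[OF assms])
  then have P: "?P ?a" and l: "length ?a \<le> length (take (period w) w)"
    using per_power[OF assms] by auto
  obtain j where j: "j \<ge> 1" "w = concat (replicate j ?a)" using P by auto
  have "?a \<noteq> []" using assms j(2) by (metis concat_replicate_trivial)
  then have "period w \<le> length ?a"
    by (intro per_least concat_replicate_rotate[OF j(2)]) (cases ?a, auto)
  then have "length ?a = period w" using l by simp
  moreover have "take (length ?a) w = ?a"
    using j by (cases j) (metis One_nat_def not_one_le_zero, metis append_eq_conv_conj concat.simps(2) replicate_Suc)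
  ultimately show ?thesis by simp
qed

lemma rotate_mult_per: "w \<noteq> [] \<Longrightarrow> rotate (q * period w) w = w"
  by (induction q) (simp_all add: rotate_rotate[symmetric] per_spec add.commute)

lemma rotate_mod_per:
  assumes "w \<noteq> []"
  shows "rotate r w = rotate (r mod period w) w"
proof -
  have "rotate r w = rotate (r mod period w + (r div period w) * period w) w" by simp
  also have "\<dots> = rotate (r mod period w) w"
    by (simp only: rotate_rotate[symmetric] rotate_mult_per[OF assms])
  finally show ?thesis .
qed

section \<open>Rotation classes and their sizes\<close>

definition rotations :: "nat list \<Rightarrow> nat list set" where
  "rotations w = range (\<lambda>r. rotate r w)"

lemma rotations_self: "w \<in> rotations w"
  unfolding rotations_def by (metis id_apply range_eqI rotate0)

lemma card_rotations:
  assumes "w \<noteq> []"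
  shows "card (rotations w) = period w"
proof -
  have "rotations w = (\<lambda>r. rotate r w) ` {..<period w}"
  proof -
    have "rotate r w \<in> (\<lambda>r. rotate r w) ` {..<period w}" for r
      using rotate_mod_per[OF assms, of r] per_spec(1)[OF assms]
      by (intro image_eqI[of _ _ "r mod period w"]) auto
    then show ?thesis by (auto simp: rotations_def)
  qed
  moreover have "inj_on (\<lambda>r. rotate r w) {..<period w}"
  proof -
    have *: "i = j" if "i \<le> j" "j < period w" "rotate i w = rotate j w" for i j
    proof (rule ccontr)
      assume "i \<noteq> j"
      have "rotate i (rotate (j - i) w) = rotate i w" using that by (simp add: rotate_rotate)
      then have "rotate (j - i) w = w" by (simp add: rotate_eq_rotate_iff)
      then have "period w \<le> j - i" using that \<open>i \<noteq> j\<close> by (intro per_least) auto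
      then show False using that \<open>i \<noteq> j\<close> by auto
    qed
    show ?thesis by (intro inj_onI) (metis * lessThan_iff linear)
  qed
  ultimately show ?thesis by (simp add: card_image)
qed

lemma rotations_subset_words: "w \<in> words n t \<Longrightarrow> rotations w \<subseteq> words n t"
  by (auto simp: rotations_def)

lemma rotate_inverse: "\<exists>s. rotate s (rotate r w) = w"
proof (cases "w = []")
  case False
  then have "rotate (length w - r mod length w) (rotate (r mod length w) w) = w"
    by (simp add: rotate_rotate less_imp_le)
  then show ?thesis by (metis rotate_conv_mod)
qed simp

lemma rotations_rotate: "rotations (rotate r w) = rotations w"
proof -
  obtain s where s: "rotate s (rotate r w) = w" using rotate_inverse by blast
  show ?thesis unfolding rotations_def
  proof (intro equalityI subsetI)
    fix x assume "x \<in> range (\<lambda>i. rotate i w)"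
    then obtain i where "x = rotate i w" by auto
    then have "x = rotate (i + s) (rotate r w)" by (simp add: rotate_rotate[symmetric] s)
    then show "x \<in> range (\<lambda>i. rotate i (rotate r w))" by blast
  qed (auto simp: rotate_rotate)
qed

lemma rotations_eq: "x \<in> rotations v \<Longrightarrow> rotations x = rotations v"
  by (metis rangeE rotations_def rotations_rotate)

lemma max_rot_unique:
  assumes "max_rot a" "max_rot b" "a \<in> rotations b"
  shows "a = b"
proof -
  have "a \<le> b" using assms by (auto simp: rotations_def max_rot_def)
  moreover have "b \<in> rotations a" using assms(3) rotations_rotate rotations_self
    by (auto simp: rotations_def)
  then have "b \<le> a" using assms by (auto simp: rotations_def max_rot_def)
  ultimately show ?thesis by simp
qed

text \<open>As a power of its aperiodic prefix, the word also ends with it. Windows that cross the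
  end of a necklace are read off with this.\<close>

lemma per_suffix:
  assumes "w \<noteq> []"
  shows "drop (length w - period w) w = take (period w) w"
proof -
  obtain j where "j \<ge> 1" "w = concat (replicate j (take (period w) w))"
    using per_power[OF assms] by auto
  then obtain i where i: "w = concat (replicate (Suc i) (take (period w) w))" by (cases j) auto
  then have "w = concat (replicate i (take (period w) w)) @ take (period w) w"
    by (metis replicate_app_Cons_same concat_append append_Nil2 concat.simps replicate_Suc)
  then obtain v where v: "w = v @ take (period w) w" by blast
  then have "length w = length v + period w" using per_spec[OF assms]
    by (metis length_append length_take min.absorb2)
  then show ?thesis using v by (metis add_diff_cancel_right' append_eq_conv_conj)
qed

subsection \<open>The concatenation of the aperiodic prefixes\<close>

lemma finite_words: "finite (words n t)"
proof -
  have "words n t \<subseteq> {w. set w \<subseteq> {..<n} \<and> length w = t}"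
    using member_le_sum_list by (fastforce simp: words_def)
  then show ?thesis using finite_lists_length_eq[of "{..<n}" t] finite_subset by blast
qed

text \<open>A slack symbol in front turns the bound on the sum into an equation, whose solutions are
  counted by stars and bars.\<close>

lemma card_words:
  assumes "1 \<le> n"
  shows "card (words n t) = (n + t - 1) choose t"
proof -
  let ?f = "\<lambda>w. (n - 1 - sum_list w) # w"
  have "bij_betw ?f (words n t) {l. length l = Suc t \<and> sum_list l = n - 1}"
    by (rule bij_betw_byWitness[where f' = tl]) (use assms in \<open>auto simp: words_def length_Suc_conv\<close>)
  then have "card (words n t) = card {l::nat list. length l = Suc t \<and> sum_list l = n - 1}"
    by (rule bij_betw_same_card)
  also have "\<dots> = (n - 1 + Suc t - 1) choose (n - 1)" by (rule card_length_sum_list)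
  also have "n - 1 + Suc t - 1 = n + t - 1" using assms by simp
  also have "(n + t - 1) choose (n - 1) = (n + t - 1) choose t"
    using assms binomial_symmetric[of t "n + t - 1"] by simp
  finally show ?thesis .
qed

definition necks :: "nat \<Rightarrow> nat \<Rightarrow> nat list set" where
  "necks n t = {w \<in> words n t. max_rot w}"

definition neck_list :: "nat \<Rightarrow> nat \<Rightarrow> nat list list" where
  "neck_list n t = rev (sorted_list_of_set (necks n t))"

definition root_concat :: "nat list list \<Rightarrow> nat list" where
  "root_concat xs = concat (map (\<lambda>w. take (period w) w) xs)"

definition below :: "nat \<Rightarrow> nat list \<Rightarrow> nat" where
  "below n z = card {w \<in> words n (length z). \<forall>r. rotate r w < z}"

lemma cat_simps [simp]:
  "root_concat [] = []" "root_concat (w # xs) = take (period w) w @ root_concat xs" "root_concat (xs @ ys) = root_concat xs @ root_concat ys"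
  by (simp_all add: root_concat_def)

lemma finite_necks: "finite (necks n t)"
  using finite_words[of n t] by (simp add: necks_def)

lemma set_neck_list [simp]: "set (neck_list n t) = necks n t"
  by (simp add: neck_list_def finite_necks)

lemma distinct_neck_list: "distinct (neck_list n t)"
  by (simp add: neck_list_def)

lemma sorted_neck_list: "sorted_wrt (>) (neck_list n t)"
proof -
  have "sorted_wrt (<) (sorted_list_of_set (necks n t))"
    by simp
  then show ?thesis by (simp add: neck_list_def sorted_wrt_rev)
qed

lemma neck_list_split:
  assumes "neck_list n t = A @ b # B"
  shows "\<gamma> \<in> necks n t \<Longrightarrow> b < \<gamma> \<longleftrightarrow> \<gamma> \<in> set A" "\<gamma> \<in> necks n t \<Longrightarrow> \<gamma> < b \<longleftrightarrow> \<gamma> \<in> set B"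
    "b \<in> necks n t"
proof -
  have s: "\<gamma> \<in> necks n t \<longleftrightarrow> \<gamma> \<in> set A \<or> \<gamma> = b \<or> \<gamma> \<in> set B" for \<gamma>
    using set_neck_list[of n t] unfolding assms by auto
  have o: "\<And>x. x \<in> set A \<Longrightarrow> b < x" "\<And>x. x \<in> set B \<Longrightarrow> x < b"
    using sorted_neck_list[of n t] unfolding assms by (auto simp: sorted_wrt_append)
  show "b < \<gamma> \<longleftrightarrow> \<gamma> \<in> set A" "\<gamma> < b \<longleftrightarrow> \<gamma> \<in> set B" if "\<gamma> \<in> necks n t"
    using s[of \<gamma>] o[of \<gamma>] that by (metis less_asym less_irrefl)+
  show "b \<in> necks n t" using s by blast
qed

lemma necks_words: "w \<in> necks n t \<Longrightarrow> w \<in> words n t"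
  and necks_max_rot: "w \<in> necks n t \<Longrightarrow> max_rot w"
  and necks_length: "w \<in> necks n t \<Longrightarrow> length w = t"
  by (auto simp: necks_def words_def)

text \<open>The aperiodic prefix of a necklace is as long as its rotation class is large, and the
  classes of distinct necklaces are disjoint.\<close>

lemma length_cat:
  assumes "distinct xs" "set xs \<subseteq> necks n t" "1 \<le> t"
  shows "length (root_concat xs) = card (\<Union>(rotations ` set xs))"
  using assms
proof (induction xs)
  case (Cons w xs)
  have w: "w \<in> necks n t" "w \<noteq> []" using Cons.prems by (auto simp: necks_def words_def)
  have f: "finite (rotations v)" if "v \<in> necks n t" for v
    using that rotations_subset_words[of v n t] finite_subset[OF _ finite_words[of n t]]
    by (auto simp: necks_def)
  have "rotations w \<inter> \<Union>(rotations ` set xs) = {}"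
  proof (rule ccontr)
    assume "rotations w \<inter> \<Union>(rotations ` set xs) \<noteq> {}"
    then obtain v x where v: "v \<in> set xs" "x \<in> rotations v" "x \<in> rotations w" by auto
    then have "rotations v = rotations w" using rotations_eq by metis
    then have "v \<in> rotations w" using rotations_self by auto
    moreover have "v \<in> necks n t" using v Cons.prems by auto
    ultimately have "v = w" using max_rot_unique w necks_max_rot by blast
    then show False using v Cons.prems by simp
  qed
  then have "card (\<Union>(rotations ` set (w # xs))) = card (rotations w) + card (\<Union>(rotations ` set xs))"
    using Cons.prems f by (subst card_Un_disjoint[symmetric]) auto
  then show ?case using Cons w card_rotations[of w] per_spec[of w] by simp
qed simp

text \<open>As soon as some rotation of a word is at least \<open>z\<close>, its largest rotation
  is, and that one is a necklace.\<close>

lemma Union_rotations_necks: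
  assumes "1 \<le> t"
  shows "\<Union>(rotations ` {\<gamma> \<in> necks n t. z \<le> \<gamma>}) = {w \<in> words n t. \<exists>r. z \<le> rotate r w}"
proof (intro equalityI subsetI)
  fix w assume "w \<in> \<Union>(rotations ` {\<gamma> \<in> necks n t. z \<le> \<gamma>})"
  then obtain \<gamma> r where *: "\<gamma> \<in> necks n t" "z \<le> \<gamma>" "w = rotate r \<gamma>" by (auto simp: rotations_def)
  moreover obtain s where "rotate s w = \<gamma>" using rotate_inverse * by blast
  then have "z \<le> rotate s w" using * by simp
  ultimately show "w \<in> {w \<in> words n t. \<exists>r. z \<le> rotate r w}" by (auto simp: necks_def)
next
  fix w assume "w \<in> {w \<in> words n t. \<exists>r. z \<le> rotate r w}"
  then obtain r where w: "w \<in> words n t" "z \<le> rotate r w" by auto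
  then have "w \<noteq> []" using assms by (auto simp: words_def)
  then obtain s where s: "max_rot (rotate s w)" using ex_max_rot by blast
  have "rotate r w \<in> rotations (rotate s w)" by (auto simp: rotations_rotate) (auto simp: rotations_def)
  then have "rotate r w \<le> rotate s w" using s by (auto simp: rotations_def max_rot_def)
  then have "rotate s w \<in> {\<gamma> \<in> necks n t. z \<le> \<gamma>}" using w s by (auto simp: necks_def)
  moreover have "w \<in> rotations (rotate s w)" by (simp add: rotations_rotate rotations_self)
  ultimately show "w \<in> \<Union>(rotations ` {\<gamma> \<in> necks n t. z \<le> \<gamma>})" by blast
qed

text \<open>The bridge between positions and counts. \<open>z\<close> is an arbitrary word of length
  \<open>t\<close> because ranking applies it to thresholds, which are prenecklaces but not always
  necklaces.\<close>

lemma length_cat_ge: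
  assumes "1 \<le> t" "length z = t"
  shows "length (root_concat (filter (\<lambda>\<gamma>. z \<le> \<gamma>) (neck_list n t))) + below n z = card (words n t)"
proof -
  have "length (root_concat (filter (\<lambda>\<gamma>. z \<le> \<gamma>) (neck_list n t))) = card {w \<in> words n t. \<exists>r. z \<le> rotate r w}"
    using assms distinct_neck_list
    by (subst length_cat) (auto simp: Union_rotations_necks[symmetric])
  moreover have "card {w \<in> words n t. \<exists>r. z \<le> rotate r w} + below n z
    = card ({w \<in> words n t. \<exists>r. z \<le> rotate r w} \<union> {w \<in> words n t. \<forall>r. rotate r w < z})"
    unfolding below_def assms(2)
    by (subst card_Un_disjoint) (auto simp: finite_words not_less[symmetric])
  moreover have "{w \<in> words n t. \<exists>r. z \<le> rotate r w} \<union> {w \<in> words n t. \<forall>r. rotate r w < z} = words n t"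
    by (auto simp: not_less[symmetric])
  ultimately show ?thesis by simp
qed

lemma zeros_in_necks: "1 \<le> n \<Longrightarrow> replicate t 0 \<in> necks n t"
  by (simp add: necks_def words_def max_rot_replicate sum_list_replicate)

lemma length_cat_neck_list:
  assumes "1 \<le> n" "1 \<le> t"
  shows "length (root_concat (neck_list n t)) = card (words n t)"
proof -
  have "\<not> rotate r w < replicate t 0" if "w \<in> words n t" for w r
    using replicate_zero_le[of "rotate r w" t] that by (simp add: words_def not_less)
  then have "{w \<in> words n t. \<forall>r. rotate r w < replicate t 0} = {}" by auto
  then have "below n (replicate t 0) = 0" unfolding below_def
    by (metis card.empty length_replicate)
  moreover have "filter (\<lambda>\<gamma>. replicate t 0 \<le> \<gamma>) (neck_list n t) = neck_list n t"
    using replicate_zero_le by (auto simp: filter_id_conv necks_def words_def)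
  ultimately show ?thesis using length_cat_ge[of t "replicate t 0" n] assms by simp
qed

lemma length_cat_upto:
  assumes "neck_list n t = A @ b # B" "1 \<le> t"
  shows "length (root_concat A) + period b + below n b = card (words n t)"
proof -
  have b: "b \<in> necks n t" using neck_list_split[OF assms(1)] by simp
  then have "length b = t" "b \<noteq> []" using assms(2) by (auto simp: necks_def words_def)
  have "filter (\<lambda>\<gamma>. b \<le> \<gamma>) (neck_list n t) = A @ [b]"
  proof -
    have "\<forall>x\<in>set A. b < x" "\<forall>x\<in>set B. x < b"
      using sorted_neck_list[of n t] unfolding assms(1) by (auto simp: sorted_wrt_append)
    then have "filter (\<lambda>\<gamma>. b \<le> \<gamma>) A = A" "filter (\<lambda>\<gamma>. b \<le> \<gamma>) B = []"
      by (auto simp: filter_empty_conv intro!: filter_True less_imp_le)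
    then show ?thesis unfolding assms(1) by simp
  qed
  then show ?thesis using length_cat_ge[OF assms(2) \<open>length b = t\<close>, of n] per_spec[OF \<open>b \<noteq> []\<close>]
    by simp
qed

text \<open>Lowering the last nonzero symbol \<open>c\<close> by one gives a necklace
  \<open>g < b\<close>. The successor lies between \<open>g\<close> and \<open>b\<close>, and both
  of these begin with \<open>u\<close>.\<close>

lemma neck_list_successor:
  assumes "neck_list n t = A @ b # b' # B" "b = u @ c # replicate k 0" "0 < c"
  shows "take (length u) b' = u"
proof -
  have s: "neck_list n t = (A @ [b]) @ b' # B" using assms(1) by simp
  have b: "b \<in> necks n t" "b' \<in> necks n t"
    using neck_list_split[OF assms(1)] neck_list_split[OF s] by auto
  have lt: "b' < b" using neck_list_split(1)[OF s b(1)] by simp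
  define g where "g = u @ (c - 1) # replicate k 0"
  have "pren (take (Suc (length u)) b)" using b by (intro pren_take max_rot_pren) (simp add: necks_def)
  then have "pren (u @ [c])" using assms(2) by simp
  then have "max_rot g" unfolding g_def using assms(3) by (intro max_rot_lower[of u c]) auto
  then have g: "g \<in> necks n t" using b(1) assms(2,3) by (auto simp: g_def necks_def words_def)
  have "g < b" unfolding g_def assms(2) using assms(3) by (simp add: append_less_append_iff)
  then have "g \<in> set (b' # B)" using neck_list_split(2)[OF assms(1) g] by simp
  then have le: "g \<le> b'" using neck_list_split(2)[OF s g] by auto
  have l: "length b = t" "length b' = t" "length g = t" using b g by (auto simp: necks_def words_def)
  have "take (length u) g \<le> take (length u) b'" "take (length u) b' \<le> take (length u) b"
    using le lt l by (auto intro!: take_le_take)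
  then show ?thesis by (simp add: g_def assms(2))
qed

lemma last_nonzero:
  assumes "\<exists>x\<in>set w. x \<noteq> (0::nat)"
  shows "\<exists>u c k. w = u @ c # replicate k 0 \<and> 0 < c"
  using assms
proof (induction w rule: rev_induct)
  case (snoc x w)
  show ?case
  proof (cases "x = 0")
    case True
    then obtain u c k where "w = u @ c # replicate k 0" "0 < c" using snoc by auto
    then show ?thesis using True
      by (intro exI[of _ u] exI[of _ c] exI[of _ "Suc k"]) (simp add: replicate_append_same)
  next
    case False
    then show ?thesis by (intro exI[of _ w] exI[of _ x] exI[of _ 0]) simp
  qed
qed simp

lemma nonzero_words:
  "length w = t \<Longrightarrow> w \<noteq> replicate t 0 \<Longrightarrow> \<exists>x\<in>set w. x \<noteq> (0::nat)"
  by (metis replicate_eqI)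

text \<open>Otherwise the last \<open>period w\<close> symbols would all be zero; they are the
  aperiodic prefix, which repeats throughout the word.\<close>

lemma per_gt_zeros:
  assumes "w = u @ c # replicate k 0" "0 < c"
  shows "k < period w"
proof (rule ccontr)
  have ne: "w \<noteq> []" using assms by simp
  assume "\<not> k < period w"
  then have "take (period w) w = drop (length w - period w) (u @ c # replicate k 0)"
    using per_suffix[OF ne] assms(1) by simp
  also have "\<dots> = drop (k - period w) (replicate k 0)"
    using \<open>\<not> k < period w\<close> assms(1) by (simp add: Suc_diff_le)
  finally have z: "take (period w) w = replicate (period w) 0" using \<open>\<not> k < period w\<close> by simp
  obtain j where "w = concat (replicate j (take (period w) w))" using per_power[OF ne] by auto
  then have "set w = (\<Union>v\<in>set (replicate j (take (period w) w)). set v)"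
    by (metis set_concat)
  then have "set w \<subseteq> set (take (period w) w)" by (auto split: if_splits)
  then have "c \<in> set (replicate (period w) (0::nat))" using assms(1) unfolding z by auto
  then show False using assms(2) by auto
qed

lemma neck_list_next:
  assumes "neck_list n t = A @ b # B" "b \<noteq> replicate t 0" "1 \<le> n"
  shows "\<exists>b' B'. B = b' # B'"
proof -
  have z: "replicate t 0 \<in> necks n t" using zeros_in_necks[OF assms(3)] .
  have b: "b \<in> necks n t" using neck_list_split[OF assms(1)] by simp
  then have "replicate t 0 < b" using replicate_zero_le[of b t] assms(2)
    by (auto simp: necks_def words_def)
  then have "replicate t 0 \<in> set B" using neck_list_split(2)[OF assms(1) z] by simp
  then show ?thesis by (cases B) auto
qed

text \<open>Periodic necklaces are completed by the necklaces that follow them.\<close>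

lemma cat_starts_with:
  assumes "neck_list n t = A @ b # B" "b \<noteq> replicate t 0" "1 \<le> n" "1 \<le> t"
  shows "\<exists>E. root_concat (b # B) = b @ E"
  using assms(1,2)
proof (induction B arbitrary: A b)
  case Nil
  then show ?case using neck_list_next assms by fastforce
next
  case (Cons b' B)
  have s: "neck_list n t = (A @ [b]) @ b' # B" using Cons.prems by simp
  have b: "b \<in> necks n t" "b' \<in> necks n t"
    using neck_list_split[OF Cons.prems(1)] neck_list_split[OF s] by auto
  then have l: "length b = t" "length b' = t" by (auto simp: necks_def words_def)
  then have ne: "b \<noteq> []" "b' \<noteq> []" using assms by auto
  obtain u c k where u: "b = u @ c # replicate k 0" "0 < c"
    using nonzero_words[OF l(1) Cons.prems(2)] last_nonzero by blast
  have k: "k < period b" using per_gt_zeros[OF u] .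
  have t: "take (length u) b' = u" using neck_list_successor[OF Cons.prems(1) u] .
  let ?p = "period b"
  have p: "1 \<le> ?p" "?p \<le> t" using per_spec[OF ne(1)] l by auto
  \<comment> \<open>Since \<open>k < ?p\<close>, at most \<open>?p\<close> symbols of
    \<open>b\<close> lie after \<open>u\<close>, and the next necklace shares
    \<open>u\<close>.\<close>
  have tb: "take (t - ?p) b' = take (t - ?p) b"
  proof -
    have "t - ?p \<le> length u" using k l u by simp
    then have "take (t - ?p) b' = take (t - ?p) (take (length u) b')" by (simp add: min_def)
    also have "\<dots> = take (t - ?p) b" using t u \<open>t - ?p \<le> length u\<close> by simp
    finally show ?thesis .
  qed
  have rot: "b = take ?p b @ take (t - ?p) b"
  proof -
    have "drop ?p b @ take ?p b = b"
      using per_spec[OF ne(1)] l by (cases "?p = t") (auto simp: rotate_drop_take)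
    then have "take (t - ?p) b = drop ?p b" using l
      by (metis append_eq_conv_conj length_drop)
    then show ?thesis by simp
  qed
  have "\<exists>E. root_concat (b' # B) = take (t - ?p) b @ E"
  \<comment> \<open>The zero necklace contributes a single symbol only, but its predecessor is
    aperiodic and has nothing left to complete: otherwise it would start with 0 and hence be
    zero.\<close>
  proof (cases "b' = replicate t 0")
    case True
    show ?thesis
    proof (cases "?p = t")
      case False
      have "0 < t - ?p" using False p by simp
      have "hd (take (t - ?p) b') = 0" using \<open>0 < t - ?p\<close> True assms(4) by (cases t) auto
      then have "hd b = 0" using tb \<open>0 < t - ?p\<close> by simp
      then have "\<forall>x\<in>set b. x = 0" using max_rot_hd_ge[of b] b by (auto simp: necks_def)
      then show ?thesis using u by auto
    qed simp
  next
    case False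
    then obtain E where "root_concat (b' # B) = b' @ E" using Cons.IH[OF s] by auto
    then have "root_concat (b' # B) = take (t - ?p) b' @ (drop (t - ?p) b' @ E)" by simp
    then show ?thesis unfolding tb by blast
  qed
  then obtain E where "root_concat (b' # B) = take (t - ?p) b @ E" by auto
  then have "root_concat (b # b' # B) = b @ E" using rot by (metis append.assoc cat_simps(2))
  then show ?case by blast
qed

subsection \<open>Positions of words\<close>

lemma cyclic_substring_mid:
  assumes "D = a @ s @ b" "length s = t"
  shows "cyclic_substring D t (Suc (length a)) = s"
  by (rule nth_equalityI) (use assms in \<open>auto simp: cyclic_substring_def nth_append\<close>)

text \<open>The reduction of \<open>p\<close> takes effect for empty \<open>y\<close>, where the
  window starts at the beginning of \<open>D\<close>.\<close>

lemma cyclic_substring_wrap: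
  assumes "D = a @ y" "D = x @ b" "length y + length x = t" "p = length a mod length D"
  shows "cyclic_substring D t (Suc p) = y @ x"
proof (rule nth_equalityI)
  show "length (cyclic_substring D t (Suc p)) = length (y @ x)"
    using assms by (simp add: cyclic_substring_def)
  fix j assume "j < length (cyclic_substring D t (Suc p))"
  then have j: "j < t" by (simp add: cyclic_substring_def)
  then have e: "cyclic_substring D t (Suc p) ! j = D ! ((length a + j) mod length D)"
    using assms(4) by (simp add: cyclic_substring_def mod_add_left_eq)
  show "cyclic_substring D t (Suc p) ! j = (y @ x) ! j"
  proof (cases "j < length y")
    case True
    then have "(length a + j) mod length D = length a + j" using assms(1) by simp
    then show ?thesis unfolding e using True assms(1) by (simp add: nth_append)
  next
    case False
    then have "length a + j = length D + (j - length y)" using assms(1) by simp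
    moreover have "j - length y < length x" "length x \<le> length D"
      using False j assms(3) by (auto simp: assms(2))
    ultimately have "(length a + j) mod length D = j - length y"
      by (metis mod_add_self1 mod_less order_less_le_trans)
    then have "cyclic_substring D t (Suc p) ! j = D ! (j - length y)" using e by simp
    also have "\<dots> = (y @ x) ! j"
      unfolding assms(2) using False \<open>j - length y < length x\<close> by (simp add: nth_append)
    finally show ?thesis .
  qed
qed

lemma split_necks: "b \<in> necks n t \<Longrightarrow> \<exists>A B. neck_list n t = A @ b # B"
  by (metis set_neck_list split_list)

lemma per_zeros: "1 \<le> t \<Longrightarrow> period (replicate t (0::nat)) = 1"
  using per_least[of 1 "replicate t (0::nat)"] per_spec(1)[of "replicate t (0::nat)"] by auto

lemma max_rot_single: "max_rot (c # replicate k 0)"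
proof -
  have "pren [Suc c]" by (auto simp: pren_def le_Suc_eq)
  then show ?thesis using max_rot_lower[of "[]" "Suc c" c k] by simp
qed

text \<open>The predecessor shares everything before its last nonzero symbol with the zero word. If
  this part were nonempty, the predecessor would start with 0, but a necklace starting with 0 is
  zero.\<close>

lemma before_zeros:
  assumes "neck_list n t = A @ b # replicate t 0 # B" "1 \<le> n" "1 \<le> t"
  shows "\<exists>c>0. b = c # replicate (t - 1) 0"
proof -
  have s: "neck_list n t = (A @ [b]) @ replicate t 0 # B" using assms(1) by simp
  have b: "b \<in> necks n t" using neck_list_split[OF assms(1)] by simp
  then have l: "length b = t" by (rule necks_length)
  have "replicate t 0 < b" using neck_list_split(1)[OF s b] by simp
  then obtain u c k where u: "b = u @ c # replicate k 0" "0 < c"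
    using nonzero_words[OF l] last_nonzero by blast
  have tu: "take (length u) (replicate t 0) = u" using neck_list_successor[OF assms(1) u] .
  have "u = []"
  proof (rule ccontr)
    assume "u \<noteq> []"
    then have "hd b = hd u" using u by simp
    also have "\<dots> = 0" using \<open>u \<noteq> []\<close> assms(3) by (subst tu[symmetric]) (cases t; cases u; auto)
    finally have "c \<le> 0" using max_rot_hd_ge[of b c] b u by (auto simp: necks_def)
    then show False using u by simp
  qed
  then show ?thesis using u l by (intro exI[of _ c]) auto
qed

text \<open>The last necklace before the zero word is a positive symbol followed by
  \<open>t - 1\<close> zeros. It is aperiodic, so all these zeros appear, and the zero necklace adds
  one more. Windows that run over the end of the sequence depend on this.\<close>

lemma cat_ends_with_zeros:
  assumes "2 \<le> n" "1 \<le> t"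
  shows "\<exists>D'. D' \<noteq> [] \<and> root_concat (neck_list n t) = D' @ replicate t 0"
proof -
  have z: "replicate t 0 \<in> necks n t" using zeros_in_necks assms by simp
  then obtain A B where s: "neck_list n t = A @ replicate t 0 # B" using split_necks by blast
  have "B = []"
  proof (rule ccontr)
    assume "B \<noteq> []"
    then obtain g where g: "g \<in> set B" by (cases B) auto
    then have "g \<in> necks n t" using set_neck_list[of n t] unfolding s by auto
    then have "g < replicate t 0" "length g = t"
      using neck_list_split(2)[OF s] g necks_length by auto
    then show False using replicate_zero_le[of g t] by (simp add: not_less[symmetric])
  qed
  have "1 # replicate (t - 1) 0 \<in> necks n t"
    using assms max_rot_single[of 1] by (simp add: necks_def words_def sum_list_replicate)
  moreover have "replicate t (0::nat) < 1 # replicate (t - 1) 0" using assms by (cases t) auto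
  ultimately have "A \<noteq> []" using neck_list_split(1)[OF s] by fastforce
  then obtain A' b where A: "A = A' @ [b]" by (cases A rule: rev_cases) auto
  then obtain c where c: "0 < c" "b = c # replicate (t - 1) 0"
    using before_zeros[of n t A' b B] s assms by auto
  have "t - 1 < period b" using per_gt_zeros[of b "[]"] c by simp
  then have "take (period b) b = b" using c by simp
  then have "root_concat (neck_list n t) = (root_concat A' @ [c]) @ replicate (t - 1) 0 @ [0]"
    unfolding s A using \<open>B = []\<close> per_zeros[OF assms(2)] assms(2) c
    by (simp add: take_Cons')
  also have "replicate (t - 1) 0 @ [0] = replicate t (0::nat)"
    using assms(2) by (cases t) (auto simp: replicate_append_same)
  finally show ?thesis by blast
qed

lemma drop_take_per:
  assumes "b \<noteq> []" "j \<le> period b"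
  shows "drop (period b - j) (take (period b) b) = drop (length b - j) b"
proof -
  have "drop (period b - j) (take (period b) b) = drop (period b - j) (drop (length b - period b) b)"
    using per_suffix[OF assms(1)] by simp
  also have "\<dots> = drop (length b - j) b" using assms per_spec[OF assms(1)] by (simp add: add.commute)
  finally show ?thesis .
qed

text \<open>Because \<open>j \<le> period b\<close>, the last \<open>j\<close> symbols contributed
  by \<open>b\<close> are the last \<open>j\<close> symbols of \<open>b\<close> itself. What follows
  starts with \<open>b'\<close>, except that the zero necklace contributes one symbol only; then the
  window has to end with \<open>b\<close>.\<close>

lemma window_at_end_of_neck:
  assumes s: "neck_list n t = A @ b # b' # B" and n: "1 \<le> n" "1 \<le> t"
    and j: "j \<le> period b" and b': "b' \<noteq> replicate t 0 \<or> j = t"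
  shows "cyclic_substring (root_concat (neck_list n t)) t (Suc (length (root_concat A) + period b - j))
    = drop (t - j) b @ take (t - j) b'"
proof -
  have "b \<in> necks n t" using neck_list_split[OF s] by simp
  then have l: "length b = t" "b \<noteq> []" using n by (auto simp: necks_def words_def)
  have s': "neck_list n t = (A @ [b]) @ b' # B" using s by simp
  have jt: "j \<le> t" using j per_spec[OF l(2)] l by simp
  have l': "length b' = t" using neck_list_split[OF s'] necks_length by blast
  have "\<exists>E. root_concat (b' # B) = take (t - j) b' @ E"
  proof (cases "b' = replicate t 0")
    case False
    then obtain E where "root_concat (b' # B) = b' @ E" using cat_starts_with[OF s' _ n] by auto
    then have "root_concat (b' # B) = take (t - j) b' @ (drop (t - j) b' @ E)" by simp
    then show ?thesis by blast
  qed (use b' in simp)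
  then obtain E where E: "root_concat (b' # B) = take (t - j) b' @ E" by auto
  have tp: "take (period b) b = take (period b - j) b @ drop (t - j) b"
    using drop_take_per[OF l(2) j] l append_take_drop_id[of "period b - j" "take (period b) b"]
    by (simp add: min_def)
  have "root_concat (neck_list n t) = root_concat A @ take (period b) b @ root_concat (b' # B)" unfolding s by simp
  also have "\<dots> = (root_concat A @ take (period b - j) b) @ (drop (t - j) b @ take (t - j) b') @ E"
    unfolding E tp by simp
  finally have *: "root_concat (neck_list n t) =
    (root_concat A @ take (period b - j) b) @ (drop (t - j) b @ take (t - j) b') @ E" .
  have "length (root_concat A @ take (period b - j) b) = length (root_concat A) + period b - j"
    using j per_spec[OF l(2)] by simp
  then have "cyclic_substring (root_concat (neck_list n t)) t (Suc (length (root_concat A @ take (period b - j) b)))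
    = drop (t - j) b @ take (t - j) b'"
    using cyclic_substring_mid[OF *, of t] l' jt l by simp
  then show ?thesis using \<open>length (root_concat A @ take (period b - j) b) = length (root_concat A) + period b - j\<close> by metis
qed

lemma window_nonzero:
  assumes b: "x @ y \<in> necks n t" and n: "1 \<le> n" "1 \<le> t"
    and y: "\<exists>a\<in>set y. a \<noteq> 0" "length y \<le> period (x @ y)"
  shows "cyclic_substring (root_concat (neck_list n t)) t
    (Suc (card (words n t) - below n (x @ y) - length y)) = y @ x"
proof -
  define b where "b = x @ y"
  have bn: "b \<in> necks n t" using b by (simp add: b_def)
  then have l: "length b = t" by (rule necks_length)
  then have lx: "t - length y = length x" by (simp add: b_def)
  have "\<exists>a\<in>set b. a \<noteq> 0" using y b_def by auto
  then obtain u c k where u: "b = u @ c # replicate k 0" "0 < c" using last_nonzero by blast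
  then have nz: "b \<noteq> replicate t 0" by (metis in_set_conv_decomp in_set_replicate less_irrefl)
  obtain A B where "neck_list n t = A @ b # B" using split_necks[OF bn] by auto
  then obtain b' B' where s: "neck_list n t = A @ b # b' # B'" using neck_list_next nz n by metis
  \<comment> \<open>The last nonzero symbol of \<open>b\<close> lies in \<open>y\<close>, so
    \<open>x\<close> is part of the prefix \<open>u\<close> that the next necklace shares.\<close>
  have "k < length y"
  proof (rule ccontr)
    assume "\<not> k < length y"
    then have "y = drop (length x) (u @ c # replicate k 0)" "length u < length x"
      using u l lx b_def by (metis append_eq_conv_conj, simp)
    then have "y = drop (length x - Suc (length u)) (replicate k 0)"
      by (cases "length x - length u") (auto simp: drop_Cons')
    then show False using y by auto
  qed
  then have xu: "length x \<le> length u" using u b_def l lx by simp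
  have "take (length u) b' = u" using neck_list_successor[OF s u] .
  then have "take (length x) b' = take (length x) u" using xu
    by (metis min.absorb1 take_take)
  also have "\<dots> = take (length x) b" using u xu by simp
  finally have tx: "take (length x) b' = x" by (simp add: b_def)
  have "b' \<noteq> replicate t 0 \<or> length y = t"
  proof (rule ccontr)
    assume "\<not> (b' \<noteq> replicate t 0 \<or> length y = t)"
    then have *: "b' = replicate t 0" "x \<noteq> []" using lx b_def l by auto
    then have "hd b = 0" using tx b_def n
      by (metis hd_append2 hd_replicate hd_take length_greater_0_conv not_one_le_zero)
    then have "c \<le> 0" using max_rot_hd_ge[of b c] bn u by (auto simp: necks_def)
    then show False using u by simp
  qed
  then have "cyclic_substring (root_concat (neck_list n t)) t (Suc (length (root_concat A) + period b - length y)) = y @ x"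
    using window_at_end_of_neck[OF s n, of "length y"] y(2) lx tx by (simp add: b_def)
  moreover have "length (root_concat A) + period b + below n b = card (words n t)"
    using length_cat_upto[OF s n(2)] .
  then have "length (root_concat A) + period b = card (words n t) - below n b" by linarith
  ultimately show ?thesis by (simp add: b_def)
qed

lemma neck_list_filter:
  "neck_list n t = filter (\<lambda>\<gamma>. z \<le> \<gamma>) (neck_list n t) @ filter (\<lambda>\<gamma>. \<not> z \<le> \<gamma>) (neck_list n t)"
proof -
  have "xs = filter (\<lambda>\<gamma>. z \<le> \<gamma>) xs @ filter (\<lambda>\<gamma>. \<not> z \<le> \<gamma>) xs"
    if "sorted_wrt (>) xs" for xs :: "nat list list" and z
    using that
  proof (induction xs)
    case (Cons x xs)
    show ?case
    proof (cases "z \<le> x")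
      case False
      then have "\<forall>y\<in>set xs. \<not> z \<le> y" using Cons.prems by fastforce
      then show ?thesis using False by (simp add: filter_empty_conv[THEN iffD2] filter_True)
    qed (use Cons in simp)
  qed simp
  then show ?thesis using sorted_neck_list by blast
qed

text \<open>\<open>z\<close> separates the necklaces whose prefix exceeds \<open>x\<close> from the
  others. The first one after them, \<open>f\<close>, is at least \<open>b\<close> and thus starts
  with \<open>x\<close>, and the symbols before it end with \<open>r\<close> zeros. \<open>N\<close>
  is added before \<open>r\<close> is subtracted because no necklace may lie above \<open>z\<close>,
  and then the window starts near the end of the sequence.\<close>

lemma window_zero:
  assumes b: "x @ replicate r 0 \<in> necks n t" and n: "1 \<le> n" "1 \<le> t"
    and nz: "\<exists>a\<in>set x. a \<noteq> 0"
    and z: "length z = t" "\<And>\<gamma>. \<gamma> \<in> necks n t \<Longrightarrow> z \<le> \<gamma> \<longleftrightarrow> x < take (length x) \<gamma>"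
  defines "N \<equiv> card (words n t)"
  shows "cyclic_substring (root_concat (neck_list n t)) t
    (Suc ((N + (N - below n z) - r) mod N)) = replicate r 0 @ x"
proof -
  define b where "b = x @ replicate r (0::nat)"
  have bn: "b \<in> necks n t" using b by (simp add: b_def)
  then have l: "length b = t" by (rule necks_length)
  then have lr: "t - r = length x" "r + length x = t" by (auto simp: b_def)
  define A where "A = filter (\<lambda>\<gamma>. z \<le> \<gamma>) (neck_list n t)"
  define B where "B = filter (\<lambda>\<gamma>. \<not> z \<le> \<gamma>) (neck_list n t)"
  have s: "neck_list n t = A @ B" unfolding A_def B_def by (rule neck_list_filter)
  have lA: "length (root_concat A) = N - below n z"
    using length_cat_ge[OF n(2) z(1), of n] by (simp add: A_def N_def)
  have "b \<in> set B" using bn z(2)[OF bn] by (simp add: B_def b_def)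
  then obtain f B' where B: "B = f # B'" by (cases B) auto
  have s1: "neck_list n t = A @ f # B'" using s B by simp
  have fB: "f \<in> set B" using B by simp
  then have fn: "f \<in> necks n t" "\<not> z \<le> f" by (auto simp: B_def)
  have lf: "length f = t" using fn by (simp add: necks_length)
  have "b \<in> set (f # B')" using \<open>b \<in> set B\<close> B by simp
  then have bf: "b \<le> f" using neck_list_split(2)[OF s1 bn] by auto
  then have "take (length x) b \<le> take (length x) f" using l lf by (simp add: take_le_take)
  then have tf: "take (length x) f = x" using z(2)[OF fn(1)] fn(2) by (simp add: b_def)
  have fz: "f \<noteq> replicate t 0"
  proof
    assume "f = replicate t 0"
    then have "x = replicate (min (length x) t) 0" using tf by (metis take_replicate)
    then show False using nz by (metis in_set_replicate)
  qed
  obtain E where E: "root_concat (f # B') = f @ E" using cat_starts_with[OF s1 fz n] by auto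
  have "f \<noteq> []" using lf n by auto
  then have "1 \<le> period f" by (rule per_spec)
  moreover have "length (root_concat A) + period f + below n f = N"
    using length_cat_upto[OF s1 n(2)] by (simp add: N_def)
  ultimately have AN: "length (root_concat A) < N" by linarith
  have LN: "length (root_concat (neck_list n t)) = N" using length_cat_neck_list[OF n] by (simp add: N_def)
  show ?thesis
  proof (cases A rule: rev_cases)
    \<comment> \<open>The sequence starts with \<open>f\<close>, hence with \<open>x\<close>, and
      the window takes its zeros from the end of the sequence.\<close>
    case Nil
    have n2: "2 \<le> n"
    proof (rule ccontr)
      assume "\<not> 2 \<le> n"
      moreover have "sum_list b < n" using bn by (simp add: necks_def words_def)
      ultimately have "sum_list b = 0" by linarith
      then show False using nz by (auto simp: b_def)
    qed
    obtain D' where "root_concat (neck_list n t) = D' @ replicate t 0" using cat_ends_with_zeros[OF n2 n(2)] by auto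
    moreover have "replicate t (0::nat) = replicate (length x) 0 @ replicate r 0"
      using lr by (simp add: replicate_add[symmetric] add.commute)
    ultimately have D1: "root_concat (neck_list n t) = (D' @ replicate (length x) 0) @ replicate r 0" by simp
    have "f = x @ drop (length x) f" using tf by (metis append_take_drop_id)
    then have D2: "root_concat (neck_list n t) = x @ (drop (length x) f @ E)" using s1 Nil E
      by (metis append.assoc append_Nil)
    have "N = length (D' @ replicate (length x) (0::nat)) + r" using LN D1 by (metis length_append length_replicate)
    then have "(N + (N - below n z) - r) mod N = length (D' @ replicate (length x) (0::nat)) mod length (root_concat (neck_list n t))"
      using lA Nil LN by simp
    then show ?thesis using cyclic_substring_wrap[OF D1 D2, of t] lr by simp
  next
    case (snoc A' a)
    have s2: "neck_list n t = A' @ a # f # B'" using s1 snoc by simp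
    have a: "a \<in> set A" using snoc by simp
    then have an: "a \<in> necks n t" "z \<le> a" by (auto simp: A_def)
    have la: "length a = t" using an by (simp add: necks_length)
    have "f < a" using neck_list_split(1)[OF s1 an(1)] a by simp
    then have "a \<noteq> replicate t 0" using replicate_zero_le[of f t] lf by auto
    then obtain u c k where u: "a = u @ c # replicate k 0" "0 < c"
      using nonzero_words[OF la] last_nonzero by blast
    have tu: "take (length u) f = u" using neck_list_successor[OF s2 u] .
    \<comment> \<open>\<open>a\<close> and its successor \<open>f\<close> share \<open>u\<close> but
      differ within the first \<open>length x\<close> symbols. So \<open>a\<close> ends with at
      least \<open>r\<close> zeros.\<close>
    have "length u < length x"
    proof (rule ccontr)
      assume "\<not> length u < length x"
      then have "take (length x) a = take (length x) (take (length u) f)" unfolding tu using u by simp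
      also have "\<dots> = x" using \<open>\<not> length u < length x\<close> tf by (simp add: min_def)
      finally show False using z(2)[OF an(1)] an(2) by simp
    qed
    then have kr: "r \<le> k" using lr la u by auto
    then have rp: "r \<le> period a" using per_gt_zeros[OF u] by simp
    have "drop (t - r) a = replicate r 0"
    proof -
      have "t - r = Suc (length u) + (k - r)" using la u kr by simp
      then show ?thesis using u kr by (simp add: drop_Cons')
    qed
    then have "cyclic_substring (root_concat (neck_list n t)) t (Suc (length (root_concat A') + period a - r)) = replicate r 0 @ x"
      using window_at_end_of_neck[OF s2 n rp] fz tf lr by simp
    moreover have "(N + (N - below n z) - r) mod N = length (root_concat A') + period a - r"
    proof -
      have "a \<noteq> []" using la n by auto
      then have "length (take (period a) a) = period a" using per_spec[of a] by simp
      then have "length (root_concat A) = length (root_concat A') + period a" using snoc by simp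
      moreover have "(N + (N - below n z) - r) = N + (length (root_concat A) - r)"
        using lA calculation rp by simp
      then have "(N + (N - below n z) - r) mod N = (length (root_concat A) - r) mod N" by simp
      ultimately show ?thesis using AN by simp
    qed
    ultimately show ?thesis by simp
  qed
qed

text \<open>For \<open>n = 1\<close> the sequence is a single 0 and the window goes round it
  repeatedly; \<open>(N - t) mod N\<close> is 0 then. Otherwise the sequence ends with
  \<open>t\<close> zeros.\<close>

lemma window_zeros:
  assumes n: "1 \<le> n" "1 \<le> t"
  defines "N \<equiv> card (words n t)"
  shows "cyclic_substring (root_concat (neck_list n t)) t (Suc ((N - t) mod N)) = replicate t 0"
proof (cases "n = 1")
  case True
  have "N = 1" unfolding N_def card_words[OF n(1)] using True by simp
  then have L1: "length (root_concat (neck_list n t)) = 1" using length_cat_neck_list[OF n] N_def by simp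
  have "w = replicate t 0" if "w \<in> necks n t" for w
    using that True by (auto simp: necks_def words_def intro: replicate_eqI)
  then have "set (root_concat (neck_list n t)) \<subseteq> {0}"
    using set_neck_list[of n t] by (fastforce simp: root_concat_def dest!: in_set_takeD)
  then have "root_concat (neck_list n t) = [0]" using L1 by (cases "root_concat (neck_list n t)") auto
  then show ?thesis by (intro nth_equalityI) (auto simp: cyclic_substring_def)
next
  case False
  then obtain D' where D: "D' \<noteq> []" "root_concat (neck_list n t) = D' @ replicate t 0"
    using cat_ends_with_zeros[of n t] n by auto
  have "length (root_concat (neck_list n t)) = N" using length_cat_neck_list[OF n] by (simp add: N_def)
  then have "(N - t) mod N = length D'" using D n by auto
  then show ?thesis using cyclic_substring_mid[of _ D' "replicate t 0" "[]" t] D by simp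
qed

text \<open>The least word of the same length that agrees with \<open>b\<close> before its
  \<open>p\<close>-th symbol (counted from 1) and exceeds it there.\<close>

definition bump :: "nat list \<Rightarrow> nat \<Rightarrow> nat list" where
  "bump b p = take (p - 1) b @ Suc (b ! (p - 1)) # replicate (length b - p) 0"

lemma length_bump: "1 \<le> p \<Longrightarrow> p \<le> length b \<Longrightarrow> length (bump b p) = length b"
  by (simp add: bump_def)

text \<open>If the prefix of a necklace \<open>g\<close> exceeds that of \<open>b\<close>, first at
  index \<open>e\<close>, then lowering \<open>g ! e\<close> to \<open>Suc (b ! e)\<close> and
  clearing the rest leaves a prenecklace, \<open>bump b (Suc e)\<close>. So
  \<open>Suc e \<le> p\<close> by maximality of \<open>p\<close>. In case of equality
  \<open>bump b p\<close> is the least such word, otherwise \<open>g\<close> is larger already at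
  \<open>e\<close>. This replaces a condition on prefixes by a comparison with one
  prenecklace.\<close>

lemma bump_threshold:
  assumes h: "h \<le> t" "length b = t"
    and p: "1 \<le> p" "p \<le> h" "pren (bump b p)" "\<And>q. p < q \<Longrightarrow> q \<le> h \<Longrightarrow> \<not> pren (bump b q)"
    and g: "max_rot g" "length g = t"
  shows "bump b p \<le> g \<longleftrightarrow> take h b < take h g"
proof
  assume le: "bump b p \<le> g"
  have "take (p - 1) b @ [b ! (p - 1)] = take p b"
    using p h by (cases p) (auto simp: take_Suc_conv_app_nth)
  then have "take h b = take (p - 1) b @ [b ! (p - 1)] @ drop p (take h b)"
    using append_take_drop_id[of p "take h b"] p by (simp only: append_assoc[symmetric]) (simp add: min_def)
  moreover have "take h (bump b p) = take (p - 1) b @ [Suc (b ! (p - 1))] @ replicate (h - p) 0"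
    using p h by (auto simp: bump_def take_Cons' min_def)
  ultimately have "take h b < take h (bump b p)"
    using append_less_append_iff[of "take (p - 1) b" "take (p - 1) b" "[b ! (p - 1)] @ drop p (take h b)"
        "[Suc (b ! (p - 1))] @ replicate (h - p) 0"] by (metis append_Cons append_Nil Cons_less_Cons lessI)
  also have "\<dots> \<le> take h g" using le p h g length_bump[of p b] by (intro take_le_take) auto
  finally show "take h b < take h g" .
next
  assume "take h b < take h g"
  then obtain e where e: "e < h" "mismatch g b e" using mismatch_if_take_less h g by metis
  then have *: "e < t" "take e b = take e g" "b ! e < g ! e" using h g by (auto simp: mismatch_def)
  have "pren (take (Suc e) g)" using g by (intro pren_take max_rot_pren)
  then have "pren (take e b @ [g ! e])" using * g by (simp add: take_Suc_conv_app_nth)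
  then have "pren (take e b @ [Suc (b ! e)])" using *(3) by (rule pren_lower[OF _ Suc_leI])
  then have "pren (bump b (Suc e))" unfolding bump_def
    using pren_append_zeros[of "take e b @ [Suc (b ! e)]"] by simp
  then have ep: "Suc e \<le> p" using p(4)[of "Suc e"] e(1) by (metis Suc_leI not_less)
  show "bump b p \<le> g"
  proof (cases "Suc e = p")
    case True
    have g': "g = take e g @ g ! e # drop (Suc e) g" using * g by (simp add: id_take_nth_drop)
    have "replicate (t - Suc e) 0 \<le> drop (Suc e) g" using g by (intro replicate_zero_le) simp
    then have "Suc (b ! e) # replicate (t - Suc e) 0 \<le> g ! e # drop (Suc e) g" using *(3) by auto
    then have "take e g @ Suc (b ! e) # replicate (t - Suc e) 0 \<le> take e g @ g ! e # drop (Suc e) g"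
      by (simp add: append_le_append_iff)
    then show ?thesis using True g' * h by (auto simp: bump_def)
  next
    case False
    then have "e < p - 1" using ep by simp
    then have "mismatch g (bump b p) e" using e(2) p h
      by (auto simp: mismatch_def bump_def nth_append min_def)
    then show ?thesis using less_if_mismatch length_bump[of p b] p h g by fastforce
  qed
qed

lemma pren_bump_1: "1 \<le> length b \<Longrightarrow> pren (bump b 1)"
  using max_rot_pren[OF max_rot_single] by (simp add: bump_def)

subsection \<open>Counting words by their largest rotation\<close>

text \<open>A block is a prefix of \<open>z\<close> followed by a symbol smaller than the next one in \<open>z\<close>. The
  words in \<open>block_words z m\<close> are the concatenations of blocks of total length \<open>m\<close>.\<close>

definition block_words :: "nat list \<Rightarrow> nat \<Rightarrow> nat list set" where
  "block_words z m = {v. length v = m \<and> (\<forall>i<m. \<exists>e. mismatch z (drop i v) e)}"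

definition block :: "nat list \<Rightarrow> nat \<times> nat \<times> nat list \<Rightarrow> nat list" where
  "block z = (\<lambda>(l, x, v). take l z @ x # v)"

lemma mismatch_block: "l < length z \<Longrightarrow> x < z ! l \<Longrightarrow> mismatch z (block z (l, x, v)) l"
  by (simp add: mismatch_def block_def nth_append)

lemma mismatch_block_decomp:
  "mismatch z w l \<Longrightarrow> w = block z (l, w ! l, drop (Suc l) w)"
  unfolding mismatch_def block_def by (metis case_prod_conv id_take_nth_drop)

text \<open>Suffixes that start inside the block fall below \<open>z\<close> inside it, because
  \<open>z\<close> is a prenecklace; later ones are suffixes of \<open>v\<close>.\<close>

lemma block_in_block_words:
  assumes "pren z" "l < length z" "x < z ! l" "v \<in> block_words z m"
  shows "block z (l, x, v) \<in> block_words z (Suc l + m)"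
  unfolding block_words_def
proof (intro CollectI conjI allI impI)
  let ?w = "block z (l, x, v)"
  show "length ?w = Suc l + m" using assms by (simp add: block_def block_words_def)
  fix i assume i: "i < Suc l + m"
  show "\<exists>e. mismatch z (drop i ?w) e"
  proof (cases "i \<le> l")
    case True
    then show ?thesis using pren_mismatch_drop[OF assms(1) mismatch_block[OF assms(2,3)]] by blast
  next
    case False
    then have "drop i ?w = drop (i - Suc l) v" using assms(2) by (simp add: block_def drop_Cons')
    moreover have "i - Suc l < m" using i False by simp
    ultimately show ?thesis using assms(4) by (simp add: block_words_def)
  qed
qed

text \<open>The first block ends at the mismatch position of the whole word, so it can be read off
  from the word.\<close>

lemma bij_block:
  assumes "pren z" "m < length z"
  shows "bij_betw (block z) (SIGMA l:{..m}. {..<z ! l} \<times> block_words z (m - l)) (block_words z (Suc m))"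
  unfolding bij_betw_def
proof
  show "inj_on (block z) (SIGMA l:{..m}. {..<z ! l} \<times> block_words z (m - l))"
  proof (rule inj_onI)
    fix p q assume "p \<in> (SIGMA l:{..m}. {..<z ! l} \<times> block_words z (m - l))"
      "q \<in> (SIGMA l:{..m}. {..<z ! l} \<times> block_words z (m - l))" and e: "block z p = block z q"
    then obtain l x v l' x' v' where *: "p = (l, x, v)" "q = (l', x', v')" "l \<le> m" "x < z ! l"
      "l' \<le> m" "x' < z ! l'" by auto
    have "mismatch z (block z p) l" "mismatch z (block z q) l'"
      using mismatch_block[of l z x v] mismatch_block[of l' z x' v'] * assms(2) by auto
    then have "l = l'" using e mismatch_unique by simp
    then show "p = q" using * e by (simp add: block_def)
  qed
  show "block z ` (SIGMA l:{..m}. {..<z ! l} \<times> block_words z (m - l)) = block_words z (Suc m)"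
  proof (intro equalityI subsetI)
    fix w assume "w \<in> block z ` (SIGMA l:{..m}. {..<z ! l} \<times> block_words z (m - l))"
    then obtain l x v where "w = block z (l, x, v)" "l \<le> m" "x < z ! l" "v \<in> block_words z (m - l)"
      by auto
    then show "w \<in> block_words z (Suc m)"
      using block_in_block_words[OF assms(1), of l x v "m - l"] assms(2) by simp
  next
    fix w assume w: "w \<in> block_words z (Suc m)"
    then have ws: "\<exists>e. mismatch z (drop i w) e" if "i < Suc m" for i
      using that unfolding block_words_def by blast
    obtain l where l: "mismatch z w l" using ws[of 0] by auto
    then have "l \<le> m" "w ! l < z ! l" using w by (auto simp: mismatch_def block_words_def)
    moreover have "drop (Suc l) w \<in> block_words z (m - l)"
      using w ws by (simp add: block_words_def less_diff_conv)
    ultimately show "w \<in> block z ` (SIGMA l:{..m}. {..<z ! l} \<times> block_words z (m - l))"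
      using mismatch_block_decomp[OF l]
      by (intro image_eqI[of _ _ "(l, w ! l, drop (Suc l) w)"]) auto
  qed
qed

lemma finite_block_words: "finite (block_words z m)"
proof -
  have "set v \<subseteq> {..Max (set z)}" if "v \<in> block_words z m" for v
  proof
    fix x assume "x \<in> set v"
    then obtain i where i: "i < length v" "v ! i = x" by (auto simp: in_set_conv_nth)
    moreover have "length v = m" "\<forall>i<m. \<exists>e. mismatch z (drop i v) e"
      using that by (simp_all add: block_words_def)
    ultimately obtain e where e: "mismatch z (drop i v) e" by auto
    \<comment> \<open>The suffix starting at \<open>i\<close> either has its mismatch at its first
      symbol or agrees with \<open>z\<close> there.\<close>
    have "v ! i \<le> z ! 0"
    proof (cases e)
      case (Suc e')
      then have "take e (drop i v) ! 0 = take e z ! 0" using e by (simp add: mismatch_def)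
      then show ?thesis using i Suc by simp
    qed (use e i in \<open>simp add: mismatch_def\<close>)
    moreover have "z ! 0 \<in> set z" using e by (cases z) (auto simp: mismatch_def)
    ultimately show "x \<in> {..Max (set z)}" using i by (auto intro!: order_trans[OF _ Max_ge])
  qed
  then have "block_words z m \<subseteq> {v. set v \<subseteq> {..Max (set z)} \<and> length v = m}"
    by (auto simp: block_words_def)
  then show ?thesis using finite_lists_length_eq[of "{..Max (set z)}" m] finite_subset by blast
qed

text \<open>The value at \<open>X\<close> of the generating function, by sum of symbols, of the
  blocks of length \<open>Suc l\<close>.\<close>

definition bcoef :: "nat \<Rightarrow> nat list \<Rightarrow> nat \<Rightarrow> nat" where
  "bcoef X z l = X ^ sum_list (take l z) * (\<Sum>x<z ! l. X ^ x)"

lemma sum_block: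
  "(\<Sum>p\<in>{..<z ! l} \<times> C. X ^ sum_list (block z (l, p))) = bcoef X z l * (\<Sum>v\<in>C. X ^ sum_list v)"
proof -
  have "bcoef X z l * (\<Sum>v\<in>C. X ^ sum_list v)
    = X ^ sum_list (take l z) * ((\<Sum>x<z ! l. X ^ x) * (\<Sum>v\<in>C. X ^ sum_list v))"
    by (simp add: bcoef_def mult.assoc)
  also have "\<dots> = (\<Sum>x<z ! l. \<Sum>v\<in>C. X ^ sum_list (block z (l, x, v)))"
    by (simp only: sum_product) (simp add: sum_distrib_left block_def power_add)
  finally show ?thesis by (simp add: sum.cartesian_product')
qed

lemma sum_block_words:
  assumes "pren z" "m < length z"
  shows "(\<Sum>v\<in>block_words z (Suc m). X ^ sum_list v)
    = (\<Sum>l\<le>m. bcoef X z l * (\<Sum>v\<in>block_words z (m - l). X ^ sum_list v))"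
proof -
  have "(\<Sum>v\<in>block_words z (Suc m). X ^ sum_list v)
    = (\<Sum>p\<in>(SIGMA l:{..m}. {..<z ! l} \<times> block_words z (m - l)). X ^ sum_list (block z p))"
    by (rule sum.reindex_bij_betw[OF bij_block[OF assms], symmetric])
  also have "\<dots> = (\<Sum>(l, p)\<in>(SIGMA l:{..m}. {..<z ! l} \<times> block_words z (m - l)). X ^ sum_list (block z (l, p)))"
    by (simp add: case_prod_unfold)
  also have "\<dots> = (\<Sum>l\<le>m. \<Sum>p\<in>{..<z ! l} \<times> block_words z (m - l). X ^ sum_list (block z (l, p)))"
    by (rule sum.Sigma[symmetric]) (auto simp: finite_block_words)
  also have "\<dots> = (\<Sum>l\<le>m. bcoef X z l * (\<Sum>v\<in>block_words z (m - l). X ^ sum_list v))"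
    by (simp add: sum_block)
  finally show ?thesis .
qed

section \<open>Circular concatenations of blocks\<close>

definition low_words :: "nat list \<Rightarrow> nat list set" where
  "low_words z = {w. length w = length z \<and> (\<forall>r. rotate r w < z)}"

lemma low_words_rotate: "w \<in> low_words z \<Longrightarrow> rotate r w \<in> low_words z"
  by (simp add: low_words_def rotate_rotate)

text \<open>A block that starts inside another one ends no later than it, so the intervals from a
  position to its mismatch are nested or disjoint.\<close>

lemma low_words_mismatch_rotate:
  assumes "pren z" "w \<in> low_words z" "mismatch z w m" "e \<le> m" "mismatch z (rotate e w) m'"
  shows "e + m' \<le> m"
proof -
  obtain m'' where m'': "m'' \<le> m - e" "mismatch z (drop e w) m''"
    using pren_mismatch_drop[OF assms(1,3,4)] by auto
  have "e < length w" using assms(3,4) by (simp add: mismatch_def)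
  then have "rotate e w = drop e w @ take e w" by (simp add: rotate_drop_take)
  then have "mismatch z (rotate e w) m''" using m''(2) by (simp add: mismatch_append)
  then have "m'' = m'" using assms(5) mismatch_unique by blast
  then show ?thesis using m''(1) assms(4) by simp
qed

lemma block_words_subset_low_words:
  assumes "length z = t" "1 \<le> t"
  shows "block_words z t \<subseteq> low_words z"
proof
  fix w assume w: "w \<in> block_words z t"
  then have l: "length w = t" by (simp add: block_words_def)
  have "rotate r w < z" for r
  proof -
    define i where "i = r mod t"
    have i: "i < t" using assms by (simp add: i_def)
    have "rotate r w = rotate i w" using l by (metis i_def rotate_conv_mod)
    moreover have "rotate i w = drop i w @ take i w" using i l by (simp add: rotate_drop_take)
    moreover obtain e where "mismatch z (drop i w) e" using w i by (auto simp: block_words_def)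
    ultimately have "mismatch z (rotate r w) e" by (simp add: mismatch_append)
    then show ?thesis using less_if_mismatch l assms by simp
  qed
  then show "w \<in> low_words z" using l assms by (simp add: low_words_def)
qed

text \<open>A word with all rotations below \<open>z\<close> is a rotation of a concatenation of blocks; the offset is
  taken within the block that contains position 0, which makes the representation unique.\<close>

lemma low_word_starts_in_block:
  assumes z: "pren z" "length z = t" "1 \<le> t" and w: "w \<in> low_words z"
  shows "\<exists>s e. 1 \<le> s \<and> s \<le> t \<and> rotate s w \<in> block_words z t \<and> mismatch z (rotate s w) e \<and> t - s \<le> e"
proof -
  have l: "length w = t" using w z by (simp add: low_words_def)
  have "\<exists>m. mismatch z (rotate i w) m" for i
  proof -
    have "rotate i w < z" using w by (simp add: low_words_def)
    then show ?thesis using mismatch_if_less[of "rotate i w" z] z l by simp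
  qed
  then obtain \<mu> where \<mu>: "\<And>i. mismatch z (rotate i w) (\<mu> i)" by metis
  have \<mu>t: "\<mu> i < t" for i using \<mu>[of i] z by (simp add: mismatch_def)
  have period: "\<mu> (i + t) = \<mu> i" for i
  proof -
    have "rotate (i + t) w = rotate i w" using l by (metis mod_add_self2 rotate_conv_mod)
    then show ?thesis using \<mu>[of "i + t"] \<mu>[of i] mismatch_unique by simp
  qed
  have lam: "j + \<mu> j \<le> i + \<mu> i" if "i \<le> j" "j \<le> i + \<mu> i" for i j
  proof -
    have "rotate (j - i) (rotate i w) = rotate j w" using that by (simp add: rotate_rotate)
    then have "(j - i) + \<mu> j \<le> \<mu> i"
      using low_words_mismatch_rotate[OF z(1) low_words_rotate[OF w] \<mu>[of i], of "j - i" "\<mu> j"] \<mu>[of j] that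
      by simp
    then show ?thesis using that by simp
  qed
  \<comment> \<open>The first start from position 1 on whose block reaches position
    \<open>t\<close>, that is, position 0 one turn later; \<open>t\<close> itself qualifies.\<close>
  define s where "s = (LEAST i. 1 \<le> i \<and> t \<le> i + \<mu> i)"
  have s: "1 \<le> s" "t \<le> s + \<mu> s" and st: "s \<le> t"
    unfolding s_def using z LeastI[of "\<lambda>i. 1 \<le> i \<and> t \<le> i + \<mu> i" t] by (auto intro: Least_le)
  have min: "i + \<mu> i < t" if "1 \<le> i" "i < s" for i
    using not_less_Least[of i "\<lambda>i. 1 \<le> i \<and> t \<le> i + \<mu> i"] that by (auto simp: s_def)
  \<comment> \<open>Read from \<open>s\<close>, no block runs over the end of the word. A start up
    to \<open>t\<close> lies in the block of \<open>s\<close>. A later one repeats some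
    \<open>j < s\<close>, and a block from \<open>j\<close> that reached \<open>s\<close> would
    contain the block of \<open>s\<close> and so reach \<open>t\<close>.\<close>
  have good: "i + \<mu> (s + i) < t" if i: "i < t" for i
  proof (cases "s + i \<le> t")
    case True
    then have "s + i + \<mu> (s + i) \<le> s + \<mu> s" using s by (intro lam) auto
    then show ?thesis using \<mu>t[of s] by simp
  next
    case False
    define j where "j = s + i - t"
    have j: "1 \<le> j" "j < s" "s + i = j + t" using False i by (auto simp: j_def)
    then have "j + \<mu> j < t" using min by simp
    have "j + \<mu> j < s"
    proof (rule ccontr)
      assume "\<not> j + \<mu> j < s"
      then have "s + \<mu> s \<le> j + \<mu> j" using j by (intro lam) auto
      then show False using s \<open>j + \<mu> j < t\<close> by simp
    qed
    then show ?thesis using period[of j] j by simp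
  qed
  have "rotate s w \<in> block_words z t"
    unfolding block_words_def
  proof (intro CollectI conjI allI impI)
    fix i assume i: "i < t"
    have "rotate i (rotate s w) = drop i (rotate s w) @ take i (rotate s w)"
      using i l by (simp add: rotate_drop_take[of i])
    then have r: "rotate (s + i) w = drop i (rotate s w) @ take i (rotate s w)"
      by (simp add: rotate_rotate add.commute)
    have "mismatch z (drop i (rotate s w)) (\<mu> (s + i))"
    proof -
      have "\<mu> (s + i) < length (drop i (rotate s w))" using good[OF i] l by simp
      moreover have "mismatch z (drop i (rotate s w) @ take i (rotate s w)) (\<mu> (s + i))"
        using \<mu>[of "s + i"] unfolding r .
      ultimately show ?thesis by (simp add: mismatch_def nth_append del: length_drop length_rotate)
    qed
    then show "\<exists>e. mismatch z (drop i (rotate s w)) e" by blast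
  qed (use l in simp)
  then show ?thesis using s st \<mu>[of s] by (intro exI[of _ s] exI[of _ "\<mu> s"]) auto
qed

text \<open>\<open>r\<close> is the index, inside the first block of length \<open>Suc l\<close>, of
  the symbol that becomes position 0; the \<open>Suc l\<close> choices give the factor in
  \<open>sum_low_words\<close>.\<close>

lemma bij_low_words:
  assumes z: "pren z" "length z = Suc m"
  shows "bij_betw (\<lambda>(l, r, x, v). rotate r (block z (l, x, v)))
    (SIGMA l:{..m}. {..l} \<times> {..<z ! l} \<times> block_words z (m - l)) (low_words z)"
  unfolding bij_betw_def
proof
  let ?f = "\<lambda>(l, r, x, v). rotate r (block z (l, x, v))"
  let ?S = "SIGMA l:{..m}. {..l} \<times> {..<z ! l} \<times> block_words z (m - l)"
  have bw: "block z (l, x, v) \<in> block_words z (Suc m)" "mismatch z (block z (l, x, v)) l"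
    if "l \<le> m" "x < z ! l" "v \<in> block_words z (m - l)" for l x v
    using block_in_block_words[OF z(1), of l x v "m - l"] mismatch_block[of l z x v] that z by auto
  \<comment> \<open>If \<open>r < r'\<close>, the last \<open>d\<close> symbols of \<open>c\<close>
    are the first \<open>d\<close> symbols of \<open>c'\<close>. That suffix of \<open>c\<close> has
    a mismatch inside it, so \<open>c'\<close> would have one before \<open>d\<close>, although its
    mismatch is at \<open>l' \<ge> d\<close>.\<close>
  have *: "r = r'"
    if c: "c \<in> block_words z (Suc m)" "mismatch z c l" "r \<le> l"
      and c': "c' \<in> block_words z (Suc m)" "mismatch z c' l'" "r' \<le> l'"
      and e: "rotate r c = rotate r' c'" and le: "r \<le> r'" for c c' l l' r r'
  proof (rule ccontr)
    assume "r \<noteq> r'"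
    define d where "d = r' - r"
    have d: "0 < d" "d \<le> l'" using \<open>r \<noteq> r'\<close> le c' by (auto simp: d_def)
    have lc: "length c = Suc m" "length c' = Suc m" using c c' by (auto simp: block_words_def)
    have d': "d < Suc m" using d c' lc by (simp add: mismatch_def)
    have "rotate r c = rotate r (rotate d c')" using e le by (simp add: d_def rotate_rotate)
    then have "c = rotate d c'" by (simp add: rotate_eq_rotate_iff)
    then have "c = drop d c' @ take d c'" using d' lc by (simp add: rotate_drop_take)
    then have "drop (Suc m - d) c = take d c'" using lc d' by simp
    moreover have "Suc m - d < Suc m" using d by simp
    ultimately obtain e where e: "mismatch z (take d c') e"
    proof -
      have "\<forall>i<Suc m. \<exists>e. mismatch z (drop i c) e" using c(1) by (simp add: block_words_def)
      then show thesis using that \<open>drop (Suc m - d) c = take d c'\<close> \<open>Suc m - d < Suc m\<close> by metis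
    qed
    then have "e < d" by (simp add: mismatch_def)
    moreover have "mismatch z c' e" using e by (auto simp: mismatch_def)
    then have "e = l'" using c'(2) mismatch_unique by blast
    ultimately show False using d by simp
  qed
  show "inj_on ?f ?S"
  proof (rule inj_onI)
    fix p q assume "p \<in> ?S" "q \<in> ?S" and e: "?f p = ?f q"
    then obtain l r x v l' r' x' v' where p: "p = (l, r, x, v)" "q = (l', r', x', v')"
      "l \<le> m" "r \<le> l" "x < z ! l" "v \<in> block_words z (m - l)"
      "l' \<le> m" "r' \<le> l'" "x' < z ! l'" "v' \<in> block_words z (m - l')" by auto
    have e': "rotate r (block z (l, x, v)) = rotate r' (block z (l', x', v'))" using e p by simp
    note b = bw[OF p(3,5,6)] bw[OF p(7,9,10)]
    have "r = r'"
      using *[OF b(1,2) p(4) b(3,4) p(8) e'] *[OF b(3,4) p(8) b(1,2) p(4) e'[symmetric]]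
      by (metis linear)
    then have eq: "block z (l, x, v) = block z (l', x', v')" using e' by (simp add: rotate_eq_rotate_iff)
    then have "l = l'" using mismatch_unique b(2,4) by metis
    then show "p = q" using p \<open>r = r'\<close> eq by (simp add: block_def)
  qed
  show "?f ` ?S = low_words z"
  proof (intro equalityI subsetI)
    fix w assume "w \<in> ?f ` ?S"
    then obtain l r x v where p: "w = rotate r (block z (l, x, v))"
      "l \<le> m" "r \<le> l" "x < z ! l" "v \<in> block_words z (m - l)" by auto
    then show "w \<in> low_words z"
      using bw[OF p(2,4,5)] block_words_subset_low_words[OF z(2)] low_words_rotate by auto
  next
    fix w assume w: "w \<in> low_words z"
    then obtain s e where s: "1 \<le> s" "s \<le> Suc m" "rotate s w \<in> block_words z (Suc m)"
      "mismatch z (rotate s w) e" "Suc m - s \<le> e"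
      using low_word_starts_in_block[OF z _ w] by (metis le_add1 plus_1_eq_Suc)
    have "rotate s w \<in> block z ` (SIGMA l:{..m}. {..<z ! l} \<times> block_words z (m - l))"
      using bij_block[OF z(1), of m] s(3) z(2) by (simp add: bij_betw_def)
    then obtain l x v where lxv: "rotate s w = block z (l, x, v)" "l \<le> m" "x < z ! l"
      "v \<in> block_words z (m - l)" by auto
    have "l = e" using bw(2)[OF lxv(2-4)] s(4) lxv(1) mismatch_unique by metis
    have "length w = Suc m" using w z by (simp add: low_words_def)
    then have "rotate (Suc m) w = w" by (metis mod_self rotate_id)
    then have "w = rotate (Suc m - s) (rotate s w)" using s(2) by (metis rotate_rotate le_add_diff_inverse2)
    then have "w = ?f (l, Suc m - s, x, v)" using lxv by simp
    moreover have "(l, Suc m - s, x, v) \<in> ?S" using lxv s \<open>l = e\<close> by simp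
    ultimately show "w \<in> ?f ` ?S" by (rule image_eqI)
  qed
qed

lemma sum_low_words:
  assumes "pren z" "length z = Suc m"
  shows "(\<Sum>w\<in>low_words z. X ^ sum_list w)
    = (\<Sum>l\<le>m. Suc l * bcoef X z l * (\<Sum>v\<in>block_words z (m - l). X ^ sum_list v))"
proof -
  have "(\<Sum>w\<in>low_words z. X ^ sum_list w)
    = (\<Sum>p\<in>(SIGMA l:{..m}. {..l} \<times> {..<z ! l} \<times> block_words z (m - l)).
        X ^ sum_list ((\<lambda>(l, r, x, v). rotate r (block z (l, x, v))) p))"
    by (rule sum.reindex_bij_betw[OF bij_low_words[OF assms], symmetric])
  also have "\<dots> = (\<Sum>(l, p)\<in>(SIGMA l:{..m}. {..l} \<times> {..<z ! l} \<times> block_words z (m - l)).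
      X ^ sum_list (block z (l, snd p)))"
    by (simp add: case_prod_unfold)
  also have "\<dots> = (\<Sum>l\<le>m. \<Sum>p\<in>{..l} \<times> {..<z ! l} \<times> block_words z (m - l). X ^ sum_list (block z (l, snd p)))"
    by (rule sum.Sigma[symmetric]) (auto simp: finite_block_words)
  also have "\<dots> = (\<Sum>l\<le>m. Suc l * (\<Sum>p\<in>{..<z ! l} \<times> block_words z (m - l). X ^ sum_list (block z (l, p))))"
    by (simp add: sum.cartesian_product'[of _ "{.._}"])
  also have "\<dots> = (\<Sum>l\<le>m. Suc l * bcoef X z l * (\<Sum>v\<in>block_words z (m - l). X ^ sum_list v))"
    by (simp only: sum_block mult.assoc)
  finally show ?thesis .
qed

section \<open>Evaluation of the generating functions at a number, and extraction of the
  count\<close>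

declare sum.cong [fundef_cong]

fun fcoef :: "nat \<Rightarrow> nat list \<Rightarrow> nat \<Rightarrow> nat" where
  "fcoef X z 0 = 1"
| "fcoef X z (Suc m) = (\<Sum>l\<le>m. bcoef X z l * fcoef X z (m - l))"

lemma fcoef_eq:
  assumes "pren z" "m \<le> length z"
  shows "fcoef X z m = (\<Sum>v\<in>block_words z m. X ^ sum_list v)"
  using assms(2)
proof (induction m rule: less_induct)
  case (less m)
  show ?case
  proof (cases m)
    case 0
    have "block_words z 0 = {[]}" by (auto simp: block_words_def)
    then show ?thesis using 0 by simp
  next
    case (Suc m')
    then show ?thesis using less sum_block_words[OF assms(1), of m'] by simp
  qed
qed

definition vcoef :: "nat \<Rightarrow> nat list \<Rightarrow> nat" where
  "vcoef X z = (\<Sum>l<length z. Suc l * bcoef X z l * fcoef X z (length z - Suc l))"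

text \<open>Since \<open>X \<equiv> 1\<close> modulo \<open>X - 1\<close>, the last reduction adds up the coefficients of a polynomial
  in \<open>X\<close> whose coefficients have a small sum.\<close>

definition tval :: "nat \<Rightarrow> nat \<Rightarrow> nat list \<Rightarrow> nat" where
  "tval n X z = vcoef X z mod X ^ n mod (X - 1)"

lemma power_mod_pred:
  assumes "2 \<le> (X::nat)"
  shows "X ^ k mod (X - 1) = 1 mod (X - 1)"
proof -
  have "X mod (X - 1) = 1 mod (X - 1)"
    using assms by (metis One_nat_def Suc_1 Suc_leD le_add_diff_inverse2 mod_add_self1 add.commute)
  then show ?thesis by (metis power_mod power_one)
qed

text \<open>Words of sum at least \<open>n\<close> contribute multiples of \<open>X ^ n\<close>. The
  others, at most \<open>N = card (words n t)\<close> many, contribute at most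
  \<open>N * X ^ (n - 1) < X ^ n\<close>, and their number is less than
  \<open>X - 1 = N + 1\<close>, so it survives the second reduction. This is the origin of
  \<open>N + 2\<close>.\<close>

lemma tval_eq_below:
  assumes "pren z" "length z = t" "1 \<le> t" "1 \<le> n" "X = card (words n t) + 2"
  shows "tval n X z = below n z"
proof -
  obtain m where m: "t = Suc m" using assms by (cases t) auto
  let ?A = "{w \<in> low_words z. sum_list w < n}" and ?B = "{w \<in> low_words z. \<not> sum_list w < n}"
  have fin: "finite (low_words z)"
  proof -
    have "finite (SIGMA l:{..m}. {..l} \<times> {..<z ! l} \<times> block_words z (m - l))"
      by (intro finite_SigmaI finite_cartesian_product finite_block_words) auto
    then show ?thesis using bij_low_words[OF assms(1)] m assms(2) bij_betw_finite by blast
  qed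
  have A: "?A = {w \<in> words n (length z). \<forall>r. rotate r w < z}"
    by (auto simp: low_words_def words_def)
  have "?A \<subseteq> words n t" using assms(2) by (auto simp: low_words_def words_def)
  then have cA: "card ?A \<le> card (words n t)" by (intro card_mono finite_words)
  have "vcoef X z = (\<Sum>l\<le>m. Suc l * bcoef X z l * (\<Sum>v\<in>block_words z (m - l). X ^ sum_list v))"
    unfolding vcoef_def using assms(2) m
    by (simp add: fcoef_eq[OF assms(1)] lessThan_Suc_atMost)
  also have "\<dots> = (\<Sum>w\<in>low_words z. X ^ sum_list w)"
    using sum_low_words[OF assms(1)] assms(2) m by simp
  also have "\<dots> = (\<Sum>w\<in>?A. X ^ sum_list w) + (\<Sum>w\<in>?B. X ^ sum_list w)"
    using fin by (subst sum.union_disjoint[symmetric]) (auto intro: sum.cong)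
  finally have V: "vcoef X z = (\<Sum>w\<in>?A. X ^ sum_list w) + (\<Sum>w\<in>?B. X ^ sum_list w)" .
  have "X ^ n dvd (\<Sum>w\<in>?B. X ^ sum_list w)"
    by (intro dvd_sum le_imp_power_dvd) auto
  moreover have "(\<Sum>w\<in>?A. X ^ sum_list w) < X ^ n"
  proof -
    have "(\<Sum>w\<in>?A. X ^ sum_list w) \<le> (\<Sum>w\<in>?A. X ^ (n - 1))"
      using assms(5) by (intro sum_mono power_increasing) auto
    also have "\<dots> = card ?A * X ^ (n - 1)" by simp
    also have "\<dots> < X * X ^ (n - 1)" using cA assms(5) by (intro mult_strict_right_mono) auto
    also have "\<dots> = X ^ n" using assms(4) by (simp add: power_eq_if)
    finally show ?thesis .
  qed
  ultimately have "vcoef X z mod X ^ n = (\<Sum>w\<in>?A. X ^ sum_list w)"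
    unfolding V by (auto simp: dvd_def)
  also have "\<dots> mod (X - 1) = (\<Sum>w\<in>?A. X ^ sum_list w mod (X - 1)) mod (X - 1)"
    by (rule mod_sum_eq[symmetric])
  also have "\<dots> = (\<Sum>w\<in>?A. 1 mod (X - 1)) mod (X - 1)"
    using power_mod_pred[of X] assms(5) by simp
  also have "\<dots> = card ?A mod (X - 1)" by (simp only: mod_sum_eq) simp
  also have "\<dots> = card ?A" using cA assms(5) by simp
  finally show ?thesis unfolding tval_def below_def A .
qed

lemma below_mono:
  assumes "length a = length b" "a \<le> b"
  shows "below n a \<le> below n b"
  unfolding below_def assms(1) using assms(2)
  by (intro card_mono) (auto simp: finite_words intro: less_le_trans)

text \<open>The rotations of \<open>b\<close> stay below \<open>z\<close> but are not counted by
  \<open>below n b\<close>, and there are \<open>period b\<close> of them. In the search, candidates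
  above the wanted necklace overshoot the target for this reason.\<close>

lemma below_greater:
  assumes "b \<in> necks n t" "length z = t" "b < z" "1 \<le> t"
  shows "below n b + period b \<le> below n z"
proof -
  have l: "length b = t" "b \<noteq> []" using assms by (auto simp: necks_def words_def)
  have r: "rotations b \<subseteq> words n t" using assms(1) by (intro rotations_subset_words) (simp add: necks_def)
  have rb: "x \<le> b" if "x \<in> rotations b" for x
    using that assms(1) by (auto simp: rotations_def necks_def max_rot_def)
  have "below n b + period b = card ({w \<in> words n t. \<forall>r. rotate r w < b} \<union> rotations b)"
  proof -
    have "{w \<in> words n t. \<forall>r. rotate r w < b} \<inter> rotations b = {}"
    proof (rule ccontr)
      assume "\<not> ?thesis"
      then obtain x where x: "x \<in> rotations b" "\<forall>r. rotate r x < b" by blast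
      then have "b \<in> rotations x" using rotations_eq[OF x(1)] rotations_self by simp
      then show False using x(2) by (auto simp: rotations_def)
    qed
    then show ?thesis unfolding below_def l(1) using card_rotations[OF l(2)] finite_words[of n t] r
      by (subst card_Un_disjoint) (auto intro: finite_subset)
  qed
  also have "\<dots> \<le> below n z" unfolding below_def assms(2)
  proof (intro card_mono)
    show "{w \<in> words n t. \<forall>r. rotate r w < b} \<union> rotations b \<subseteq> {w \<in> words n t. \<forall>r. rotate r w < z}"
    proof
      fix x assume "x \<in> {w \<in> words n t. \<forall>r. rotate r w < b} \<union> rotations b"
      then consider "x \<in> words n t" "\<forall>r. rotate r x < b" | "x \<in> rotations b" by blast
      then show "x \<in> {w \<in> words n t. \<forall>r. rotate r w < z}"
      proof cases
        case 1
        then show ?thesis using assms(3) less_trans by blast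
      next
        case 2
        have "rotate r x < z" for r
        proof -
          have "rotate r x \<in> rotations b" using 2 by (auto simp: rotations_def rotate_rotate)
          then show ?thesis using rb assms(3) le_less_trans by blast
        qed
        then show ?thesis using 2 r by blast
      qed
    qed
  qed (simp add: finite_words)
  finally show ?thesis .
qed

subsection \<open>Ranking and unranking words\<close>

text \<open>Here \<open>w = y @ x\<close> with \<open>length y = r\<close> and
  \<open>b = x @ y\<close>. If \<open>y\<close> is nonzero, \<open>z = b\<close> is the necklace
  across whose end \<open>w\<close> occurs; otherwise \<open>z\<close> is the threshold for prefixes
  larger than \<open>x\<close>.\<close>

lemma rank_correct:
  assumes w: "w \<in> words n t" and n: "1 \<le> n" "1 \<le> t"
    and r: "r < t" "b = rotate r w" "max_rot b" "\<And>s. s < r \<Longrightarrow> rotate s w \<noteq> b"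
    and nz: "w \<noteq> replicate t 0"
    and z: "if drop (t - r) b = replicate r 0
      then \<exists>p\<in>{1..t - r}. z = bump b p \<and> pren z \<and> (\<forall>q\<in>{p<..t - r}. \<not> pren (bump b q))
      else z = b"
  defines "N \<equiv> card (words n t)"
  shows "cyclic_substring (root_concat (neck_list n t)) t (Suc ((N + (N - below n z) - r) mod N)) = w"
proof -
  have lw: "length w = t" using w by (simp add: words_def)
  have bn: "b \<in> necks n t" using w r by (simp add: necks_def)
  have bsplit: "b = drop r w @ take r w" "length b = t" using r lw by (simp_all add: rotate_drop_take)
  have bne: "b \<noteq> []" using bsplit n by auto
  have tb: "take (t - r) b = drop r w" and db: "drop (t - r) b = take r w" using bsplit lw by auto
  \<comment> \<open>Otherwise the smaller offset \<open>r - period b\<close> would already lead to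
    \<open>b\<close>.\<close>
  have rp: "r < period b"
  proof (rule ccontr)
    assume "\<not> r < period b"
    obtain s where "rotate s b = w" using rotate_inverse r(2) by blast
    have "rotate (period b) w = w"
      using per_spec(2)[OF bne] \<open>rotate s b = w\<close> by (metis add.commute rotate_rotate)
    then have "rotate (r - period b) w = rotate r w" using \<open>\<not> r < period b\<close>
      by (metis le_add_diff_inverse2 not_less rotate_rotate)
    then show False using r(4)[of "r - period b"] r(2) per_spec(1)[OF bne] \<open>\<not> r < period b\<close> by auto
  qed
  have wsplit: "w = take r w @ drop r w" by simp
  show ?thesis
  proof (cases "drop (t - r) b = replicate r 0")
    case False
    then have zb: "z = b" using z by simp
    have yz: "\<exists>a\<in>set (take r w). a \<noteq> 0"
      using False unfolding db by (intro nonzero_words) (use lw r in auto)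
    have "cyclic_substring (root_concat (neck_list n t)) t (Suc (N - below n b - length (take r w))) = take r w @ drop r w"
      unfolding N_def bsplit(1) using bn rp yz bsplit n lw r by (intro window_nonzero) auto
    moreover have "(N + (N - below n b) - r) mod N = N - below n b - r"
    proof -
      obtain A B where s: "neck_list n t = A @ b # B" using split_necks[OF bn] by auto
      have "r < N - below n b" using length_cat_upto[OF s n(2)] rp by (simp add: N_def)
      then have "N + (N - below n b) - r = N + (N - below n b - r)" by simp
      moreover have "r \<noteq> 0" using yz by (cases r) auto
      then have "N - below n b - r < N" using \<open>r < N - below n b\<close> by simp
      ultimately show ?thesis by simp
    qed
    ultimately show ?thesis using zb lw r by simp
  next
    case True
    then obtain p where p: "1 \<le> p" "p \<le> t - r" "z = bump b p" "pren z"
      "\<And>q. p < q \<Longrightarrow> q \<le> t - r \<Longrightarrow> \<not> pren (bump b q)" using z by auto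
    have tw: "take r w = replicate r 0" using True db by simp
    have b': "drop r w @ replicate r 0 = b" using bsplit tw by simp
    have "\<exists>a\<in>set w. a \<noteq> 0" using nonzero_words[OF lw nz] .
    moreover have "set w = set (take r w) \<union> set (drop r w)" using wsplit by (metis set_append)
    ultimately have "\<exists>a\<in>set (drop r w). a \<noteq> 0" unfolding tw by auto
    moreover have "z \<le> \<gamma> \<longleftrightarrow> drop r w < take (length (drop r w)) \<gamma>" if "\<gamma> \<in> necks n t" for \<gamma>
      using bump_threshold[of "t - r" t b p \<gamma>] bsplit p that tb lw by (auto simp: necks_def words_def)
    moreover have "length z = t" using p bsplit by (simp add: length_bump)
    ultimately have "cyclic_substring (root_concat (neck_list n t)) t
      (Suc ((N + (N - below n z) - r) mod N)) = replicate r 0 @ drop r w"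
      unfolding N_def using bn b' n by (intro window_zero) auto
    then show ?thesis using wsplit tw by simp
  qed
qed

lemma ex_position:
  assumes w: "w \<in> words n t" and n: "1 \<le> n" "1 \<le> t"
  shows "\<exists>p<card (words n t). cyclic_substring (root_concat (neck_list n t)) t (Suc p) = w"
proof -
  have N: "card (words n t) > 0" using w finite_words by (auto simp: card_gt_0_iff)
  show ?thesis
  proof (cases "w = replicate t 0")
    case True
    then show ?thesis using window_zeros[OF n] N
      by (intro exI[of _ "(card (words n t) - t) mod card (words n t)"]) simp
  next
    case False
    have lw: "length w = t" "w \<noteq> []" using w n by (auto simp: words_def)
    define r where "r = (LEAST r. max_rot (rotate r w))"
    obtain s where s: "s < t" "max_rot (rotate s w)" using ex_max_rot[OF lw(2)] lw by auto
    have r: "max_rot (rotate r w)" "r < t"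
      using LeastI[of "\<lambda>r. max_rot (rotate r w)" s] Least_le[of "\<lambda>r. max_rot (rotate r w)" s] s
      by (auto simp: r_def)
    have rl: "rotate q w \<noteq> rotate r w" if "q < r" for q
      using not_less_Least[of q "\<lambda>r. max_rot (rotate r w)"] that r by (auto simp: r_def)
    define b where "b = rotate r w"
    have lb: "length b = t" by (simp add: b_def lw)
    define P where "P = {p. 1 \<le> p \<and> p \<le> t - r \<and> pren (bump b p)}"
    \<comment> \<open>Raising the first symbol and clearing the rest gives a necklace, so there is
      an admissible position.\<close>
    have "1 \<in> P" using pren_bump_1[of b] lb r n by (simp add: P_def)
    moreover have "finite P" unfolding P_def by (rule finite_subset[of _ "{..t}"]) auto
    ultimately have m: "Max P \<in> P" "\<And>q. q \<in> P \<Longrightarrow> q \<le> Max P" using Max_in by auto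
    have "\<exists>p\<in>{1..t - r}. bump b (Max P) = bump b p \<and> pren (bump b (Max P)) \<and>
        (\<forall>q\<in>{p<..t - r}. \<not> pren (bump b q))"
    proof (intro bexI conjI ballI)
      show "Max P \<in> {1..t - r}" "pren (bump b (Max P))" using m(1) by (auto simp: P_def)
      fix q assume "q \<in> {Max P<..t - r}"
      then have "1 \<le> q" "q \<le> t - r" "\<not> q \<le> Max P" by auto
      then show "\<not> pren (bump b q)" using m(2)[of q] by (auto simp: P_def)
    qed simp
    moreover define z where "z = (if drop (t - r) b = replicate r 0 then bump b (Max P) else b)"
    ultimately have "if drop (t - r) b = replicate r 0
      then \<exists>p\<in>{1..t - r}. z = bump b p \<and> pren z \<and> (\<forall>q\<in>{p<..t - r}. \<not> pren (bump b q))
      else z = b" by (simp split del: if_split) (simp split: if_split)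
    then have "cyclic_substring (root_concat (neck_list n t)) t
      (Suc ((card (words n t) + (card (words n t) - below n z) - r) mod card (words n t))) = w"
      using r rl by (intro rank_correct[OF w n r(2) b_def _ _ False]) (auto simp: b_def)
    moreover have "(card (words n t) + (card (words n t) - below n z) - r) mod card (words n t) < card (words n t)"
      using N by simp
    ultimately show ?thesis by blast
  qed
qed

lemma cat_index:
  assumes "p < length (root_concat xs)" "[] \<notin> set xs"
  shows "\<exists>A b B. xs = A @ b # B \<and> length (root_concat A) \<le> p \<and> p < length (root_concat A) + period b"
  using assms
proof (induction xs arbitrary: p)
  case (Cons w xs)
  have l: "length (take (period w) w) = period w" using Cons.prems per_spec[of w] by auto
  show ?case
  proof (cases "p < period w")
    case True
    then show ?thesis by (intro exI[of _ "[]"] exI[of _ w] exI[of _ xs]) simp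
  next
    case False
    then have "p - period w < length (root_concat xs)" using Cons.prems l by simp
    then obtain A b B where "xs = A @ b # B" "length (root_concat A) \<le> p - period w" "p - period w < length (root_concat A) + period b"
      using Cons.IH[of "p - period w"] Cons.prems by auto
    then show ?thesis using False l by (intro exI[of _ "w # A"] exI[of _ b] exI[of _ B]) auto
  qed
qed simp

text \<open>From the position on, \<open>Suc r \<le> t\<close> symbols remain, all of them zero. The
  rest of the window is read from the first necklace, \<open>(n - 1) # replicate (t - 1) 0\<close>,
  which for \<open>n = 1\<close> is zero itself.\<close>

lemma unrank_last:
  assumes n: "1 \<le> n" "1 \<le> t" and r: "r < t" "r < card (words n t)"
  shows "cyclic_substring (root_concat (neck_list n t)) t (Suc (card (words n t) - 1 - r))
    = replicate (Suc r) 0 @ take (t - Suc r) ((n - 1) # replicate (t - 1) 0)"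
proof (cases "n = 1")
  case True
  then have "card (words n t) = 1" using card_words[OF n(1)] by simp
  then have N: "card (words n t) - 1 - r = (card (words n t) - t) mod card (words n t)"
    by simp
  have "(n - 1) # replicate (t - 1) 0 = replicate t 0" using True n by (cases t) auto
  moreover have "replicate (Suc r) (0::nat) @ replicate (t - Suc r) 0 = replicate t 0"
    using r(1) by (simp del: replicate_Suc add: replicate_add[symmetric])
  ultimately show ?thesis unfolding N window_zeros[OF n] by (simp del: replicate_Suc)
next
  case False
  let ?f = "(n - 1) # replicate (t - 1) 0"
  let ?N = "card (words n t)"
  have n2: "2 \<le> n" using False n by simp
  have f: "?f \<in> necks n t" using n max_rot_single by (simp add: necks_def words_def sum_list_replicate)
  obtain A B where s: "neck_list n t = A @ ?f # B" using split_necks[OF f] by auto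
  have "A = []"
  proof (rule ccontr)
    assume "A \<noteq> []"
    then obtain g where "g \<in> set A" by (cases A) auto
    moreover have "set A \<subseteq> necks n t" using set_neck_list[of n t] unfolding s by auto
    ultimately have g: "g \<in> necks n t" "?f < g" using neck_list_split(1)[OF s] by auto
    then obtain h g' where h: "g = h # g'" "length g' = t - 1" "h + sum_list g' < n"
      using n by (cases g) (auto simp: necks_def words_def)
    then have "h = n - 1" "replicate (t - 1) 0 < g'" using g by auto
    moreover have "sum_list g' = 0" using h \<open>h = n - 1\<close> by linarith
    then have "g' = replicate (t - 1) 0" using h by (intro replicate_eqI) auto
    ultimately show False by simp
  qed
  obtain E where E: "root_concat (?f # B) = ?f @ E"
    using cat_starts_with[OF s _ n] n2 n by (cases t) auto
  obtain D' where D: "root_concat (neck_list n t) = D' @ replicate t 0"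
    using cat_ends_with_zeros[OF n2 n(2)] by auto
  have "replicate t (0::nat) = replicate (t - Suc r) 0 @ replicate (Suc r) 0"
    using r by (simp del: replicate_Suc add: replicate_add[symmetric])
  then have D1: "root_concat (neck_list n t) = (D' @ replicate (t - Suc r) 0) @ replicate (Suc r) 0"
    using D by simp
  have "root_concat (neck_list n t) = ?f @ E" using s \<open>A = []\<close> E by simp
  also have "\<dots> = take (t - Suc r) ?f @ (drop (t - Suc r) ?f @ E)" by (metis append.assoc append_take_drop_id)
  finally have D2: "root_concat (neck_list n t) = take (t - Suc r) ?f @ (drop (t - Suc r) ?f @ E)" .
  have "?N = length (D' @ replicate (t - Suc r) (0::nat)) + Suc r"
    using length_cat_neck_list[OF n] D1 by (metis length_append length_replicate)
  then have "?N - 1 - r = length (D' @ replicate (t - Suc r) (0::nat)) mod length (root_concat (neck_list n t))"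
    using length_cat_neck_list[OF n] by simp
  then show ?thesis using cyclic_substring_wrap[OF D1 D2, of t] r by simp
qed

text \<open>\<open>r\<close> is the number of symbols after the position. The necklace whose
  aperiodic prefix covers the position and the necklace after it are both described through
  \<open>below\<close> and \<open>period\<close> alone, which is the form that the search needs. The
  first piece of the window has \<open>r + 1 - below n b\<close> symbols.\<close>

lemma unrank_general:
  assumes n: "1 \<le> n" "1 \<le> t" and r: "t \<le> r" "r < card (words n t)"
  shows "\<exists>b b'. b \<in> necks n t \<and> b' \<in> necks n t \<and> below n b \<le> r \<and> r < below n b + period b
    \<and> below n b' + period b' = below n b \<and> r + 1 - below n b \<le> t
    \<and> cyclic_substring (root_concat (neck_list n t)) t (Suc (card (words n t) - 1 - r))
      = drop (t - (r + 1 - below n b)) b @ take (t - (r + 1 - below n b)) b'"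
proof -
  let ?N = "card (words n t)"
  define p where "p = ?N - 1 - r"
  have p: "p < ?N" "r = ?N - 1 - p" using r by (auto simp: p_def)
  have "[] \<notin> set (neck_list n t)" using n by (auto simp: necks_def words_def)
  then obtain A b B where s: "neck_list n t = A @ b # B" "length (root_concat A) \<le> p" "p < length (root_concat A) + period b"
    using cat_index[of p "neck_list n t"] p(1) length_cat_neck_list[OF n] by auto
  have bn: "b \<in> necks n t" using neck_list_split[OF s(1)] by simp
  have lb: "length b = t" using bn by (rule necks_length)
  then have bne: "b \<noteq> []" using n by auto
  have N: "length (root_concat A) + period b + below n b = ?N" using length_cat_upto[OF s(1) n(2)] .
  have bz: "b \<noteq> replicate t 0"
  proof
    assume "b = replicate t 0"
    then have "period b = 1" using per_zeros[OF n(2)] by simp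
    moreover have "below n b = 0"
    proof -
      have "{w \<in> words n (length b). \<forall>r. rotate r w < b} = {}"
        using replicate_zero_le[of _ t] lb \<open>b = replicate t 0\<close> by (auto simp: words_def not_less[symmetric])
      then show ?thesis unfolding below_def by (metis card.empty)
    qed
    ultimately show False using N s(2) p r n by linarith
  qed
  obtain b' B' where B: "B = b' # B'" using neck_list_next[OF s(1) bz n(1)] by auto
  have s1: "neck_list n t = A @ b # b' # B'" using s B by simp
  then have s2: "neck_list n t = (A @ [b]) @ b' # B'" by simp
  have bn': "b' \<in> necks n t" using neck_list_split[OF s2] by simp
  have "length (root_concat (A @ [b])) = length (root_concat A) + period b" using per_spec[OF bne] by simp
  then have N': "length (root_concat A) + period b + period b' + below n b' = ?N" using length_cat_upto[OF s2 n(2)] by simp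
  define j where "j = r + 1 - below n b"
  have j: "j = length (root_concat A) + period b - p" unfolding j_def using p N by linarith
  then have jp: "j \<le> period b" using s by simp
  then have jt: "j \<le> t" using per_spec[OF bne] lb by simp
  have pj: "p = length (root_concat A) + period b - j" using j s by simp
  \<comment> \<open>Only one symbol follows if \<open>b'\<close> is zero, and then
    \<open>j = r \<ge> t\<close>.\<close>
  have "b' \<noteq> replicate t 0 \<or> j = t"
  proof (cases "b' = replicate t 0")
    case True
    then have "neck_list n t = A @ b # replicate t 0 # B'" using s1 by simp
    have "period b' = 1" using True per_zeros[OF n(2)] by simp
    moreover have "below n b' = 0"
    proof -
      have "{w \<in> words n (length b'). \<forall>r. rotate r w < b'} = {}"
        using replicate_zero_le[of _ t] True by (auto simp: words_def not_less[symmetric])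
      then show ?thesis unfolding below_def by (metis card.empty)
    qed
    ultimately have "below n b = 1" using N N' by simp
    then have "j \<ge> t" using r by (simp add: j_def)
    then show ?thesis using jt by simp
  qed simp
  then have "cyclic_substring (root_concat (neck_list n t)) t (Suc p) = drop (t - j) b @ take (t - j) b'"
    unfolding pj by (rule window_at_end_of_neck[OF s1 n jp])
  moreover have "below n b \<le> r" "r < below n b + period b" using N s p by linarith+
  moreover have "below n b' + period b' = below n b" using N N' by simp
  ultimately show ?thesis using bn bn' jt unfolding j_def p_def by blast
qed

subsection \<open>Translation to the original strings and to multisets\<close>

lemma map_diff_less_iff:
  fixes a b :: "nat list"
  assumes "length a = length b" "set a \<subseteq> {1..n}" "set b \<subseteq> {1..n}"
  shows "map ((-) n) a < map ((-) n) b \<longleftrightarrow> b < a"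
  using assms by (induction a b rule: list_induct2) auto

lemma map_diff_inj:
  fixes a b :: "nat list"
  assumes "set a \<subseteq> {1..n}" "set b \<subseteq> {1..n}" "map ((-) n) a = map ((-) n) b"
  shows "a = b"
proof -
  have "map ((-) n) (map ((-) n) c) = c" if "set c \<subseteq> {1..n}" for c
    using that by (induction c) auto
  then show ?thesis using assms by metis
qed

lemma per_map_diff:
  assumes "set a \<subseteq> {1..n}"
  shows "period (map ((-) n) a) = period a"
proof -
  have "rotate d (map ((-) n) a) = map ((-) n) a \<longleftrightarrow> rotate d a = a" for d
    unfolding rotate_map using map_diff_inj[of "rotate d a" n a] assms by auto
  then show ?thesis by (simp add: period_def)
qed

lemma sum_map_diff:
  assumes "set a \<subseteq> {1..n}"
  shows "sum_list (map ((-) n) a) + sum_list a = n * length a"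
  using assms by (induction a) auto

text \<open>Subtraction from \<open>n\<close> reverses the order. The bound equals
  \<open>n * t - n + 1\<close>, so weight at least this means that the subtracted word has sum less
  than \<open>n\<close>.\<close>

lemma necklaces_up_eq:
  assumes "1 \<le> n" "1 \<le> t"
  shows "map (map ((-) n)) (necklaces_up n t (n * t + t - (n + t - 1))) = neck_list n t"
proof -
  let ?k = "map ((-) n)"
  let ?v = "n * t + t - (n + t - 1)"
  let ?S = "{s \<in> strings_up n t ?v. is_necklace s}"
  have st: "set s \<subseteq> {1..n}" "length s = t" if "s \<in> ?S" for s
    using that by (auto simp: strings_up_def strings_def)
  have fin: "finite ?S"
  proof -
    have "?S \<subseteq> {s. set s \<subseteq> {1..n} \<and> length s = t}" using st by blast
    then show ?thesis using finite_lists_length_eq[of "{1..n}" t] finite_subset by blast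
  qed
  have iff: "s \<in> ?S \<longleftrightarrow> ?k s \<in> necks n t" if s: "set s \<subseteq> {1..n}" "length s = t" for s
  proof -
    have "n \<le> n * t" using assms by simp
    then have v: "?v = n * t - n + 1" using assms by linarith
    have "sum_list (?k s) + sum_list s = n * t" using sum_map_diff[OF s(1)] s(2) by simp
    then have "?v \<le> sum_list s \<longleftrightarrow> sum_list (?k s) < n" unfolding v using \<open>n \<le> n * t\<close> by linarith
    moreover have "is_necklace s \<longleftrightarrow> max_rot (?k s)"
      unfolding is_necklace_def max_rot_def rotate_map
    proof (intro all_cong1)
      fix r
      show "s \<le> rotate r s \<longleftrightarrow> ?k (rotate r s) \<le> ?k s"
        using map_diff_less_iff[of s "rotate r s" n] s by (simp add: not_less[symmetric])
    qed
    ultimately show ?thesis using s by (auto simp: strings_up_def strings_def necks_def words_def)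
  qed
  have img: "?k ` ?S = necks n t"
  proof (intro equalityI subsetI)
    fix w assume w: "w \<in> necks n t"
    have "x < n" if "x \<in> set w" for x
      using member_le_sum_list[of x w] that w by (auto simp: necks_def words_def)
    then have "set (?k w) \<subseteq> {1..n}" "?k (?k w) = w"
      by (auto simp: map_idI Suc_le_eq less_imp_le)
    moreover have "length (?k w) = t" using w by (simp add: necks_length)
    ultimately show "w \<in> ?k ` ?S" using iff[of "?k w"] w by (intro image_eqI[of _ _ "?k w"]) auto
  qed (use iff st in blast)
  have "sorted_wrt (<) (sorted_list_of_set ?S)" by simp
  then have "sorted_wrt (\<lambda>a b. ?k b < ?k a) (sorted_list_of_set ?S)"
  proof (rule sorted_wrt_mono_rel[rotated])
    fix a b assume "a \<in> set (sorted_list_of_set ?S)" "b \<in> set (sorted_list_of_set ?S)" "a < b"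
    then show "?k b < ?k a" using st[of a] st[of b] fin by (subst map_diff_less_iff) auto
  qed
  then have "sorted_wrt (<) (rev (map ?k (sorted_list_of_set ?S)))"
    by (simp add: sorted_wrt_rev sorted_wrt_map)
  moreover have "set (rev (map ?k (sorted_list_of_set ?S))) = necks n t" using fin img by simp
  ultimately have "rev (map ?k (sorted_list_of_set ?S)) = sorted_list_of_set (necks n t)"
    by (intro strict_sorted_equal) (auto simp: finite_necks)
  then show ?thesis unfolding necklaces_up_def neck_list_def by (metis rev_rev_ident)
qed

text \<open>\<open>n - x + 1\<close> is the successor of \<open>n - x\<close>: complementing passes
  to the words \<open>w\<close> and adds 1, the same shift that adjusts a difference
  representative.\<close>

lemma G_down_eq:
  assumes "1 \<le> n" "1 \<le> t"
  shows "G_down n t (n + t - 1) = map Suc (root_concat (neck_list n t))"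
proof -
  let ?ss = "necklaces_up n t (n * t + t - (n + t - 1))"
  have fin: "finite {s \<in> strings_up n t (n * t + t - (n + t - 1)). is_necklace s}"
  proof -
    have "{s \<in> strings_up n t (n * t + t - (n + t - 1)). is_necklace s} \<subseteq> {s. set s \<subseteq> {1..n} \<and> length s = t}"
      by (auto simp: strings_up_def strings_def)
    then show ?thesis using finite_lists_length_eq[of "{1..n}" t] finite_subset by blast
  qed
  have s: "set s \<subseteq> {1..n}" "s \<noteq> []" if "s \<in> set ?ss" for s
    using that fin assms(2) by (auto simp: necklaces_up_def strings_up_def strings_def)
  have "complement n (aperiodic_prefix s) = map Suc (take (period (map ((-) n) s)) (map ((-) n) s))"
    if "s \<in> set ?ss" for s
    using s[OF that] by (auto simp: complement_def aperiodic_prefix_eq per_map_diff take_map dest: in_set_takeD)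
  then have e: "map (\<lambda>s. complement n (aperiodic_prefix s)) ?ss
    = map (\<lambda>s. map Suc (take (period (map ((-) n) s)) (map ((-) n) s))) ?ss" by (rule map_cong[OF refl])
  have "G_down n t (n + t - 1) = concat (map (\<lambda>s. complement n (aperiodic_prefix s)) ?ss)"
    unfolding G_down_def G_up_def complement_def by (simp only: map_concat map_map comp_def)
  also have "\<dots> = map Suc (root_concat (map (map ((-) n)) ?ss))"
    unfolding e root_concat_def by (simp only: map_concat map_map comp_def)
  finally show ?thesis by (simp only: necklaces_up_eq[OF assms])
qed

section \<open>Multisets as partial sums of their difference words\<close>

definition partial_sums :: "nat list \<Rightarrow> nat list" where
  "partial_sums w = map (\<lambda>j. sum_list (take (Suc j) w)) [0..<length w]"

lemma length_difference_rep: "length (difference_rep M) = size M"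
  by (simp add: difference_rep_def Let_def)

lemma partial_sums_difference_rep: "partial_sums (difference_rep M) = sorted_list_of_multiset M"
proof -
  let ?ms = "sorted_list_of_multiset M" and ?d = "difference_rep M"
  have l: "length ?ms = size M" by (metis mset_sorted_list_of_multiset size_mset)
  have "sum_list (take (Suc j) ?d) = ?ms ! j" if "j < size M" for j
    using that
  proof (induction j)
    case 0
    then have "take (Suc 0) ?d = [?d ! 0]" by (simp add: take_Suc_conv_app_nth length_difference_rep)
    then show ?case using 0 by (simp add: difference_rep_def Let_def)
  next
    case (Suc j)
    have "take (Suc (Suc j)) ?d = take (Suc j) ?d @ [?d ! Suc j]"
      using Suc.prems by (simp add: take_Suc_conv_app_nth length_difference_rep)
    moreover have "?d ! Suc j = ?ms ! Suc j - ?ms ! j" using Suc.prems by (simp add: difference_rep_def Let_def)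
    moreover have "?ms ! j \<le> ?ms ! Suc j"
      using sorted_nth_mono[of ?ms j "Suc j"] Suc.prems l by simp
    ultimately show ?case using Suc by simp
  qed
  then show ?thesis using l
    by (intro nth_equalityI) (auto simp: partial_sums_def length_difference_rep)
qed

text \<open>The differences telescope, so their sum is the largest element of the multiset.\<close>

lemma difference_rep_words:
  assumes "M \<in> multisets n t" "1 \<le> n"
  shows "difference_rep M \<in> words n t"
proof -
  have t: "size M = t" "set_mset M \<subseteq> {0..<n}" using assms by (auto simp: multisets_def)
  let ?d = "difference_rep M"
  have l: "length ?d = t" using t by (simp add: length_difference_rep)
  have "sum_list ?d < n"
  proof (cases "t = 0")
    case False
    have "partial_sums ?d ! (t - 1) = sum_list ?d" using l False by (simp add: partial_sums_def)
    moreover have "partial_sums ?d ! (t - 1) \<in> set (partial_sums ?d)"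
      using l False by (intro nth_mem) (simp add: partial_sums_def)
    then have "partial_sums ?d ! (t - 1) \<in> set_mset M" by (simp add: partial_sums_difference_rep)
    ultimately show ?thesis using t by auto
  qed (use l assms in simp)
  then show ?thesis using l by (simp add: words_def)
qed

lemma cyclic_substring_map:
  "u \<noteq> [] \<Longrightarrow> cyclic_substring (map f u) t i = map f (cyclic_substring u t i)"
  by (simp add: cyclic_substring_def)

lemma occurs_at_iff:
  assumes "1 \<le> n" "1 \<le> t" "M \<in> multisets n t"
  shows "occurs_at (G_down n t (n + t - 1)) M i \<longleftrightarrow>
    (\<exists>p<card (words n t). i = Suc p \<and> cyclic_substring (root_concat (neck_list n t)) t (Suc p) = difference_rep M)"
proof -
  let ?D = "root_concat (neck_list n t)"
  have N: "length ?D = card (words n t)" using length_cat_neck_list assms by simp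
  have "difference_rep M \<in> words n t" using difference_rep_words assms by simp
  then have "?D \<noteq> []" using N finite_words[of n t] by (auto simp: card_eq_0_iff)
  then have "occurs_at (map Suc ?D) M i \<longleftrightarrow> i \<in> {1..card (words n t)} \<and>
      cyclic_substring ?D t i = difference_rep M"
    using assms(3) N
    by (simp add: occurs_at_def adjusted_difference_rep_def cyclic_substring_map multisets_def)
  also have "\<dots> \<longleftrightarrow> (\<exists>p<card (words n t). i = Suc p \<and> cyclic_substring ?D t (Suc p) = difference_rep M)"
    by (cases i) (auto simp: Suc_le_eq)
  finally show ?thesis using G_down_eq assms by simp
qed

lemma position_unique:
  assumes "1 \<le> n" "1 \<le> t" "p < card (words n t)" "q < card (words n t)"
    "cyclic_substring (root_concat (neck_list n t)) t (Suc p) = cyclic_substring (root_concat (neck_list n t)) t (Suc q)"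
  shows "p = q"
proof -
  let ?g = "\<lambda>p. cyclic_substring (root_concat (neck_list n t)) t (Suc p)"
  let ?N = "card (words n t)"
  have "words n t \<subseteq> ?g ` {..<?N}" using ex_position[of _ n t] assms(1,2) by blast
  then have "?N \<le> card (?g ` {..<?N})" by (intro card_mono) auto
  moreover have "card (?g ` {..<?N}) \<le> ?N" by (metis card_image_le card_lessThan finite_lessThan)
  ultimately have "inj_on ?g {..<?N}" by (intro eq_card_imp_inj_on) auto
  then show ?thesis using assms by (auto dest: inj_onD)
qed

lemma universal_cycle_G_down:
  assumes "1 \<le> n" "1 \<le> t"
  shows "universal_cycle n t (G_down n t (n + t - 1))"
  unfolding universal_cycle_def
proof (intro conjI ballI)
  show "length (G_down n t (n + t - 1)) = (n + t - 1) choose t"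
    using G_down_eq length_cat_neck_list card_words assms by simp
  fix M assume M: "M \<in> multisets n t"
  show "\<exists>!i. occurs_at (G_down n t (n + t - 1)) M i"
  proof (rule ex_ex1I)
    show "\<exists>i. occurs_at (G_down n t (n + t - 1)) M i"
      using ex_position[OF difference_rep_words[OF M assms(1)] assms] occurs_at_iff[OF assms M] by blast
    show "i = j" if "occurs_at (G_down n t (n + t - 1)) M i" "occurs_at (G_down n t (n + t - 1)) M j" for i j
      using that position_unique[OF assms] unfolding occurs_at_iff[OF assms M] by metis
  qed
qed

subsection \<open>Structured programs for the random access machine\<close>

datatype com =
    Blk "instr list"
  | Seq com com (infixr ";;" 60)
  | While nat com
  | IfNZ nat com com

fun code_size :: "com \<Rightarrow> nat" where
  "code_size (Blk is) = length is"
| "code_size (a ;; b) = code_size a + code_size b"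
| "code_size (While i b) = code_size b + 2"
| "code_size (IfNZ i a b) = code_size a + code_size b + 2"

text \<open>\<open>p\<close> is the address at which the code will be placed, since the jumps of the
  machine are absolute.\<close>

fun compile :: "nat \<Rightarrow> com \<Rightarrow> program" where
  "compile p (Blk is) = is"
| "compile p (a ;; b) = compile p a @ compile (p + code_size a) b"
| "compile p (While i b) = JumpZero i (p + code_size b + 2) # compile (p + 1) b @ [Jump p]"
| "compile p (IfNZ i a b) = JumpZero i (p + code_size a + 2) # compile (p + 1) a
    @ Jump (p + code_size a + code_size b + 2) # compile (p + code_size a + 2) b"

lemma length_compile [simp]: "length (compile p c) = code_size c"
  by (induction c arbitrary: p) auto

type_synonym state = "(nat \<Rightarrow> nat) \<times> nat list \<times> nat list"

definition state_of :: "config \<Rightarrow> state" where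
  "state_of c = (reg c, inp c, out c)"

fun instr_step :: "instr \<Rightarrow> state \<Rightarrow> state" where
  "instr_step (Const i x) (R, xs, ys) = (R(i := x), xs, ys)"
| "instr_step (Add i j k) (R, xs, ys) = (R(i := R j + R k), xs, ys)"
| "instr_step (Sub i j k) (R, xs, ys) = (R(i := R j - R k), xs, ys)"
| "instr_step (Mul i j k) (R, xs, ys) = (R(i := R j * R k), xs, ys)"
| "instr_step (Div i j k) (R, xs, ys) = (R(i := R j div R k), xs, ys)"
| "instr_step (Load i j) (R, xs, ys) = (R(i := R (R j)), xs, ys)"
| "instr_step (Store i j) (R, xs, ys) = (R(R i := R j), xs, ys)"
| "instr_step (Read i) (R, xs, ys) = (R(i := (case xs of [] \<Rightarrow> 0 | x # _ \<Rightarrow> x)), tl xs, ys)"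
| "instr_step (Write i) (R, xs, ys) = (R, xs, ys @ [R i])"
| "instr_step (Jump l) s = s"
| "instr_step (JumpZero i l) s = s"

text \<open>Restricting all accesses to registers below \<open>B\<close> turns \<open>B\<close> into
  a space bound. Jumps are rejected, so that a block is straight-line code.\<close>

fun instr_ok :: "nat \<Rightarrow> instr \<Rightarrow> state \<Rightarrow> bool" where
  "instr_ok B (Const i x) s \<longleftrightarrow> i < B"
| "instr_ok B (Add i j k) s \<longleftrightarrow> i < B \<and> j < B \<and> k < B"
| "instr_ok B (Sub i j k) s \<longleftrightarrow> i < B \<and> j < B \<and> k < B"
| "instr_ok B (Mul i j k) s \<longleftrightarrow> i < B \<and> j < B \<and> k < B"
| "instr_ok B (Div i j k) s \<longleftrightarrow> i < B \<and> j < B \<and> k < B"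
| "instr_ok B (Load i j) s \<longleftrightarrow> i < B \<and> j < B \<and> fst s j < B"
| "instr_ok B (Store i j) s \<longleftrightarrow> i < B \<and> j < B \<and> fst s i < B"
| "instr_ok B (Read i) s \<longleftrightarrow> i < B"
| "instr_ok B (Write i) s \<longleftrightarrow> i < B"
| "instr_ok B (Jump l) s \<longleftrightarrow> False"
| "instr_ok B (JumpZero i l) s \<longleftrightarrow> False"

text \<open>A weakest precondition by symbolic execution, in a form that the simplifier evaluates on
  concrete blocks.\<close>

fun block_post :: "nat \<Rightarrow> instr list \<Rightarrow> (state \<Rightarrow> bool) \<Rightarrow> state \<Rightarrow> bool" where
  "block_post B [] Q s \<longleftrightarrow> Q s"
| "block_post B (i # is) Q s \<longleftrightarrow> instr_ok B i s \<and> block_post B is Q (instr_step i s)"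

lemma exec_instr:
  assumes "instr_ok B i (state_of c)"
  shows "state_of (exec i c) = instr_step i (state_of c)" "pc (exec i c) = Suc (pc c)"
    "accessed i c \<subseteq> {..<B}"
  using assms by (cases i; auto simp: state_of_def set_reg_def)+

section \<open>Hoare-style rules with bounds on time and registers\<close>

definition reaches :: "program \<Rightarrow> nat \<Rightarrow> config \<Rightarrow> nat \<Rightarrow> config \<Rightarrow> bool" where
  "reaches P B c k c' \<longleftrightarrow> (step P ^^ k) c = c' \<and> (\<forall>r<k. step_accessed P ((step P ^^ r) c) \<subseteq> {..<B})"

lemma reaches_0: "reaches P B c 0 c"
  by (simp add: reaches_def)

lemma reaches_trans:
  assumes "reaches P B c k c'" "reaches P B c' l c''"
  shows "reaches P B c (k + l) c''"
  unfolding reaches_def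
proof (intro conjI allI impI)
  have k: "(step P ^^ (k + i)) c = (step P ^^ i) c'" for i
  proof -
    have "(step P ^^ (i + k)) c = (step P ^^ i) ((step P ^^ k) c)" by (simp add: funpow_add)
    moreover have "(step P ^^ k) c = c'" using assms(1) by (simp add: reaches_def)
    ultimately show ?thesis by (simp add: add.commute)
  qed
  show "(step P ^^ (k + l)) c = c''" using assms(2) k[of l] by (simp add: reaches_def)
  fix r assume r: "r < k + l"
  show "step_accessed P ((step P ^^ r) c) \<subseteq> {..<B}"
  proof (cases "r < k")
    case False
    then have "(step P ^^ r) c = (step P ^^ (r - k)) c'" using k[of "r - k"] by simp
    then show ?thesis using assms(2) r False by (simp add: reaches_def)
  qed (use assms(1) in \<open>simp add: reaches_def\<close>)
qed

lemma reaches_1: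
  assumes "pc c < length P" "P ! pc c = i" "accessed i c \<subseteq> {..<B}"
  shows "reaches P B c 1 (exec i c)"
  using assms by (simp add: reaches_def step_def step_accessed_def halted_def)

text \<open>Total correctness within time \<open>k\<close> and registers below \<open>B\<close>. The
  surrounding code is arbitrary, so a command can be reused at different addresses.\<close>

definition runs :: "nat \<Rightarrow> com \<Rightarrow> state \<Rightarrow> nat \<Rightarrow> (state \<Rightarrow> bool) \<Rightarrow> bool" where
  "runs B c s k Q \<longleftrightarrow> (\<forall>pre post a. pc a = length pre \<and> state_of a = s \<longrightarrow>
    (\<exists>l\<le>k. \<exists>b. reaches (pre @ compile (length pre) c @ post) B a l b \<and>
      pc b = length pre + code_size c \<and> Q (state_of b)))"

lemma runsE:
  assumes "runs B c s k Q" "pc a = length pre" "state_of a = s"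
  obtains l b where "l \<le> k" "reaches (pre @ compile (length pre) c @ post) B a l b"
    "pc b = length pre + code_size c" "Q (state_of b)"
proof -
  have "\<exists>l\<le>k. \<exists>b. reaches (pre @ compile (length pre) c @ post) B a l b \<and>
      pc b = length pre + code_size c \<and> Q (state_of b)"
    using assms unfolding runs_def by simp
  then show thesis using that by blast
qed

lemma runs_weaken:
  assumes "runs B c s k Q" "k \<le> k'" "\<And>s'. Q s' \<Longrightarrow> Q' s'"
  shows "runs B c s k' Q'"
  unfolding runs_def
proof (intro allI impI)
  fix pre post :: program and a assume a: "pc a = length pre \<and> state_of a = s"
  obtain l b where "l \<le> k" "reaches (pre @ compile (length pre) c @ post) B a l b"
    "pc b = length pre + code_size c" "Q (state_of b)" using a by (elim conjE runsE[OF assms(1)])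
  then show "\<exists>l\<le>k'. \<exists>b. reaches (pre @ compile (length pre) c @ post) B a l b \<and>
      pc b = length pre + code_size c \<and> Q' (state_of b)"
    using assms(2,3) le_trans by blast
qed

lemma runs_Blk:
  assumes "block_post B is Q s" "length is \<le> k"
  shows "runs B (Blk is) s k Q"
proof -
  have *: "\<exists>b. reaches (pre @ is @ post) B a (length is) b \<and> pc b = length pre + length is \<and> Q (state_of b)"
    if "pc a = length pre" "block_post B is Q (state_of a)" for pre post :: program and a "is"
    using that
  proof (induction "is" arbitrary: pre a)
    case Nil
    then show ?case using reaches_0 by fastforce
  next
    case (Cons i js)
    let ?P = "pre @ (i # js) @ post"
    have ok: "instr_ok B i (state_of a)" using Cons.prems by simp
    note e = exec_instr[OF ok]
    have "reaches ?P B a 1 (exec i a)"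
      using Cons.prems e by (intro reaches_1) (auto simp: nth_append)
    moreover have "\<exists>b. reaches ((pre @ [i]) @ js @ post) B (exec i a) (length js) b \<and>
        pc b = length (pre @ [i]) + length js \<and> Q (state_of b)"
      using Cons.prems e by (intro Cons.IH) auto
    then obtain b where "reaches ?P B (exec i a) (length js) b" "pc b = length (pre @ [i]) + length js"
      "Q (state_of b)" by auto
    ultimately show ?case using reaches_trans by fastforce
  qed
  show ?thesis unfolding runs_def
  proof (intro allI impI)
    fix pre post :: program and a assume "pc a = length pre \<and> state_of a = s"
    then obtain b where "reaches (pre @ is @ post) B a (length is) b" "pc b = length pre + length is" "Q (state_of b)"
      using *[of a pre "is" post] assms(1) by auto
    then show "\<exists>l\<le>k. \<exists>b. reaches (pre @ compile (length pre) (Blk is) @ post) B a l b \<and>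
      pc b = length pre + code_size (Blk is) \<and> Q (state_of b)" using assms(2) by auto
  qed
qed

lemma runs_Seq:
  assumes "runs B c s k R" "\<And>s'. R s' \<Longrightarrow> runs B d s' l Q" "k + l \<le> m"
  shows "runs B (c ;; d) s m Q"
  unfolding runs_def
proof (intro allI impI)
  fix pre post :: program and a assume a: "pc a = length pre \<and> state_of a = s"
  let ?P = "pre @ compile (length pre) (c ;; d) @ post"
  let ?c = "compile (length pre) c" and ?d = "compile (length pre + code_size c) d"
  obtain i b where b: "i \<le> k" "reaches ?P B a i b" "pc b = length pre + code_size c" "R (state_of b)"
    using runsE[OF assms(1), of a pre "?d @ post"] a by auto
  obtain j e where e: "j \<le> l" "reaches ((pre @ ?c) @ compile (length (pre @ ?c)) d @ post) B b j e"
    "pc e = length (pre @ ?c) + code_size d" "Q (state_of e)"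
    using runsE[OF assms(2)[OF b(4)], of b "pre @ ?c" post] b(3) by auto
  have "reaches ?P B b j e" using e(2) by simp
  then have "reaches ?P B a (i + j) e" using b(2) reaches_trans by blast
  then show "\<exists>l\<le>m. \<exists>b. reaches ?P B a l b \<and> pc b = length pre + code_size (c ;; d) \<and> Q (state_of b)"
    using b(1) e assms(3) by (intro exI[of _ "i + j"] conjI exI[of _ e]) auto
qed

lemma runs_IfNZ:
  assumes "i < B" "0 < fst s i \<Longrightarrow> runs B c s k Q" "fst s i = 0 \<Longrightarrow> runs B d s k Q" "k + 2 \<le> m"
  shows "runs B (IfNZ i c d) s m Q"
  unfolding runs_def
proof (intro allI impI)
  fix pre post :: program and a assume a: "pc a = length pre \<and> state_of a = s"
  let ?P = "pre @ compile (length pre) (IfNZ i c d) @ post"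
  let ?c = "compile (Suc (length pre)) c" and ?d = "compile (length pre + code_size c + 2) d"
  let ?J = "Jump (length pre + code_size c + code_size d + 2)"
  let ?Z = "JumpZero i (length pre + code_size c + 2)"
  have P: "?P = (pre @ [?Z]) @ ?c @ ?J # ?d @ post" "?P = (pre @ ?Z # ?c @ [?J]) @ ?d @ post" by simp_all
  have r: "reg a i = fst s i" using a by (auto simp: state_of_def)
  have first: "reaches ?P B a 1 (exec ?Z a)"
    using a assms(1) by (intro reaches_1) (auto simp: nth_append)
  have st: "state_of (exec ?Z a) = s" using a by (auto simp: state_of_def)
  show "\<exists>l\<le>m. \<exists>b. reaches ?P B a l b \<and> pc b = length pre + code_size (IfNZ i c d) \<and> Q (state_of b)"
  proof (cases "fst s i = 0")
    case True
    then have "pc (exec ?Z a) = length (pre @ ?Z # ?c @ [?J])" using r by simp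
    then obtain j e where e: "j \<le> k" "reaches ((pre @ ?Z # ?c @ [?J]) @ compile (length (pre @ ?Z # ?c @ [?J])) d @ post) B (exec ?Z a) j e"
      "pc e = length (pre @ ?Z # ?c @ [?J]) + code_size d" "Q (state_of e)"
      by (rule runsE[OF assms(3)[OF True] _ st])
    then have "reaches ?P B (exec ?Z a) j e" by simp
    then show ?thesis using reaches_trans[OF first] e assms(4)
      by (intro exI[of _ "1 + j"] conjI exI[of _ e]) auto
  next
    case False
    then have rc: "runs B c s k Q" using assms(2) by simp
    have "pc (exec ?Z a) = length (pre @ [?Z])" using False r a by simp
    then obtain j e where e: "j \<le> k" "reaches ((pre @ [?Z]) @ compile (length (pre @ [?Z])) c @ ?J # ?d @ post) B (exec ?Z a) j e"
      "pc e = length (pre @ [?Z]) + code_size c" "Q (state_of e)"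
      by (rule runsE[OF rc _ st])
    then have "reaches ?P B (exec ?Z a) j e" by simp
    moreover have "reaches ?P B e 1 (exec ?J e)" using e(3) by (intro reaches_1) (auto simp: nth_append)
    ultimately have "reaches ?P B a (1 + (j + 1)) (exec ?J e)" using reaches_trans first by blast
    then show ?thesis using e assms(4)
      by (intro exI[of _ "1 + (j + 1)"] conjI exI[of _ "exec ?J e"]) (auto simp: state_of_def)
  qed
qed

lemma runs_While_0:
  assumes "i < B" "fst s i = 0" "Q s" "1 \<le> m"
  shows "runs B (While i c) s m Q"
  unfolding runs_def
proof (intro allI impI)
  fix pre post :: program and a assume a: "pc a = length pre \<and> state_of a = s"
  let ?P = "pre @ compile (length pre) (While i c) @ post"
  let ?Z = "JumpZero i (length pre + code_size c + 2)"
  have r: "reg a i = fst s i" using a by (auto simp: state_of_def)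
  have "reaches ?P B a 1 (exec ?Z a)"
    using a assms(1) by (intro reaches_1) (auto simp: nth_append)
  then show "\<exists>l\<le>m. \<exists>b. reaches ?P B a l b \<and> pc b = length pre + code_size (While i c) \<and> Q (state_of b)"
    using a assms r by (intro exI[of _ 1] conjI exI[of _ "exec ?Z a"]) (auto simp: state_of_def)
qed

lemma runs_While_Suc:
  assumes "i < B" "0 < fst s i" "runs B c s k R" "\<And>s'. R s' \<Longrightarrow> runs B (While i c) s' l Q" "k + l + 2 \<le> m"
  shows "runs B (While i c) s m Q"
  unfolding runs_def
proof (intro allI impI)
  fix pre post :: program and a assume a: "pc a = length pre \<and> state_of a = s"
  let ?P = "pre @ compile (length pre) (While i c) @ post"
  let ?Z = "JumpZero i (length pre + code_size c + 2)" and ?J = "Jump (length pre)"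
  have r: "reg a i = fst s i" using a by (auto simp: state_of_def)
  have first: "reaches ?P B a 1 (exec ?Z a)"
    using a assms(1) by (intro reaches_1) (auto simp: nth_append)
  have st: "state_of (exec ?Z a) = s" using a by (auto simp: state_of_def)
  have "pc (exec ?Z a) = length (pre @ [?Z])" using r a assms(2) by simp
  then obtain j e where e: "j \<le> k" "reaches ((pre @ [?Z]) @ compile (length (pre @ [?Z])) c @ ?J # post) B (exec ?Z a) j e"
    "pc e = length (pre @ [?Z]) + code_size c" "R (state_of e)"
    by (rule runsE[OF assms(3) _ st])
  then have s2: "reaches ?P B (exec ?Z a) j e" by simp
  have s3: "reaches ?P B e 1 (exec ?J e)" using e(3) by (intro reaches_1) (auto simp: nth_append)
  have "pc (exec ?J e) = length pre" "state_of (exec ?J e) = state_of e" by (simp_all add: state_of_def)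
  then obtain o' f where f: "o' \<le> l" "reaches ?P B (exec ?J e) o' f"
    "pc f = length pre + code_size (While i c)" "Q (state_of f)"
    by (rule runsE[OF assms(4)[OF e(4)]])
  have "reaches ?P B a (1 + (j + (1 + o'))) f" using reaches_trans first s2 s3 f(2) by blast
  then show "\<exists>l\<le>m. \<exists>b. reaches ?P B a l b \<and> pc b = length pre + code_size (While i c) \<and> Q (state_of b)"
    using e f assms(5) by (intro exI[of _ "1 + (j + (1 + o'))"] conjI exI[of _ f]) auto
qed

text \<open>The invariant is indexed by the number of remaining iterations.\<close>

lemma runs_for:
  assumes "i < B" "I N s"
    and i: "\<And>n R xs ys. I n (R, xs, ys) \<Longrightarrow> R i = n"
    and step: "\<And>n R xs ys. Suc n \<le> N \<Longrightarrow> I (Suc n) (R, xs, ys) \<Longrightarrow> runs B c (R, xs, ys) k (I n)"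
    and "N * (k + 2) + 1 \<le> m"
  shows "runs B (While i c) s m (I 0)"
proof -
  have "runs B (While i c) s (n * (k + 2) + 1) (I 0)" if "I n s" "n \<le> N" for n s
    using that
  proof (induction n arbitrary: s)
    case 0
    then have "fst s i = 0" using i[of 0 "fst s"] by (cases s) auto
    then show ?case using 0 assms(1) by (intro runs_While_0) auto
  next
    case (Suc n)
    obtain R xs ys where s: "s = (R, xs, ys)" by (cases s)
    have "R i = Suc n" using i Suc.prems s by blast
    have "runs B c (R, xs, ys) k (I n)" using step Suc.prems s by blast
    show ?case unfolding s
    proof (rule runs_While_Suc[OF assms(1)])
      show "0 < fst (R, xs, ys) i" using \<open>R i = Suc n\<close> by simp
      show "runs B c (R, xs, ys) k (I n)" by fact
      show "runs B (While i c) s' (n * (k + 2) + 1) (I 0)" if "I n s'" for s'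
        using Suc.IH[OF that] Suc.prems by simp
    qed simp
  qed
  then show ?thesis using assms(2,5) runs_weaken by blast
qed

lemma runs_computes:
  assumes "runs B c ((\<lambda>_. 0), xs, []) k (\<lambda>(R, is, os). os = ys)" "real k \<le> T" "real B \<le> S"
  shows "computes_within (compile 0 c) xs ys T S"
proof -
  let ?a = "\<lparr>pc = 0, reg = (\<lambda>_. 0), inp = xs, out = []\<rparr>"
  obtain l b where l: "l \<le> k" "reaches (compile 0 c) B ?a l b" "pc b = code_size c" "out b = ys"
    using runsE[OF assms(1), of ?a "[]" "[]"] by (auto simp: state_of_def)
  have b: "config_after (compile 0 c) xs l = b" using l(2) by (simp add: config_after_def reaches_def)
  have "(\<Union>r<l. step_accessed (compile 0 c) (config_after (compile 0 c) xs r)) \<subseteq> {..<B}"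
    using l(2) by (auto simp: reaches_def config_after_def)
  then have "card (\<Union>r<l. step_accessed (compile 0 c) (config_after (compile 0 c) xs r)) \<le> B"
    by (metis card_lessThan card_mono finite_lessThan)
  then show ?thesis unfolding computes_within_def
    using l b assms(2,3) by (intro exI[of _ l]) (auto simp: halted_def)
qed

subsection \<open>Words as numbers\<close>

text \<open>The first symbol is the most significant digit. For words of equal length with symbols
  below \<open>X\<close>, numerical order is then lexicographic order; quotients by powers of
  \<open>X\<close> are prefixes, and remainders are suffixes.\<close>

fun num :: "nat \<Rightarrow> nat list \<Rightarrow> nat" where
  "num X [] = 0"
| "num X (d # w) = d * X ^ length w + num X w"

lemma num_append: "num X (a @ b) = num X a * X ^ length b + num X b"
  by (induction a) (auto simp: power_add algebra_simps)

lemma num_zeros [simp]: "num X (replicate k 0) = 0"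
  by (induction k) auto

lemma num_less:
  assumes "\<forall>d\<in>set w. d < X"
  shows "num X w < X ^ length w"
  using assms
proof (induction w)
  case (Cons d w)
  have "num X (d # w) < d * X ^ length w + X ^ length w" using Cons by simp
  also have "\<dots> = Suc d * X ^ length w" by simp
  also have "\<dots> \<le> X * X ^ length w" using Cons.prems by (intro mult_right_mono) auto
  finally show ?case by simp
qed simp

lemma num_less_iff:
  assumes "length a = length b" "\<forall>d\<in>set a. d < X" "\<forall>d\<in>set b. d < X"
  shows "num X a < num X b \<longleftrightarrow> a < b"
proof -
  have *: "num X a < num X b"
    if "length a = length b" "a < b" "\<forall>d\<in>set a. d < X" "\<forall>d\<in>set b. d < X" for a b
    using that
  proof (induction a b rule: list_induct2)
    case (Cons x a y b)
    show ?case
    proof (cases "x < y")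
      case True
      have "num X (x # a) < x * X ^ length a + X ^ length a" using Cons.prems num_less[of a X] by simp
      also have "\<dots> = Suc x * X ^ length a" by simp
      also have "\<dots> \<le> y * X ^ length a" using True by (intro mult_right_mono) auto
      also have "\<dots> \<le> num X (y # b)" using Cons.hyps by simp
      finally show ?thesis .
    qed (use Cons in auto)
  qed simp
  show ?thesis using *[of a b] *[of b a] assms by (metis less_asym linorder_less_linear less_irrefl)
qed

lemma num_le_iff:
  assumes "length a = length b" "\<forall>d\<in>set a. d < X" "\<forall>d\<in>set b. d < X"
  shows "num X a \<le> num X b \<longleftrightarrow> a \<le> b"
  using num_less_iff[of b a X] assms by (metis not_less)

lemma num_div_mod:
  assumes "\<forall>d\<in>set w. d < X" "i \<le> length w" "0 < X"
  shows "num X w div X ^ (length w - i) = num X (take i w)"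
    "num X w mod X ^ (length w - i) = num X (drop i w)"
proof -
  have "num X w = num X (take i w) * X ^ (length w - i) + num X (drop i w)"
    using num_append[of X "take i w" "drop i w"] by simp
  moreover have "num X (drop i w) < X ^ (length w - i)"
    using num_less[of "drop i w" X] assms(1) by (metis in_set_dropD length_drop)
  ultimately show "num X w div X ^ (length w - i) = num X (take i w)"
    "num X w mod X ^ (length w - i) = num X (drop i w)" using assms(3) by simp_all
qed

lemma pren_iff_num:
  assumes "\<forall>d\<in>set z. d < X" "length z = t" "0 < X"
  shows "pren z \<longleftrightarrow> (\<forall>i<t. num X z mod X ^ (t - i) \<le> num X z div X ^ i)"
proof -
  have "num X z mod X ^ (t - i) \<le> num X z div X ^ i \<longleftrightarrow> drop i z \<le> take (t - i) z" if "i \<le> t" for i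
  proof -
    have "num X z mod X ^ (t - i) = num X (drop i z)" using num_div_mod(2)[OF assms(1) _ assms(3), of i] that assms(2) by simp
    moreover have "num X z div X ^ i = num X (take (t - i) z)"
      using num_div_mod(1)[OF assms(1) _ assms(3), of "t - i"] that assms(2) by simp
    moreover have "\<forall>d\<in>set (drop i z). d < X" "\<forall>d\<in>set (take (t - i) z). d < X"
      using assms(1) by (auto dest: in_set_dropD in_set_takeD)
    ultimately show ?thesis using num_le_iff[of "drop i z" "take (t - i) z" X] that assms(2) by simp
  qed
  moreover have "pren z \<longleftrightarrow> (\<forall>i<t. drop i z \<le> take (t - i) z)"
    unfolding pren_def using assms(2) by (auto simp: order_le_less[of _ t])
  ultimately show ?thesis by auto
qed

subsection \<open>Subroutines\<close>

lemma runs_Blk_Seq: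
  assumes "block_post B is (\<lambda>s'. runs B d s' l Q) s" "length is + l \<le> m"
  shows "runs B (Blk is ;; d) s m Q"
  using runs_Seq[OF runs_Blk[OF assms(1) le_refl] _ assms(2)] by blast

lemma runs_Seq_le:
  assumes "runs B c s k P" "\<And>R xs ys. P (R, xs, ys) \<Longrightarrow> runs B d (R, xs, ys) l Q" "k + l \<le> m"
  shows "runs B (c ;; d) s m Q"
  by (rule runs_Seq[OF assms(1) _ assms(3)]) (use assms(2) in auto)

lemma runs_for':
  assumes "i < B" "I N s"
    and "\<And>n R xs ys. I n (R, xs, ys) \<Longrightarrow> R i = n"
    and "\<And>n R xs ys. Suc n \<le> N \<Longrightarrow> I (Suc n) (R, xs, ys) \<Longrightarrow> runs B c (R, xs, ys) k (I n)"
    and "\<And>R xs ys. I 0 (R, xs, ys) \<Longrightarrow> Q (R, xs, ys)" "N * (k + 2) + 1 \<le> m"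
  shows "runs B (While i c) s m Q"
proof -
  have "runs B (While i c) s m (I 0)"
    by (rule runs_for[where I = I and N = N and k = k]) (fact assms)+
  then show ?thesis by (rule runs_weaken) (use assms(5) in auto)
qed

text \<open>Register conventions: 0 to 9 hold the constants fixed by \<open>params\<close>, 10 holds the word given to a
  subroutine (as a number in base \<open>base n t\<close>), 11 the value computed by \<open>eval_prog\<close>, 12 is zero iff
  \<open>pren_check\<close> succeeds, 13 to 24 are scratch, 25 to 39 belong to the main programs. The coefficients
  \<open>bcoef\<close> and \<open>fcoef\<close> are stored alternately, from 40 and 41 on. \<open>same\<close> lists the registers
  that subroutines leave alone.\<close>

definition base :: "nat \<Rightarrow> nat \<Rightarrow> nat" where
  "base n t = card (words n t) + 2"

definition params :: "nat \<Rightarrow> nat \<Rightarrow> (nat \<Rightarrow> nat) \<Rightarrow> bool" where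
  "params n t R \<longleftrightarrow> R 0 = n \<and> R 1 = t \<and> R 2 = card (words n t) \<and> R 3 = base n t \<and>
    R 4 = base n t ^ n \<and> R 5 = base n t ^ t \<and> R 6 = 1 \<and> R 7 = 2 \<and> R 8 = base n t - 1 \<and> R 9 = base n t ^ (t - 1)"

definition same :: "(nat \<Rightarrow> nat) \<Rightarrow> (nat \<Rightarrow> nat) \<Rightarrow> bool" where
  "same R R' \<longleftrightarrow> (\<forall>i. i \<le> 10 \<or> 25 \<le> i \<and> i < 40 \<longrightarrow> R' i = R i)"

lemma paramsD:
  assumes "params n t R"
  shows "R 0 = n" "R (Suc 0) = t" "R 2 = card (words n t)" "R 3 = base n t"
    "R 4 = base n t ^ n" "R 5 = base n t ^ t" "R 6 = Suc 0" "R 7 = 2" "R 8 = base n t - Suc 0"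
    "R 9 = base n t ^ (t - Suc 0)"
  using assms by (auto simp: params_def)

lemma base_pos [simp]: "0 < base n t"
  by (simp add: base_def)

lemma same_params: "same R R' \<Longrightarrow> params n t R \<Longrightarrow> params n t R'"
  by (simp add: same_def params_def)

lemma sameD: "same R R' \<Longrightarrow> i \<le> 10 \<or> 25 \<le> i \<and> i < 40 \<Longrightarrow> R' i = R i"
  unfolding same_def by blast

lemma same_refl [simp]: "same R R"
  by (simp add: same_def)

lemma same_trans: "same R R' \<Longrightarrow> same R' R'' \<Longrightarrow> same R R''"
  by (simp add: same_def)

lemma same_upd [simp]: "11 \<le> j \<Longrightarrow> j < 25 \<or> 40 \<le> j \<Longrightarrow> same R R' \<Longrightarrow> same R (R'(j := x))"
  by (auto simp: same_def)

text \<open>Truncated differences are accumulated in register 12: it stays 0 exactly if no suffix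
  exceeds the prefix of its length, so the test takes no branch.\<close>

definition pren_body :: com where
  "pren_body = Blk [Div 16 10 13, Mul 16 16 13, Sub 16 10 16, Div 17 10 14, Sub 16 16 17, Add 12 12 16,
      Div 13 13 3, Mul 14 14 3, Sub 15 15 6]"

text \<open>Register 6 holds 1, and \<open>Mul i j 6\<close> serves as a copy instruction in all
  programs.\<close>

definition pren_check :: com where
  "pren_check = Blk [Const 12 0, Mul 13 5 6, Const 14 1, Mul 15 1 6] ;; While 15 pren_body"

lemma runs_pren_check:
  assumes S: "params n t R" and z: "R 10 = num (base n t) z" "length z = t" "\<forall>d\<in>set z. d < base n t"
    and B: "50 \<le> B"
  shows "runs B pren_check (R, xs, ys) (11 * t + 5) (\<lambda>(R', xs', ys'). xs' = xs \<and> ys' = ys \<and> same R R' \<and>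
    R' 11 = R 11 \<and> (R' 12 = 0 \<longleftrightarrow> pren z))"
proof -
  define X where "X = base n t"
  have X: "0 < X" by (simp add: X_def)
  define v where "v = num X z"
  define I where "I = (\<lambda>k (R', xs', ys'). xs' = xs \<and> ys' = ys \<and> same R R' \<and> R' 11 = R 11 \<and> R' 15 = k \<and>
    R' 13 = X ^ k \<and> R' 14 = X ^ (t - k) \<and> (R' 12 = 0 \<longleftrightarrow> (\<forall>i<t - k. v mod X ^ (t - i) \<le> v div X ^ i)))"
  let ?R = "R(12 := 0, 13 := X ^ t, 14 := 1, 15 := t)"
  have w: "runs B (While 15 pren_body) (?R, xs, ys) (11 * t + 1)
    (\<lambda>(R', xs', ys'). xs' = xs \<and> ys' = ys \<and> same R R' \<and> R' 11 = R 11 \<and> (R' 12 = 0 \<longleftrightarrow> pren z))"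
  proof (rule runs_for'[where k = 9 and N = t and I = I])
    show "I t (?R, xs, ys)" by (simp add: I_def)
    fix k R' xs' ys' assume k: "Suc k \<le> t" and I: "I (Suc k) (R', xs', ys')"
    have i: "same R R'" "R' 15 = Suc k" "R' 13 = X ^ Suc k" "R' 14 = X ^ (t - Suc k)"
      "R' 12 = 0 \<longleftrightarrow> (\<forall>i<t - Suc k. v mod X ^ (t - i) \<le> v div X ^ i)" "xs' = xs" "ys' = ys" "R' 11 = R 11"
      using I by (auto simp: I_def)
    note c = paramsD[OF same_params[OF i(1) S]]
    have c': "R' 10 = v" using sameD[OF i(1)] z by (simp add: v_def X_def)
    have e: "t - k = Suc (t - Suc k)" using k by simp
    have m: "v - v div X ^ Suc k * X ^ Suc k = v mod X ^ (t - (t - Suc k))"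
      using k by (simp only: minus_div_mult_eq_mod diff_diff_cancel)
    have *: "(\<forall>i<t - k. v mod X ^ (t - i) \<le> v div X ^ i) \<longleftrightarrow>
      (\<forall>i<t - Suc k. v mod X ^ (t - i) \<le> v div X ^ i) \<and> v mod X ^ (t - (t - Suc k)) \<le> v div X ^ (t - Suc k)"
      unfolding e by (auto simp: less_Suc_eq)
    show "runs B pren_body (R', xs', ys') 9 (I k)" unfolding pren_body_def
    proof (rule runs_Blk)
      have "X ^ Suc k div X = X ^ k" "X ^ (t - Suc k) * X = X ^ (t - k)" using X by (simp_all add: e)
      then show "block_post B [Div 16 10 13, Mul 16 16 13, Sub 16 10 16, Div 17 10 14, Sub 16 16 17, Add 12 12 16,
        Div 13 13 3, Mul 14 14 3, Sub 15 15 6] (I k) (R', xs', ys')"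
        using B k *[symmetric] by (simp add: I_def i c c' m X_def[symmetric] del: power_Suc)
    qed simp
  qed (use B pren_iff_num[of z X t] z X in \<open>auto simp: I_def v_def X_def\<close>)
  show ?thesis unfolding pren_check_def
    by (rule runs_Blk_Seq[where l = "11 * t + 1"]) (use B w in \<open>simp_all add: paramsD[OF S] X_def\<close>)
qed

subsection \<open>Evaluation of the counting formula\<close>

text \<open>Horner's rule for the geometric sum in register 19, together with the power in
  20.\<close>

definition geo_body :: com where
  "geo_body = Blk [Mul 19 19 3, Add 19 19 6, Mul 20 20 3, Sub 18 18 6]"

text \<open>Register 13 holds the symbols still to be read, 14 the weight of the first of them, 15
  the power of \<open>X\<close> for the sum of those already read, and 16 the address of the next
  coefficient.\<close>

definition coef_body :: com where
  "coef_body = Blk [Div 18 13 14, Mul 19 18 14, Sub 13 13 19, Div 14 14 3, Const 19 0, Const 20 1] ;;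
    While 18 geo_body ;;
    Blk [Mul 21 15 19, Store 16 21, Mul 15 15 20, Add 16 16 7, Sub 17 17 6]"

text \<open>One term of the convolution. The addresses in 20 and 21 move in opposite directions, in
  steps of 2 because the two kinds of coefficients alternate in memory.\<close>

definition conv_body :: com where
  "conv_body = Blk [Load 22 20, Load 23 21, Mul 22 22 23, Add 19 19 22, Add 20 20 7, Sub 21 21 7, Sub 18 18 6]"

definition fcoef_body :: com where
  "fcoef_body = Blk [Mul 18 14 6, Const 19 0, Const 20 40, Mul 21 13 6] ;;
    While 18 conv_body ;;
    Blk [Add 13 13 7, Store 13 19, Add 14 14 6, Sub 17 17 6]"

definition vcoef_body :: com where
  "vcoef_body = Blk [Load 22 20, Load 23 21, Mul 22 22 23, Mul 22 22 14, Add 19 19 22, Add 20 20 7,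
    Sub 21 21 7, Add 14 14 6, Sub 18 18 6]"

definition coef_prog :: com where
  "coef_prog = Blk [Mul 13 10 6, Mul 14 9 6, Const 15 1, Const 16 40, Mul 17 1 6] ;; While 17 coef_body"

definition fcoef_prog :: com where
  "fcoef_prog = Blk [Const 13 41, Store 13 6, Const 14 1, Mul 17 1 6] ;; While 17 fcoef_body"

definition vcoef_prog :: com where
  "vcoef_prog = Blk [Mul 18 1 6, Const 19 0, Const 20 40, Sub 21 13 7, Const 14 1] ;; While 18 vcoef_body"

text \<open>The machine divides but has no remainder instruction, so both remainders are computed as
  \<open>x - x div m * m\<close>.\<close>

definition reduce_prog :: com where
  "reduce_prog = Blk [Div 20 19 4, Mul 20 20 4, Sub 19 19 20, Div 20 19 8, Mul 20 20 8, Sub 11 19 20]"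

definition eval_prog :: com where
  "eval_prog = coef_prog ;; fcoef_prog ;; vcoef_prog ;; reduce_prog"

lemma sum_power_Suc: "(\<Sum>x<Suc m. X ^ x) = (\<Sum>x<m. X ^ x) * X + (1::nat)"
proof (induction m)
  case (Suc m)
  have "(\<Sum>x<Suc (Suc m). X ^ x) = (\<Sum>x<Suc m. X ^ x) + X ^ Suc m" by simp
  also have "\<dots> = ((\<Sum>x<m. X ^ x) + X ^ m) * X + 1" unfolding Suc.IH by (simp add: algebra_simps)
  finally show ?case by simp
qed simp

lemma runs_geo:
  assumes "R 3 = X" "R 6 = 1" "50 \<le> B" "R 18 = d" "R 19 = 0" "R 20 = 1"
  shows "runs B (While 18 geo_body) (R, xs, ys) (6 * d + 1)
    (\<lambda>s. s = (R(18 := 0, 19 := (\<Sum>x<d. X ^ x), 20 := X ^ d), xs, ys))"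
proof -
  define I where "I = (\<lambda>k s. k \<le> d \<and> s = (R(18 := k, 19 := (\<Sum>x<d - k. X ^ x), 20 := X ^ (d - k)), xs, ys))"
  show ?thesis
  proof (rule runs_for'[where k = 4 and N = d and I = I])
    show "I d (R, xs, ys)" using assms by (auto simp: I_def fun_eq_iff)
    show "\<And>n R' xs' ys'. I n (R', xs', ys') \<Longrightarrow> R' 18 = n" by (auto simp: I_def)
    show "(R', xs', ys') = (R(18 := 0, 19 := (\<Sum>x<d. X ^ x), 20 := X ^ d), xs, ys)"
      if "I 0 (R', xs', ys')" for R' xs' ys' using that by (simp add: I_def)
    fix k R' xs' ys' assume "Suc k \<le> d" and I: "I (Suc k) (R', xs', ys')"
    then have e: "d - k = Suc (d - Suc k)" by simp
    show "runs B geo_body (R', xs', ys') 4 (I k)" unfolding geo_body_def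
      using I assms(1-3) by (intro runs_Blk)
        (simp_all add: I_def fun_eq_iff e sum_power_Suc del: sum.lessThan_Suc)
  qed (use assms in auto)
qed

lemma runs_coefs:
  assumes S: "params n t R" and z: "R 10 = num (base n t) z" "length z = t" "\<forall>d\<in>set z. d \<le> n"
    and X: "n < base n t" and B: "2 * t + 50 \<le> B"
  shows "runs B coef_prog
    (R, xs, ys) (t * (6 * n + 14) + 6) (\<lambda>(R', xs', ys'). xs' = xs \<and> ys' = ys \<and> same R R' \<and>
    (\<forall>l<t. R' (40 + 2 * l) = bcoef (base n t) z l))"
proof -
  define X where "X = base n t"
  have X0: "0 < X" by (simp add: X_def)
  have zX: "\<forall>d\<in>set z. d < X" using z(3) X by (auto simp: X_def)
  \<comment> \<open>The clause for register 14 is restricted to \<open>0 < k\<close>: the last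
    division leaves 0 there, while \<open>X ^ (0 - 1)\<close> is 1.\<close>
  define I where "I = (\<lambda>k (R', xs', ys'). xs' = xs \<and> ys' = ys \<and> same R R' \<and> R' 17 = k \<and>
    R' 13 = num X (drop (t - k) z) \<and> (0 < k \<longrightarrow> R' 14 = X ^ (k - 1)) \<and> R' 15 = X ^ sum_list (take (t - k) z) \<and>
    R' 16 = 40 + 2 * (t - k) \<and> (\<forall>l<t - k. R' (40 + 2 * l) = bcoef X z l))"
  let ?R = "R(13 := num X z, 14 := X ^ (t - 1), 15 := 1, 16 := 40, 17 := t)"
  have w: "runs B (While 17 coef_body) (?R, xs, ys) (t * (6 * n + 14) + 1)
    (\<lambda>(R', xs', ys'). xs' = xs \<and> ys' = ys \<and> same R R' \<and> (\<forall>l<t. R' (40 + 2 * l) = bcoef (base n t) z l))"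
  proof (rule runs_for'[where k = "6 * n + 12" and N = t and I = I])
    show "I t (?R, xs, ys)" by (simp add: I_def)
    fix k R1 xs' ys' assume k: "Suc k \<le> t" and I: "I (Suc k) (R1, xs', ys')"
    define j where "j = t - Suc k"
    have jk: "t - Suc k = j" "t - k = Suc j" "j < t" "t - j - 1 = k" "length z - Suc j = k"
      using k z(2) by (auto simp: j_def)
    have i: "same R R1" "R1 17 = Suc k" "R1 13 = num X (drop j z)" "R1 14 = X ^ k"
      "R1 15 = X ^ sum_list (take j z)" "R1 16 = 40 + 2 * j" "\<And>l. l < j \<Longrightarrow> R1 (40 + 2 * l) = bcoef X z l"
      "xs' = xs" "ys' = ys"
      using I by (auto simp: I_def jk)
    note c = paramsD[OF same_params[OF i(1) S], folded X_def]
    define d where "d = z ! j"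
    have dz: "drop j z = d # drop (Suc j) z" using jk z(2) by (simp add: d_def Cons_nth_drop_Suc)
    have dn: "d \<le> n" using z jk by (simp add: d_def)
    have less: "num X (drop (Suc j) z) < X ^ k"
      using num_less[of "drop (Suc j) z" X] zX jk by (metis in_set_dropD length_drop)
    have nd: "num X (drop j z) = d * X ^ k + num X (drop (Suc j) z)" unfolding dz using jk by simp
    have q: "num X (drop j z) div X ^ k = d" "num X (drop j z) - d * X ^ k = num X (drop (Suc j) z)"
      unfolding nd using less X0 by simp_all
    have b: "bcoef X z j = X ^ sum_list (take j z) * (\<Sum>x<d. X ^ x)" by (simp add: bcoef_def d_def)
    have P: "X ^ sum_list (take (Suc j) z) = X ^ sum_list (take j z) * X ^ d"
      using jk z(2) by (simp add: take_Suc_conv_app_nth power_add d_def)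
    have A: "40 + 2 * j < B" using B jk by simp
    let ?R1 = "R1(18 := d, 19 := d * X ^ k, 13 := num X (drop (Suc j) z), 14 := X ^ k div X, 19 := 0, 20 := Suc 0)"
    let ?R2 = "?R1(18 := 0, 19 := (\<Sum>x<d. X ^ x), 20 := X ^ d)"
    have fin: "runs B (Blk [Mul 21 15 19, Store 16 21, Mul 15 15 20, Add 16 16 7, Sub 17 17 6]) (?R2, xs, ys) 5 (I k)"
    proof (rule runs_Blk)
      have "0 < k \<longrightarrow> X ^ k div X = X ^ (k - 1)" using X0 by (cases k) auto
      moreover have "l < Suc j \<Longrightarrow> 40 + 2 * l \<noteq> 40 + 2 * j \<Longrightarrow> R1 (40 + 2 * l) = bcoef X z l" for l
        using i(7) by (cases "l = j") auto
      ultimately show "block_post B [Mul 21 15 19, Store 16 21, Mul 15 15 20, Add 16 16 7, Sub 17 17 6] (I k) (?R2, xs, ys)"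
        using A B by (auto simp: I_def i c jk b P less_Suc_eq)
    qed simp
    have "runs B (While 18 geo_body) (?R1, xs, ys) (6 * d + 1) (\<lambda>s. s = (?R2, xs, ys))"
      by (rule runs_geo[where X = X]) (use B in \<open>simp_all add: c\<close>)
    then have g: "runs B (While 18 geo_body ;; Blk [Mul 21 15 19, Store 16 21, Mul 15 15 20, Add 16 16 7, Sub 17 17 6])
      (?R1, xs, ys) (6 * n + 6) (I k)"
      by (rule runs_Seq[where l = 5]) (use fin dn in auto)
    show "runs B coef_body (R1, xs', ys') (6 * n + 12) (I k)" unfolding coef_body_def
      by (rule runs_Blk_Seq[where l = "6 * n + 6"]) (use B g in \<open>simp_all add: i c q\<close>)
  qed (use B in \<open>auto simp: I_def X_def add.commute\<close>)
  show ?thesis unfolding coef_prog_def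
    by (rule runs_Blk_Seq[where l = "t * (6 * n + 14) + 1"]) (use B w in \<open>simp_all add: paramsD[OF S] z X_def\<close>)
qed

lemma fcoef_Suc_lt: "fcoef X z (Suc m) = (\<Sum>l<Suc m. bcoef X z l * fcoef X z (m - l))"
  by (simp add: lessThan_Suc_atMost)

lemma runs_conv:
  assumes R: "R 6 = 1" "R 7 = 2" "R 18 = Suc m" "R 19 = 0" "R 20 = 40" "R 21 = 41 + 2 * m"
    and A: "\<And>l. l \<le> m \<Longrightarrow> R (40 + 2 * l) = bcoef X z l" "\<And>l. l \<le> m \<Longrightarrow> R (41 + 2 * l) = fcoef X z l"
    and B: "2 * m + 50 \<le> B"
  shows "runs B (While 18 conv_body) (R, xs, ys) (9 * Suc m + 1)
    (\<lambda>s. \<exists>a b c d. s = (R(18 := 0, 19 := fcoef X z (Suc m), 20 := a, 21 := b, 22 := c, 23 := d), xs, ys))"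
proof -
  define I where "I = (\<lambda>k s. k \<le> Suc m \<and> (\<exists>a b. s = (R(18 := k,
    19 := (\<Sum>l<Suc m - k. bcoef X z l * fcoef X z (m - l)), 20 := 40 + 2 * (Suc m - k),
    21 := 41 + 2 * m - 2 * (Suc m - k), 22 := a, 23 := b), xs, ys)))"
  show ?thesis
  proof (rule runs_for'[where k = 7 and N = "Suc m" and I = I])
    have "R = R(18 := Suc m, 19 := 0, 20 := 40, 21 := 41 + 2 * m, 22 := R 22, 23 := R 23)"
      using R by (simp add: fun_eq_iff)
    then show "I (Suc m) (R, xs, ys)" unfolding I_def by simp blast
    show "\<And>n R' xs' ys'. I n (R', xs', ys') \<Longrightarrow> R' 18 = n" by (auto simp: I_def)
    show "\<exists>a b c d. (R', xs', ys') = (R(18 := 0, 19 := fcoef X z (Suc m), 20 := a, 21 := b, 22 := c, 23 := d), xs, ys)"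
      if "I 0 (R', xs', ys')" for R' xs' ys'
      using that unfolding I_def fcoef_Suc_lt by (simp del: sum.lessThan_Suc fcoef.simps) blast
    fix k R' xs' ys' assume k: "Suc k \<le> Suc m" and I: "I (Suc k) (R', xs', ys')"
    define l where "l = m - k"
    have l: "Suc m - Suc k = l" "Suc m - k = Suc l" "l \<le> m" "41 + 2 * m - 2 * l = 41 + 2 * (m - l)"
      using k by (auto simp: l_def)
    obtain a b where R': "R' = R(18 := Suc k, 19 := (\<Sum>l<l. bcoef X z l * fcoef X z (m - l)), 20 := 40 + 2 * l,
      21 := 41 + 2 * (m - l), 22 := a, 23 := b)" "xs' = xs" "ys' = ys"
      using I l unfolding I_def by auto
    have s: "(\<Sum>l<Suc m - k. bcoef X z l * fcoef X z (m - l)) =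
       (\<Sum>l<l. bcoef X z l * fcoef X z (m - l)) + bcoef X z l * fcoef X z (m - l)"
      unfolding l by simp
    have ad: "40 + 2 * l < B" "41 + 2 * (m - l) < B" using B l by auto
    have p: "41 + 2 * (m - l) - 2 = 41 + 2 * m - 2 * (Suc m - k)" "40 + 2 * l + 2 = 40 + 2 * (Suc m - k)"
      using l by auto
    show "runs B conv_body (R', xs', ys') 7 (I k)" unfolding conv_body_def
    proof (rule runs_Blk)
      show "block_post B [Load 22 20, Load 23 21, Mul 22 22 23, Add 19 19 22, Add 20 20 7, Sub 21 21 7, Sub 18 18 6] (I k) (R', xs', ys')"
        using ad k B A[of l] A[of "m - l"] l(3) R(1,2)
        by (simp add: R' I_def s p[symmetric] fun_eq_iff del: sum.lessThan_Suc)
          (intro exI[of _ "bcoef X z l * fcoef X z (m - l)"] exI[of _ "fcoef X z (m - l)"], simp)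
    qed simp
  qed (use B R in auto)
qed

lemma runs_fcoefs:
  assumes S: "params n t R" and b: "\<And>l. l < t \<Longrightarrow> R (40 + 2 * l) = bcoef X z l"
    and B: "2 * t + 50 \<le> B"
  shows "runs B fcoef_prog
    (R, xs, ys) (t * (9 * t + 11) + 5) (\<lambda>(R', xs', ys'). xs' = xs \<and> ys' = ys \<and> same R R' \<and> R' 13 = 41 + 2 * t \<and>
    (\<forall>l<t. R' (40 + 2 * l) = bcoef X z l) \<and> (\<forall>l\<le>t. R' (41 + 2 * l) = fcoef X z l))"
proof -
  define I where "I = (\<lambda>k (R', xs', ys'). xs' = xs \<and> ys' = ys \<and> same R R' \<and> R' 17 = k \<and>
    R' 13 = 41 + 2 * (t - k) \<and> R' 14 = Suc (t - k) \<and> (\<forall>l<t. R' (40 + 2 * l) = bcoef X z l) \<and>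
    (\<forall>l\<le>t - k. R' (41 + 2 * l) = fcoef X z l))"
  let ?R = "R(13 := 41, 41 := 1, 14 := 1, 17 := t)"
  have w: "runs B (While 17 fcoef_body) (?R, xs, ys) (t * (9 * t + 11) + 1)
    (\<lambda>(R', xs', ys'). xs' = xs \<and> ys' = ys \<and> same R R' \<and> R' 13 = 41 + 2 * t \<and>
    (\<forall>l<t. R' (40 + 2 * l) = bcoef X z l) \<and> (\<forall>l\<le>t. R' (41 + 2 * l) = fcoef X z l))"
  proof (rule runs_for'[where k = "9 * t + 9" and N = t and I = I])
    have "40 + 2 * l \<noteq> 41" for l :: nat by presburger
    then show "I t (?R, xs, ys)" using b by (simp add: I_def)
    fix k R1 xs' ys' assume k: "Suc k \<le> t" and I: "I (Suc k) (R1, xs', ys')"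
    define m where "m = t - Suc k"
    have mk: "t - Suc k = m" "t - k = Suc m" "m < t" using k by (auto simp: m_def)
    have i: "same R R1" "R1 17 = Suc k" "R1 13 = 41 + 2 * m" "R1 14 = Suc m"
      "\<And>l. l < t \<Longrightarrow> R1 (40 + 2 * l) = bcoef X z l" "\<And>l. l \<le> m \<Longrightarrow> R1 (41 + 2 * l) = fcoef X z l"
      "xs' = xs" "ys' = ys"
      using I by (auto simp: I_def mk)
    note c = paramsD[OF same_params[OF i(1) S]]
    let ?R1 = "R1(18 := Suc m, 19 := 0, 20 := 40, 21 := 41 + 2 * m)"
    let ?fin = "[Add 13 13 7, Store 13 19, Add 14 14 6, Sub 17 17 6]"
    have fin: "runs B (Blk ?fin) (R2, xs, ys) 4 (I k)"
      if R2: "R2 = ?R1(18 := 0, 19 := fcoef X z (Suc m), 20 := a, 21 := b, 22 := c, 23 := d)" for R2 a b c d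
    proof (rule runs_Blk)
      have "40 + 2 * l \<noteq> 43 + 2 * m" for l :: nat by presburger
      moreover have "fcoef X z l = R1 (41 + 2 * l)" if "l \<le> Suc m" "l \<noteq> Suc m" for l
        using that i(6)[of l] by simp
      moreover have "2 * l = Suc (Suc (2 * m)) \<longleftrightarrow> l = Suc m" for l :: nat by presburger
      moreover have "43 + 2 * m < B" using B mk(3) by linarith
      ultimately show "block_post B ?fin (I k) (R2, xs, ys)"
        using B by (auto simp: R2 I_def i c mk simp del: fcoef.simps)
    qed simp
    have "runs B (While 18 conv_body) (?R1, xs, ys) (9 * Suc m + 1)
      (\<lambda>s. \<exists>a b c d. s = (?R1(18 := 0, 19 := fcoef X z (Suc m), 20 := a, 21 := b, 22 := c, 23 := d), xs, ys))"
      by (rule runs_conv) (use B mk in \<open>simp_all add: i c\<close>)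
    then have g: "runs B (While 18 conv_body ;; Blk ?fin) (?R1, xs, ys) (9 * t + 5) (I k)"
    proof (rule runs_Seq[where l = 4])
      fix s' assume "\<exists>a b c d. s' = (?R1(18 := 0, 19 := fcoef X z (Suc m), 20 := a, 21 := b, 22 := c, 23 := d), xs, ys)"
      then show "runs B (Blk ?fin) s' 4 (I k)" using fin by blast
    qed (use mk in simp)
    show "runs B fcoef_body (R1, xs', ys') (9 * t + 9) (I k)" unfolding fcoef_body_def
      by (rule runs_Blk_Seq[where l = "9 * t + 5"]) (use B g in \<open>simp_all add: i c\<close>)
  qed (use B in \<open>auto simp: I_def\<close>)
  show ?thesis unfolding fcoef_prog_def
    by (rule runs_Blk_Seq[where l = "t * (9 * t + 11) + 1"]) (use B w in \<open>simp_all add: paramsD[OF S]\<close>)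
qed

lemma runs_vcoef:
  assumes R: "R 6 = 1" "R 7 = 2" "R 18 = Suc m" "R 19 = 0" "R 20 = 40" "R 21 = 41 + 2 * m" "R 14 = 1"
    and A: "\<And>l. l \<le> m \<Longrightarrow> R (40 + 2 * l) = bcoef X z l" "\<And>l. l \<le> m \<Longrightarrow> R (41 + 2 * l) = fcoef X z l"
    and B: "2 * m + 50 \<le> B" and z: "length z = Suc m"
  shows "runs B (While 18 vcoef_body) (R, xs, ys) (11 * Suc m + 1)
    (\<lambda>(R', xs', ys'). xs' = xs \<and> ys' = ys \<and> same R R' \<and> R' 19 = vcoef X z)"
proof -
  define g where "g l = Suc l * bcoef X z l * fcoef X z (m - l)" for l
  define I where "I = (\<lambda>k (R', xs', ys'). xs' = xs \<and> ys' = ys \<and> same R R' \<and> k \<le> Suc m \<and> R' 18 = k \<and>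
    R' 19 = (\<Sum>l<Suc m - k. g l) \<and> R' 20 = 40 + 2 * (Suc m - k) \<and>
    R' 21 = 41 + 2 * m - 2 * (Suc m - k) \<and> R' 14 = Suc (Suc m - k) \<and>
    (\<forall>l\<le>m. R' (40 + 2 * l) = bcoef X z l \<and> R' (41 + 2 * l) = fcoef X z l))"
  show ?thesis
  proof (rule runs_for'[where k = 9 and N = "Suc m" and I = I])
    show "I (Suc m) (R, xs, ys)" unfolding I_def using R A by simp
    show "case (R', xs', ys') of (R', xs', ys') \<Rightarrow> xs' = xs \<and> ys' = ys \<and> same R R' \<and> R' 19 = vcoef X z"
      if "I 0 (R', xs', ys')" for R' xs' ys'
      using that z by (simp add: I_def vcoef_def g_def)
    fix k R' xs' ys' assume k: "Suc k \<le> Suc m" and I: "I (Suc k) (R', xs', ys')"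
    define l where "l = m - k"
    have l: "Suc m - Suc k = l" "Suc m - k = Suc l" "l \<le> m" "41 + 2 * m - 2 * l = 41 + 2 * (m - l)"
      using k by (auto simp: l_def)
    have i: "same R R'" "R' 18 = Suc k" "R' 19 = (\<Sum>l<l. g l)"
      "R' 20 = 40 + 2 * l" "R' 21 = 41 + 2 * (m - l)" "R' 14 = Suc l"
      "\<And>l. l \<le> m \<Longrightarrow> R' (40 + 2 * l) = bcoef X z l" "\<And>l. l \<le> m \<Longrightarrow> R' (41 + 2 * l) = fcoef X z l"
      "xs' = xs" "ys' = ys"
      using I unfolding I_def prod.case l(1) l(4) by blast+
    have c: "R' 6 = Suc 0" "R' 7 = 2" using sameD[OF i(1)] R by auto
    have s: "bcoef X z l * fcoef X z (m - l) * Suc l = g l"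
      unfolding g_def by (simp only: mult.commute mult.left_commute)
    have ad: "40 + 2 * l < B" "41 + 2 * (m - l) < B" using B l by auto
    have p: "39 + 2 * (m - l) = 41 + 2 * m - Suc (Suc (2 * l))"
      using l by simp
    show "runs B vcoef_body (R', xs', ys') 9 (I k)" unfolding vcoef_body_def
    proof (rule runs_Blk)
      show "block_post B [Load 22 20, Load 23 21, Mul 22 22 23, Mul 22 22 14, Add 19 19 22, Add 20 20 7,
        Sub 21 21 7, Add 14 14 6, Sub 18 18 6] (I k) (R', xs', ys')"
        using ad k B l(3) s p
        by (simp add: I_def i c l(2))
    qed simp
  qed (use B R in \<open>auto simp: I_def\<close>)
qed

lemma runs_eval:
  assumes S: "params n t R" and z: "R 10 = num (base n t) z" "length z = t" "\<forall>d\<in>set z. d \<le> n"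
    and X: "n < base n t" and B: "2 * t + 50 \<le> B" and t: "1 \<le> t" and n: "1 \<le> n"
  shows "runs B eval_prog (R, xs, ys) (65 * (n * t + t * t)) (\<lambda>(R', xs', ys'). xs' = xs \<and> ys' = ys \<and>
    same R R' \<and> R' 11 = tval n (base n t) z)"
proof -
  define X where "X = base n t"
  obtain m where m: "t = Suc m" using t by (cases t) auto
  have le: "1 \<le> t * t" "t \<le> t * t" "t \<le> n * t" using t n by (auto simp: Suc_le_eq)
  \<comment> \<open>The lower-order terms \<open>36 * t + 23\<close> are absorbed by
    \<open>t \<le> n * t\<close>, \<open>t \<le> t * t\<close> and
    \<open>1 \<le> t * t\<close>.\<close>
  have time: "(t * (6 * n + 14) + 6) + ((t * (9 * t + 11) + 5) + (11 * t + 12)) \<le> 65 * (n * t + t * t)"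
  proof -
    have "(t * (6 * n + 14) + 6) + ((t * (9 * t + 11) + 5) + (11 * t + 12)) = 6 * (n * t) + 9 * (t * t) + 36 * t + 23"
      by (simp add: algebra_simps)
    moreover have "65 * (n * t + t * t) = 65 * (n * t) + 65 * (t * t)" by simp
    ultimately show ?thesis using le by linarith
  qed
  show ?thesis unfolding eval_prog_def
  proof (rule runs_Seq_le[OF runs_coefs[OF S z X B], where l = "(t * (9 * t + 11) + 5) + (11 * t + 12)"])
    fix R1 xs1 ys1
    assume "case (R1, xs1, ys1) of (R', xs', ys') \<Rightarrow> xs' = xs \<and> ys' = ys \<and> same R R' \<and>
      (\<forall>l<t. R' (40 + 2 * l) = bcoef (base n t) z l)"
    then have 1: "xs1 = xs" "ys1 = ys" "same R R1" "\<And>l. l < t \<Longrightarrow> R1 (40 + 2 * l) = bcoef X z l"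
      by (auto simp: X_def)
    note S1 = same_params[OF 1(3) S]
    show "runs B (fcoef_prog ;; vcoef_prog ;; reduce_prog)
      (R1, xs1, ys1) ((t * (9 * t + 11) + 5) + (11 * t + 12)) (\<lambda>(R', xs', ys'). xs' = xs \<and> ys' = ys \<and>
      same R R' \<and> R' 11 = tval n (base n t) z)"
    proof (rule runs_Seq_le[OF runs_fcoefs[OF S1 1(4) B] _ order_refl])
      fix R2 xs2 ys2
      assume "case (R2, xs2, ys2) of (R', xs', ys') \<Rightarrow> xs' = xs1 \<and> ys' = ys1 \<and> same R1 R' \<and> R' 13 = 41 + 2 * t \<and>
        (\<forall>l<t. R' (40 + 2 * l) = bcoef X z l) \<and> (\<forall>l\<le>t. R' (41 + 2 * l) = fcoef X z l)"
      then have 2: "xs2 = xs" "ys2 = ys" "same R R2" "R2 13 = 41 + 2 * t"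
        "\<And>l. l < t \<Longrightarrow> R2 (40 + 2 * l) = bcoef X z l" "\<And>l. l \<le> t \<Longrightarrow> R2 (41 + 2 * l) = fcoef X z l"
        using 1 same_trans by auto
      note c = paramsD[OF same_params[OF 2(3) S]]
      let ?R = "R2(18 := t, 19 := 0, 20 := 40, 21 := 41 + 2 * m, 14 := 1)"
      have w: "runs B (While 18 vcoef_body) (?R, xs, ys) (11 * t + 1)
        (\<lambda>(R', xs', ys'). xs' = xs \<and> ys' = ys \<and> same ?R R' \<and> R' 19 = vcoef X z)"
        unfolding m by (rule runs_vcoef) (use c B z 2 m in simp_all)
      have tm: "39 + 2 * t = 41 + 2 * m" using m by simp
      have w': "runs B vcoef_prog
        (R2, xs2, ys2) (11 * t + 6) (\<lambda>(R', xs', ys'). xs' = xs \<and> ys' = ys \<and> same ?R R' \<and> R' 19 = vcoef X z)"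
        unfolding vcoef_prog_def by (rule runs_Blk_Seq[where l = "11 * t + 1"]) (use B w tm in \<open>simp_all add: c 2\<close>)
      show "runs B (vcoef_prog ;; reduce_prog) (R2, xs2, ys2)
        (11 * t + 12) (\<lambda>(R', xs', ys'). xs' = xs \<and> ys' = ys \<and> same R R' \<and> R' 11 = tval n (base n t) z)"
      proof (rule runs_Seq_le[OF w', where l = 6])
        fix R3 xs3 ys3
        assume a: "case (R3, xs3, ys3) of (R', xs', ys') \<Rightarrow> xs' = xs \<and> ys' = ys \<and> same ?R R' \<and> R' 19 = vcoef X z"
        have "same R ?R" using 2(3) by simp
        moreover have "same ?R R3" using a by simp
        ultimately have "same R R3" by (rule same_trans)
        then have 3: "xs3 = xs" "ys3 = ys" "same R R3" "R3 19 = vcoef X z" using a by simp_all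
        note c = paramsD[OF same_params[OF 3(3) S]]
        show "runs B reduce_prog
          (R3, xs3, ys3) 6 (\<lambda>(R', xs', ys'). xs' = xs \<and> ys' = ys \<and> same R R' \<and> R' 11 = tval n (base n t) z)"
          unfolding reduce_prog_def using B by (intro runs_Blk) (simp_all add: c 3 tval_def X_def[symmetric] minus_div_mult_eq_mod)
      qed simp
    qed
  qed (use time in simp)
qed

subsection \<open>Initialisation\<close>

abbreviation pow_loop :: "nat \<Rightarrow> nat \<Rightarrow> com" where
  "pow_loop a c \<equiv> While c (Blk [Mul a a 3, Sub c c 6])"

definition binom_body :: com where
  "binom_body = Blk [Mul 2 2 13, Div 2 2 14, Add 13 13 6, Add 14 14 6, Sub 15 15 6]"

definition init_prog :: com where
  "init_prog = (Blk [Read 0, Read 1, Const 6 1, Const 7 2, Const 2 1, Mul 13 0 6, Mul 15 1 6, Const 14 1] ;;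
      While 15 binom_body) ;;
    (Blk [Add 3 2 7, Sub 8 3 6, Const 4 1, Mul 15 0 6] ;; pow_loop 4 15) ;;
    (Blk [Const 5 1, Mul 15 1 6] ;; pow_loop 5 15) ;;
    Blk [Div 9 5 3]"

lemma runs_pow:
  assumes "a \<noteq> c" "a \<noteq> 3" "c \<noteq> 3" "a \<noteq> 6" "c \<noteq> 6" "a < B" "c < B" "50 \<le> B" "R 6 = 1"
  shows "runs B (pow_loop a c) (R, xs, ys) (4 * R c + 1) (\<lambda>s. s = (R(c := 0, a := R a * R 3 ^ R c), xs, ys))"
proof -
  define I where "I = (\<lambda>k s. k \<le> R c \<and> s = (R(c := k, a := R a * R 3 ^ (R c - k)), xs, ys))"
  show ?thesis
  proof (rule runs_for'[where k = 2 and N = "R c" and I = I])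
    show "I (R c) (R, xs, ys)" using assms(1) by (simp add: I_def fun_eq_iff)
    show "\<And>n R' xs' ys'. I n (R', xs', ys') \<Longrightarrow> R' c = n" using assms(1) by (auto simp: I_def)
    show "(R', xs', ys') = (R(c := 0, a := R a * R 3 ^ R c), xs, ys)" if "I 0 (R', xs', ys')" for R' xs' ys'
      using that by (simp add: I_def)
    fix k R' xs' ys' assume "Suc k \<le> R c" and I: "I (Suc k) (R', xs', ys')"
    then have e: "R c - k = Suc (R c - Suc k)" by simp
    show "runs B (Blk [Mul a a 3, Sub c c 6]) (R', xs', ys') 2 (I k)"
      using I assms by (intro runs_Blk) (auto simp: I_def fun_eq_iff e)
  qed (use assms in auto)
qed

text \<open>The product is a multiple of \<open>Suc j\<close>, so the machine may build the number
  of words by exact integer divisions.\<close>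

lemma binom_step:
  assumes "1 \<le> n"
  shows "((n + j - 1) choose j) * (n + j) div Suc j = (n + Suc j - 1) choose Suc j"
proof -
  have "Suc (n + j - 1) * ((n + j - 1) choose j) = (Suc (n + j - 1) choose Suc j) * Suc j"
    by (rule Suc_times_binomial_eq)
  moreover have "Suc (n + j - 1) = n + j" "n + Suc j - 1 = n + j" using assms by auto
  ultimately have "((n + j - 1) choose j) * (n + j) = ((n + j) choose Suc j) * Suc j"
    by (simp only: mult.commute)
  then show ?thesis using \<open>n + Suc j - 1 = n + j\<close>
    by (simp only: nonzero_mult_div_cancel_right[OF nat.simps(3)])
qed

lemma runs_init:
  assumes n: "1 \<le> n" "1 \<le> t" and B: "50 \<le> B"
  shows "runs B init_prog ((\<lambda>_. 0), n # t # xs, ys) (11 * t + 4 * n + 18)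
    (\<lambda>(R, xs', ys'). xs' = xs \<and> ys' = ys \<and> params n t R)"
  unfolding init_prog_def
proof -
  let ?R = "(\<lambda>_. 0)(0 := n, 1 := t, 6 := 1, 7 := 2, 2 := 1, 13 := n, 15 := t, 14 := 1) :: nat \<Rightarrow> nat"
  define I where "I = (\<lambda>k (R, xs', ys'). xs' = xs \<and> ys' = ys \<and> k \<le> t \<and> R 0 = n \<and> R (Suc 0) = t \<and> R 6 = Suc 0 \<and> R 7 = 2 \<and>
    R 2 = (n + (t - k) - 1) choose (t - k) \<and> R 13 = n + (t - k) \<and> R 14 = Suc (t - k) \<and> R 15 = (k::nat))"
  have w: "runs B (While 15 binom_body) (?R, xs, ys) (7 * t + 1) (I 0)"
  proof (rule runs_for'[where k = 5 and N = t and I = I])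
    show "I t (?R, xs, ys)" by (simp add: I_def)
    fix k R' xs' ys' assume k: "Suc k \<le> t" and I: "I (Suc k) (R', xs', ys')"
    define j where "j = t - Suc k"
    have j: "t - k = Suc j" "t - Suc k = j" using k by (auto simp: j_def)
    show "runs B binom_body (R', xs', ys') 5 (I k)" unfolding binom_body_def
      using I B k binom_step[OF n(1), of j] by (intro runs_Blk) (auto simp: I_def j simp del: binomial_Suc_Suc)
  qed (use B in \<open>auto simp: I_def\<close>)
  have w1: "runs B (Blk [Read 0, Read 1, Const 6 1, Const 7 2, Const 2 1, Mul 13 0 6, Mul 15 1 6, Const 14 1] ;;
      While 15 binom_body) ((\<lambda>_. 0), n # t # xs, ys) (7 * t + 9) (I 0)"
    by (rule runs_Blk_Seq[where l = "7 * t + 1"]) (use B w in simp_all)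
  show "runs B ((Blk [Read 0, Read 1, Const 6 1, Const 7 2, Const 2 1, Mul 13 0 6, Mul 15 1 6, Const 14 1] ;;
      While 15 binom_body) ;;
    (Blk [Add 3 2 7, Sub 8 3 6, Const 4 1, Mul 15 0 6] ;; pow_loop 4 15) ;;
    (Blk [Const 5 1, Mul 15 1 6] ;; pow_loop 5 15) ;;
    Blk [Div 9 5 3]) ((\<lambda>_. 0), n # t # xs, ys) (11 * t + 4 * n + 18)
    (\<lambda>(R, xs', ys'). xs' = xs \<and> ys' = ys \<and> params n t R)"
  proof (rule runs_Seq_le[OF w1, where l = "4 * n + 4 * t + 9"])
    fix R xs' ys' assume "I 0 (R, xs', ys')"
    then have i: "xs' = xs" "ys' = ys" "R 0 = n" "R (Suc 0) = t" "R 6 = Suc 0" "R 7 = 2"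
      "R 2 = card (words n t)" by (auto simp: I_def card_words[OF n(1)])
    define N where "N = card (words n t)"
    let ?R1 = "R(3 := N + 2, 8 := N + 1, 4 := 1, 15 := n)"
    let ?R2 = "?R1(15 := 0, 4 := (N + 2) ^ n)"
    let ?R3 = "?R2(5 := 1, 15 := t)"
    let ?R4 = "?R3(15 := 0, 5 := (N + 2) ^ t)"
    have p1: "runs B (pow_loop 4 15) (?R1, xs, ys) (4 * n + 1) (\<lambda>s. s = (?R2, xs, ys))"
      using runs_pow[of 4 15 B ?R1 xs ys] B i by simp
    have p2: "runs B (pow_loop 5 15) (?R3, xs, ys) (4 * t + 1) (\<lambda>s. s = (?R4, xs, ys))"
      using runs_pow[of 5 15 B ?R3 xs ys] B i by simp
    have q1: "runs B (Blk [Add 3 2 7, Sub 8 3 6, Const 4 1, Mul 15 0 6] ;; pow_loop 4 15) (R, xs', ys')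
      (4 * n + 5) (\<lambda>s. s = (?R2, xs, ys))"
      by (rule runs_Blk_Seq[where l = "4 * n + 1"]) (use B p1 in \<open>simp_all add: i N_def\<close>)
    have q2: "runs B (Blk [Const 5 1, Mul 15 1 6] ;; pow_loop 5 15) (?R2, xs, ys)
      (4 * t + 3) (\<lambda>s. s = (?R4, xs, ys))"
      by (rule runs_Blk_Seq[where l = "4 * t + 1"]) (use B p2 in \<open>simp_all add: i\<close>)
    have "X ^ t div X = X ^ (t - 1)" if "0 < X" for X :: nat using n that by (cases t) simp_all
    from this[of "N + 2"] have "(N + 2) ^ t div (N + 2) = (N + 2) ^ (t - 1)" by simp
    then have fin: "runs B (Blk [Div 9 5 3]) (?R4, xs, ys) 1 (\<lambda>(R, xs', ys'). xs' = xs \<and> ys' = ys \<and> params n t R)"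
      using B i by (intro runs_Blk) (simp_all add: params_def base_def N_def)
    show "runs B ((Blk [Add 3 2 7, Sub 8 3 6, Const 4 1, Mul 15 0 6] ;; pow_loop 4 15) ;;
      (Blk [Const 5 1, Mul 15 1 6] ;; pow_loop 5 15) ;; Blk [Div 9 5 3]) (R, xs', ys') (4 * n + 4 * t + 9)
      (\<lambda>(R, xs', ys'). xs' = xs \<and> ys' = ys \<and> params n t R)"
    proof (rule runs_Seq[OF q1, where l = "4 * t + 4"])
      fix s' assume "s' = (?R2, xs, ys)"
      then show "runs B ((Blk [Const 5 1, Mul 15 1 6] ;; pow_loop 5 15) ;; Blk [Div 9 5 3]) s' (4 * t + 4)
        (\<lambda>(R, xs', ys'). xs' = xs \<and> ys' = ys \<and> params n t R)"
        by (simp only:) (rule runs_Seq[OF q2, where l = 1], use fin in auto)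
    qed simp
  qed simp
qed

lemma params_upd [simp]: "10 \<le> i \<Longrightarrow> params n t (R(i := x)) = params n t R"
  by (simp add: params_def)

text \<open>Makes every symbol up to \<open>n\<close> a digit in base \<open>X\<close>. The value
  \<open>n\<close> itself arises from raised symbols in \<open>bump\<close> and in the search, and
  in the threshold for the zero word.\<close>

lemma base_gt:
  assumes "1 \<le> n" "1 \<le> t"
  shows "n < base n t"
proof -
  have "n = (n choose 1)" by simp
  also have "\<dots> \<le> (n + t - 1) choose t"
  proof -
    have "(n choose 1) \<le> (n + k) choose Suc k" for k
    proof (induction k)
      case (Suc k)
      then show ?case by simp
    qed simp
    from this[of "t - 1"] show ?thesis using assms by simp
  qed
  finally show ?thesis using card_words[OF assms(1)] by (simp add: base_def)
qed

lemma num_eq_0_iff: "0 < X \<Longrightarrow> num X w = 0 \<longleftrightarrow> w = replicate (length w) 0"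
  by (induction w) auto

lemma words_less: "w \<in> words n t \<Longrightarrow> x \<in> set w \<Longrightarrow> x < n"
  using member_le_sum_list[of x w] by (simp add: words_def)

subsection \<open>The ranking program\<close>

text \<open>Register 26 holds the previous element. It starts as 0, so the first difference is the
  first element itself.\<close>

definition read_body :: com where
  "read_body = Blk [Read 28, Sub 29 28 26, Mul 26 28 6, Mul 25 25 3, Add 25 25 29, Sub 27 27 6]"

definition read_prog :: com where
  "read_prog = Blk [Const 25 0, Const 26 0, Mul 27 1 6] ;; While 27 read_body"

lemma runs_read:
  assumes S: "params n t R" and M: "M \<in> multisets n t" and B: "50 \<le> B"
  shows "runs B read_prog (R, sorted_list_of_multiset M, ys) (8 * t + 4)
    (\<lambda>(R', xs', ys'). ys' = ys \<and> params n t R' \<and> R' 25 = num (base n t) (difference_rep M))"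
proof -
  define X where "X = base n t"
  define ms where "ms = sorted_list_of_multiset M"
  define w where "w = difference_rep M"
  have st: "size M = t" using M by (simp add: multisets_def)
  have lw: "length w = t" using st by (simp add: w_def length_difference_rep)
  have lm: "length ms = t" unfolding ms_def using st by (metis mset_sorted_list_of_multiset size_mset)
  have wn: "w ! j = ms ! j - (if j = 0 then 0 else ms ! (j - 1))" if "j < t" for j
    using that st by (simp add: w_def difference_rep_def Let_def ms_def)
  define I where "I = (\<lambda>k (R', xs', ys'). ys' = ys \<and> params n t R' \<and> R' 27 = k \<and> xs' = drop (t - k) ms \<and>
    R' 25 = num X (take (t - k) w) \<and> R' 26 = (if t - k = 0 then 0 else ms ! (t - k - 1)))"
  have w: "runs B (While 27 read_body) (R(25 := 0, 26 := 0, 27 := t), ms, ys) (8 * t + 1)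
    (\<lambda>(R', xs', ys'). ys' = ys \<and> params n t R' \<and> R' 25 = num X w)"
  proof (rule runs_for'[where k = 6 and N = t and I = I])
    show "I t (R(25 := 0, 26 := 0, 27 := t), ms, ys)" using S by (simp add: I_def)
    fix k R' xs' ys' assume k: "Suc k \<le> t" and I: "I (Suc k) (R', xs', ys')"
    define j where "j = t - Suc k"
    have j: "t - k = Suc j" "t - Suc k = j" "j < t" using k by (auto simp: j_def)
    have i: "ys' = ys" "params n t R'" "R' 27 = Suc k" "xs' = ms ! j # drop (Suc j) ms"
      "R' 25 = num X (take j w)" "R' 26 = (if j = 0 then 0 else ms ! (j - 1))"
      using I lm j(3) unfolding I_def prod.case j(2) by (auto simp: Cons_nth_drop_Suc)
    note c = paramsD[OF i(2), folded X_def]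
    have "num X (take (Suc j) w) = num X (take j w) * X + w ! j"
      using j lw by (simp add: take_Suc_conv_app_nth num_append)
    then show "runs B read_body (R', xs', ys') 6 (I k)" unfolding read_body_def
      using B wn[OF j(3)] i(2) k by (intro runs_Blk) (simp_all add: I_def j i(1,3-) c)
  qed (use B lw in \<open>auto simp: I_def\<close>)
  show ?thesis unfolding read_prog_def
    by (rule runs_Blk_Seq[where l = "8 * t + 1"])
      (use B w in \<open>simp_all add: paramsD[OF S] X_def ms_def w_def\<close>)
qed

text \<open>The maximum is replaced only on a strict increase, so register 31 ends with the first
  offset of a largest rotation. It starts as \<open>t\<close> with maximum 0: the zero word never
  improves on this and is recognized by the offset \<open>t\<close>.\<close>

definition rot_body :: com where
  "rot_body = Blk [Sub 28 25 30] ;; IfNZ 28 (Blk [Mul 30 25 6, Mul 31 32 6]) (Blk []) ;;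
    Blk [Div 28 25 9, Mul 29 28 9, Sub 25 25 29, Mul 25 25 3, Add 25 25 28, Add 32 32 6, Sub 27 27 6]"

definition rot_prog :: com where
  "rot_prog = Blk [Const 30 0, Mul 31 1 6, Const 32 0, Mul 27 1 6] ;; While 27 rot_body"

lemma num_rotate1:
  assumes "v = d # v'" "\<forall>d\<in>set v. d < X"
  shows "num X v div X ^ (length v - 1) = d"
    "(num X v - d * X ^ (length v - 1)) * X + d = num X (rotate1 v)"
proof -
  have "num X v' < X ^ length v'" using assms num_less[of v' X] by simp
  then show "num X v div X ^ (length v - 1) = d" using assms by simp
  show "(num X v - d * X ^ (length v - 1)) * X + d = num X (rotate1 v)" using assms by (simp add: num_append)
qed

lemma runs_rot:
  assumes S: "params n t R" and R: "R 25 = num (base n t) w" and w: "w \<in> words n t"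
    and n: "1 \<le> n" "1 \<le> t" and B: "50 \<le> B"
  shows "runs B rot_prog (R, xs, ys) (14 * t + 5)
    (\<lambda>(R', xs', ys'). ys' = ys \<and> params n t R' \<and>
      (w = replicate t 0 \<and> R' 30 = 0 \<and> R' 31 = t \<or>
       w \<noteq> replicate t 0 \<and> R' 31 < t \<and> R' 30 = num (base n t) (rotate (R' 31) w) \<and> max_rot (rotate (R' 31) w) \<and>
       (\<forall>q<R' 31. rotate q w \<noteq> rotate (R' 31) w)))"
proof -
  define X where "X = base n t"
  define v where "v q = num X (rotate q w)" for q
  have lw: "length w = t" using w by (simp add: words_def)
  have X0: "0 < X" by (simp add: X_def)
  have dig: "\<forall>d\<in>set (rotate q w). d < X" for q
    using words_less[OF w] base_gt[OF n] by (fastforce simp: X_def)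
  have vlt: "v q < v r \<longleftrightarrow> rotate q w < rotate r w" for q r
    unfolding v_def by (rule num_less_iff) (use dig in auto)
  \<comment> \<open>Either nothing positive was seen among the first \<open>s\<close> rotations, or
    \<open>r\<close> is the first offset at which their maximum \<open>b\<close> occurs.\<close>
  define best where "best = (\<lambda>s b r. (\<forall>q<s. v q \<le> b) \<and>
    (b = 0 \<and> r = t \<or> r < s \<and> b = v r \<and> 0 < b \<and> (\<forall>q<r. v q < b)))"
  define I where "I = (\<lambda>k (R', xs' :: nat list, ys'). ys' = ys \<and> params n t R' \<and> R' 27 = k \<and> k \<le> t \<and> R' 32 = t - k \<and>
    R' 25 = v (t - k) \<and> best (t - k) (R' 30) (R' 31))"
  let ?R = "R(30 := 0, 31 := t, 32 := 0, 27 := t)"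
  have "runs B (While 27 rot_body) (?R, xs, ys) (14 * t + 1) (I 0)"
  proof (rule runs_for'[where k = 12 and N = t and I = I])
    show "I t (?R, xs, ys)" using S R by (simp add: I_def best_def v_def X_def)
    fix k R' xs' ys' assume k: "Suc k \<le> t" and I: "I (Suc k) (R', xs', ys')"
    define s where "s = t - Suc k"
    have s: "t - k = Suc s" "t - Suc k = s" "s < t" using k by (auto simp: s_def)
    have i: "ys' = ys" "params n t R'" "R' 27 = Suc k" "R' 32 = s" "R' 25 = v s" "best s (R' 30) (R' 31)"
      using I by (auto simp: I_def s)
    note c = paramsD[OF i(2), folded X_def]
    have "length (rotate s w) = t" using lw by simp
    then obtain d v' where dv: "rotate s w = d # v'" using n by (cases "rotate s w") auto
    have rot: "v s div X ^ (t - Suc 0) = d" "(v s - d * X ^ (t - Suc 0)) * X + d = v (Suc s)"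
      using num_rotate1[OF dv dig] lw unfolding v_def by simp_all
    have fin: "runs B (Blk [Div 28 25 9, Mul 29 28 9, Sub 25 25 29, Mul 25 25 3, Add 25 25 28, Add 32 32 6, Sub 27 27 6])
      (R1, xs', ys') 7 (I k)"
      if "params n t R1" "R1 27 = Suc k" "R1 32 = s" "R1 25 = v s" "best (Suc s) (R1 30) (R1 31)" for R1
      using that B i(1) k by (intro runs_Blk) (simp_all add: I_def s paramsD[OF that(1), folded X_def] rot)
    have "runs B (IfNZ 28 (Blk [Mul 30 25 6, Mul 31 32 6]) (Blk []) ;;
      Blk [Div 28 25 9, Mul 29 28 9, Sub 25 25 29, Mul 25 25 3, Add 25 25 28, Add 32 32 6, Sub 27 27 6])
      (R'(28 := v s - R' 30), xs', ys') 11 (I k)"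
    proof (rule runs_Seq_le[where k = 4 and l = 7])
      show "runs B (IfNZ 28 (Blk [Mul 30 25 6, Mul 31 32 6]) (Blk [])) (R'(28 := v s - R' 30), xs', ys') 4
        (\<lambda>(R1, xs1, ys1). xs1 = xs' \<and> ys1 = ys' \<and> params n t R1 \<and> R1 27 = Suc k \<and> R1 32 = s \<and> R1 25 = v s \<and>
          best (Suc s) (R1 30) (R1 31))"
      proof (rule runs_IfNZ[where k = 2])
        assume "0 < fst (R'(28 := v s - R' 30), xs', ys') 28"
        then have "R' 30 < v s" by simp
        then have "best (Suc s) (v s) s" using i(6) by (auto simp: best_def less_Suc_eq intro: le_less_trans less_imp_le)
        then show "runs B (Blk [Mul 30 25 6, Mul 31 32 6]) (R'(28 := v s - R' 30), xs', ys') 2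
          (\<lambda>(R1, xs1, ys1). xs1 = xs' \<and> ys1 = ys' \<and> params n t R1 \<and> R1 27 = Suc k \<and> R1 32 = s \<and> R1 25 = v s \<and>
          best (Suc s) (R1 30) (R1 31))"
          using B i by (intro runs_Blk) (simp_all add: c)
      next
        assume "fst (R'(28 := v s - R' 30), xs', ys') 28 = 0"
        then have "v s \<le> R' 30" by simp
        then have "best (Suc s) (R' 30) (R' 31)" using i(6) by (auto simp: best_def less_Suc_eq)
        then show "runs B (Blk []) (R'(28 := v s - R' 30), xs', ys') 2
          (\<lambda>(R1, xs1, ys1). xs1 = xs' \<and> ys1 = ys' \<and> params n t R1 \<and> R1 27 = Suc k \<and> R1 32 = s \<and> R1 25 = v s \<and>
          best (Suc s) (R1 30) (R1 31))"
          using B i by (intro runs_Blk) (simp_all add: c)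
      qed (use B in simp_all)
    qed (use fin in auto)
    then show "runs B rot_body (R', xs', ys') 12 (I k)" unfolding rot_body_def
      using B i by (intro runs_Blk_Seq[where l = 11]) simp_all
  qed (use B in \<open>auto simp: I_def\<close>)
  then have "runs B (While 27 rot_body) (?R, xs, ys) (14 * t + 1) (\<lambda>(R', xs', ys'). ys' = ys \<and> params n t R' \<and>
      (w = replicate t 0 \<and> R' 30 = 0 \<and> R' 31 = t \<or>
       w \<noteq> replicate t 0 \<and> R' 31 < t \<and> R' 30 = num (base n t) (rotate (R' 31) w) \<and> max_rot (rotate (R' 31) w) \<and>
       (\<forall>q<R' 31. rotate q w \<noteq> rotate (R' 31) w)))"
  proof (rule runs_weaken[OF _ order_refl])
    fix s' assume "I 0 s'"
    then obtain R' xs' where s': "s' = (R', xs', ys)" "params n t R'" "best t (R' 30) (R' 31)"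
      by (cases s') (auto simp: I_def)
    have mx: "\<forall>q<t. v q \<le> R' 30" using s'(3) by (simp add: best_def)
    from s'(3) consider "R' 30 = 0" "R' 31 = t"
      | "R' 31 < t" "R' 30 = v (R' 31)" "0 < v (R' 31)" "\<forall>q<R' 31. v q < v (R' 31)"
      by (auto simp: best_def)
    then show "case s' of (R', xs', ys') \<Rightarrow> ys' = ys \<and> params n t R' \<and>
      (w = replicate t 0 \<and> R' 30 = 0 \<and> R' 31 = t \<or>
       w \<noteq> replicate t 0 \<and> R' 31 < t \<and> R' 30 = num (base n t) (rotate (R' 31) w) \<and> max_rot (rotate (R' 31) w) \<and>
       (\<forall>q<R' 31. rotate q w \<noteq> rotate (R' 31) w))"
    proof cases
      case 1
      then have "v 0 = 0" using mx n by auto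
      then have "w = replicate t 0" using num_eq_0_iff[OF X0, of w] lw by (simp add: v_def)
      then show ?thesis using s' 1 by simp
    next
      case 2
      let ?r = "R' 31"
      have "w \<noteq> replicate t 0"
      proof
        assume "w = replicate t 0"
        then have "rotate ?r w = replicate t 0" by (metis lw max_rot_def max_rot_replicate
              rotate_map map_replicate_const length_rotate)
        then show False using 2(3) by (simp add: v_def)
      qed
      moreover have "max_rot (rotate ?r w)"
        unfolding max_rot_def
      proof
        fix q
        have e: "rotate q (rotate ?r w) = rotate ((q + ?r) mod t) w"
          using lw by (metis rotate_rotate rotate_conv_mod)
        have "v ((q + ?r) mod t) \<le> v ?r" using mx 2(2) n by simp
        then show "rotate q (rotate ?r w) \<le> rotate ?r w" unfolding e using vlt by (metis not_less)
      qed
      moreover have "\<forall>q<?r. rotate q w \<noteq> rotate ?r w" using 2(4) vlt by (metis less_irrefl)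
      ultimately show ?thesis using s' 2 by (simp add: v_def X_def)
    qed
  qed
  then show ?thesis unfolding rot_prog_def
    by (intro runs_Blk_Seq[where l = "14 * t + 1"]) (use B in \<open>simp_all add: paramsD[OF S]\<close>)
qed

section \<open>Threshold words as numbers\<close>

lemma num_bump:
  assumes "\<forall>d\<in>set b. d < X" "1 \<le> p" "p \<le> length b" "0 < X"
  shows "num X (bump b p) = (num X b div X ^ (length b - p) + 1) * X ^ (length b - p)"
proof -
  have p: "take p b = take (p - 1) b @ [b ! (p - 1)]"
    using assms(2,3) by (cases p) (auto simp: take_Suc_conv_app_nth)
  have "num X b div X ^ (length b - p) = num X (take (p - 1) b) * X + b ! (p - 1)"
    unfolding num_div_mod(1)[OF assms(1,3,4)] p by (simp add: num_append)
  moreover have "bump b p = (take (p - 1) b @ [Suc (b ! (p - 1))]) @ replicate (length b - p) 0"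
    by (simp add: bump_def)
  then have "num X (bump b p) = (num X (take (p - 1) b) * X + Suc (b ! (p - 1))) * X ^ (length b - p)"
    by (simp only: num_append) simp
  ultimately show ?thesis by simp
qed

lemma bump_le:
  assumes "\<forall>d\<in>set b. d < n" "1 \<le> p" "p \<le> length b"
  shows "\<forall>d\<in>set (bump b p). d \<le> n"
proof -
  have "b ! (p - 1) \<in> set b" using assms(2,3) by simp
  then show ?thesis using assms(1) by (auto simp: bump_def Suc_le_eq dest: in_set_takeD less_imp_le)
qed

text \<open>Positions are tried in increasing order and register 34 is overwritten at each success,
  so the largest admissible one remains. Register 35 is the weight of the raised symbol.\<close>

definition bump_body :: com where
  "bump_body = Blk [Div 10 30 35, Add 10 10 6, Mul 10 10 35] ;; pren_check ;;
    IfNZ 12 (Blk []) (Blk [Mul 34 10 6]) ;; Blk [Div 35 35 3, Sub 27 27 6]"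

text \<open>Register 28 receives the remainder modulo \<open>X ^ r\<close>. This is the number of
  the last \<open>r\<close> symbols, and it is zero iff they all are.\<close>

definition threshold_prog :: com where
  "threshold_prog = (Blk [Const 33 1, Mul 27 31 6] ;; pow_loop 33 27) ;;
    Blk [Div 28 30 33, Mul 28 28 33, Sub 28 30 28] ;;
    IfNZ 28 (Blk [Mul 10 30 6])
      (Blk [Mul 34 0 9, Mul 35 9 6, Sub 27 1 31] ;; While 27 bump_body ;; Blk [Mul 10 34 6])"

text \<open>The case \<open>r = t\<close> belongs to the zero word. Its threshold exceeds every
  rotation of every word, so \<open>below\<close> is the number of all words and the general formula
  gives the position of \<open>window_zeros\<close>. The loop over positions is empty then and keeps
  its initial value, which is this threshold.\<close>

definition is_threshold :: "nat \<Rightarrow> nat \<Rightarrow> nat list \<Rightarrow> nat \<Rightarrow> nat list \<Rightarrow> bool" where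
  "is_threshold n t b r z \<longleftrightarrow> (if drop (t - r) b = replicate r 0
    then if r = t then z = n # replicate (t - 1) 0
      else \<exists>p\<in>{1..t - r}. z = bump b p \<and> pren z \<and> (\<forall>q\<in>{p<..t - r}. \<not> pren (bump b q))
    else z = b)"

lemma runs_bump_loop:
  assumes S: "params n t R" and R: "R 30 = num (base n t) b" "R 31 = r" "R 27 = t - r" "R 34 = n * base n t ^ (t - 1)"
      "R 35 = base n t ^ (t - 1)"
    and b: "length b = t" "\<forall>d\<in>set b. d < n" and r: "r \<le> t" and n: "1 \<le> n" "1 \<le> t" and B: "50 \<le> B"
    and z: "drop (t - r) b = replicate r 0"
  shows "runs B (While 27 bump_body) (R, xs, ys) (t * (11 * t + 16) + 1)
    (\<lambda>(R', xs', ys'). ys' = ys \<and> params n t R' \<and> R' 31 = r \<and> (\<exists>z. is_threshold n t b r z \<and> R' 34 = num (base n t) z))"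
proof -
  define X where "X = base n t"
  have X0: "0 < X" by (simp add: X_def)
  have nX: "n < X" using base_gt[OF n] by (simp add: X_def)
  have bX: "\<forall>d\<in>set b. d < X" using b nX by auto
  define h where "h = t - r"
  define best where "best = (\<lambda>s v. s = 0 \<and> v = n * X ^ (t - 1) \<or>
    (\<exists>p\<in>{1..s}. v = num X (bump b p) \<and> pren (bump b p) \<and> (\<forall>q\<in>{p<..s}. \<not> pren (bump b q))))"
  define I where "I = (\<lambda>k (R', xs' :: nat list, ys'). ys' = ys \<and> params n t R' \<and> R' 30 = num X b \<and> R' 31 = r \<and>
    R' 27 = k \<and> k \<le> h \<and> (0 < k \<longrightarrow> R' 35 = X ^ (t - Suc (h - k))) \<and> best (h - k) (R' 34))"
  show ?thesis
  proof (rule runs_for'[where k = "11 * t + 14" and N = h and I = I])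
    show "I h (R, xs, ys)" using S R by (simp add: I_def best_def X_def h_def)
    fix k R' xs' ys' assume k: "Suc k \<le> h" and I: "I (Suc k) (R', xs', ys')"
    define s where "s = h - Suc k"
    have s: "h - k = Suc s" "h - Suc k = s" "Suc s \<le> h" "Suc s \<le> t" using k by (auto simp: s_def h_def)
    have i: "ys' = ys" "params n t R'" "R' 30 = num X b" "R' 31 = r" "R' 27 = Suc k"
      "R' 35 = X ^ (t - Suc s)" "best s (R' 34)"
      using I unfolding I_def prod.case s(2) by auto
    note c = paramsD[OF i(2), folded X_def]
    let ?c = "bump b (Suc s)"
    have lc: "length ?c = t" using s b by (simp add: length_bump)
    have cn: "\<forall>d\<in>set ?c. d \<le> n" using bump_le[OF b(2), of "Suc s"] s(4) b(1) by simp
    then have cX: "\<forall>d\<in>set ?c. d < X" using nX by auto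
    have nc: "num X ?c = (num X b div X ^ (t - Suc s) + 1) * X ^ (t - Suc s)"
      using num_bump[OF bX _ _ X0, of "Suc s"] s b by simp
    let ?R1 = "R'(10 := num X ?c)"
    have fin: "runs B (Blk [Div 35 35 3, Sub 27 27 6]) (R2, xs', ys') 2 (I k)"
      if "params n t R2" "R2 30 = num X b" "R2 31 = r" "R2 27 = Suc k" "R2 35 = X ^ (t - Suc s)" "best (Suc s) (R2 34)" for R2
    proof (rule runs_Blk)
      have "0 < k \<longrightarrow> X ^ (t - Suc s) div X = X ^ (t - Suc (Suc s))"
      proof
        assume "0 < k"
        then have "t - Suc s = Suc (t - Suc (Suc s))" using k unfolding s_def h_def by simp
        then show "X ^ (t - Suc s) div X = X ^ (t - Suc (Suc s))" using X0 by simp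
      qed
      then show "block_post B [Div 35 35 3, Sub 27 27 6] (I k) (R2, xs', ys')"
        using that B i(1) k by (simp add: I_def s paramsD[OF that(1), folded X_def])
    qed simp
    have g2: "runs B (IfNZ 12 (Blk []) (Blk [Mul 34 10 6]) ;; Blk [Div 35 35 3, Sub 27 27 6]) (R2, xs', ys') 6 (I k)"
      if a: "same ?R1 R2" "R2 12 = 0 \<longleftrightarrow> pren ?c" for R2
    proof (rule runs_Seq_le[where k = 4 and l = 2])
      have p2: "params n t R2" using same_params[OF a(1)] i(2) by simp
      have e: "R2 30 = num X b" "R2 31 = r" "R2 27 = Suc k" "R2 35 = X ^ (t - Suc s)" "R2 34 = R' 34" "R2 10 = num X ?c"
        using sameD[OF a(1)] i by simp_all
      show "runs B (IfNZ 12 (Blk []) (Blk [Mul 34 10 6])) (R2, xs', ys') 4 (\<lambda>(R3, xs3, ys3). xs3 = xs' \<and> ys3 = ys' \<and>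
        params n t R3 \<and> R3 30 = num X b \<and> R3 31 = r \<and> R3 27 = Suc k \<and> R3 35 = X ^ (t - Suc s) \<and> best (Suc s) (R3 34))"
      proof (rule runs_IfNZ[where k = 2])
        assume "0 < fst (R2, xs', ys') 12"
        then have np: "\<not> pren ?c" using a by simp
        have "s \<noteq> 0"
        proof
          assume "s = 0"
          then show False using np pren_bump_1[of b] b n by simp
        qed
        then obtain p where p: "1 \<le> p" "p \<le> s" "R' 34 = num X (bump b p)" "pren (bump b p)" "\<forall>q\<in>{p<..s}. \<not> pren (bump b q)"
          using i(7) by (auto simp: best_def)
        then have "\<forall>q\<in>{p<..Suc s}. \<not> pren (bump b q)" using np by (auto simp: le_Suc_eq)
        then have "best (Suc s) (R' 34)" unfolding best_def using p by (intro disjI2 bexI[of _ p]) auto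
        then show "runs B (Blk []) (R2, xs', ys') 2 (\<lambda>(R3, xs3, ys3). xs3 = xs' \<and> ys3 = ys' \<and>
          params n t R3 \<and> R3 30 = num X b \<and> R3 31 = r \<and> R3 27 = Suc k \<and> R3 35 = X ^ (t - Suc s) \<and> best (Suc s) (R3 34))"
          using B e p2 by (intro runs_Blk) simp_all
      next
        assume "fst (R2, xs', ys') 12 = 0"
        then have "pren ?c" using a by simp
        then have "best (Suc s) (num X ?c)" unfolding best_def by (intro disjI2 bexI[of _ "Suc s"]) auto
        then show "runs B (Blk [Mul 34 10 6]) (R2, xs', ys') 2 (\<lambda>(R3, xs3, ys3). xs3 = xs' \<and> ys3 = ys' \<and>
          params n t R3 \<and> R3 30 = num X b \<and> R3 31 = r \<and> R3 27 = Suc k \<and> R3 35 = X ^ (t - Suc s) \<and> best (Suc s) (R3 34))"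
          using B e p2 by (intro runs_Blk) (simp_all add: paramsD[OF p2])
      qed (use B in simp_all)
    qed (use fin in auto)
    have "params n t ?R1" using i(2) by simp
    have g1: "runs B (pren_check ;; IfNZ 12 (Blk []) (Blk [Mul 34 10 6]) ;; Blk [Div 35 35 3, Sub 27 27 6])
      (?R1, xs', ys') (11 * t + 11) (I k)"
      by (rule runs_Seq_le[OF runs_pren_check[OF \<open>params n t ?R1\<close>, of ?c], where l = 6])
        (use lc cX B g2 in \<open>auto simp: X_def\<close>)
    show "runs B bump_body (R', xs', ys') (11 * t + 14) (I k)" unfolding bump_body_def
      by (rule runs_Blk_Seq[where l = "11 * t + 11"]) (use B g1 in \<open>simp_all add: i(3-6) c nc\<close>)
  next
    fix R' xs' ys' assume I: "I 0 (R', xs', ys')"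
    have "\<exists>z. is_threshold n t b r z \<and> R' 34 = num X z"
    proof (cases "h = 0")
      case True
      then have "r = t" "R' 34 = n * X ^ (t - 1)" using I r by (auto simp: I_def best_def h_def)
      then show ?thesis using z by (intro exI[of _ "n # replicate (t - 1) 0"]) (simp add: is_threshold_def)
    next
      case False
      then obtain p where p: "p\<in>{1..h}" "R' 34 = num X (bump b p)" "pren (bump b p)" "\<forall>q\<in>{p<..h}. \<not> pren (bump b q)"
        using I by (auto simp: I_def best_def)
      moreover have "r \<noteq> t" using False by (auto simp: h_def)
      ultimately show ?thesis using z
        by (intro exI[of _ "bump b p"]) (auto simp: is_threshold_def h_def[symmetric])
    qed
    then show "case (R', xs', ys') of (R', xs', ys') \<Rightarrow> ys' = ys \<and> params n t R' \<and> R' 31 = r \<and>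
      (\<exists>z. is_threshold n t b r z \<and> R' 34 = num (base n t) z)" using I by (simp add: I_def X_def)
  next
    have "h * (11 * t + 16) \<le> t * (11 * t + 16)" by (rule mult_right_mono) (simp_all add: h_def)
    then show "h * (11 * t + 14 + 2) + 1 \<le> t * (11 * t + 16) + 1" by (simp only: add.assoc) simp
  qed (use B in \<open>auto simp: I_def\<close>)
qed

lemma runs_threshold:
  assumes S: "params n t R" and R: "R 30 = num (base n t) b" "R 31 = r"
    and b: "length b = t" "\<forall>d\<in>set b. d < n" and r: "r \<le> t" and n: "1 \<le> n" "1 \<le> t" and B: "50 \<le> B"
  shows "runs B threshold_prog (R, xs, ys) (11 * (t * t) + 20 * t + 14)
    (\<lambda>(R', xs', ys'). ys' = ys \<and> params n t R' \<and> R' 31 = r \<and> (\<exists>z. is_threshold n t b r z \<and> R' 10 = num (base n t) z))"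
proof -
  define X where "X = base n t"
  have X0: "0 < X" by (simp add: X_def)
  have bX: "\<forall>d\<in>set b. d < X" using b base_gt[OF n] by (auto simp: X_def)
  note c = paramsD[OF S, folded X_def]
  let ?Q = "\<lambda>(R', xs' :: nat list, ys'). ys' = ys \<and> params n t R' \<and> R' 31 = r \<and> (\<exists>z. is_threshold n t b r z \<and> R' 10 = num X z)"
  let ?R1 = "R(33 := 1, 27 := r)" and ?R2 = "R(33 := 1, 27 := r, 27 := 0, 33 := X ^ r)"
  have "runs B (pow_loop 33 27) (?R1, xs, ys) (4 * t + 1) (\<lambda>s. s = (?R2, xs, ys))"
    by (rule runs_weaken[OF runs_pow[of 33 27 B ?R1 xs ys]]) (use B c r in simp_all)
  then have p: "runs B (Blk [Const 33 1, Mul 27 31 6] ;; pow_loop 33 27) (R, xs, ys) (4 * t + 3) (\<lambda>s. s = (?R2, xs, ys))"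
    by (intro runs_Blk_Seq[where l = "4 * t + 1"]) (use B R in \<open>simp_all add: c\<close>)
  have md: "num X b - num X b div X ^ r * X ^ r = num X (drop (t - r) b)"
    using num_div_mod(2)[OF bX _ X0, of "t - r"] b r by (simp add: minus_div_mult_eq_mod)
  let ?R3 = "?R2(28 := num X (drop (t - r) b))"
  have z0: "num X (drop (t - r) b) = 0 \<longleftrightarrow> drop (t - r) b = replicate r 0"
    using num_eq_0_iff[OF X0, of "drop (t - r) b"] b r by simp
  have g: "runs B (IfNZ 28 (Blk [Mul 10 30 6]) (Blk [Mul 34 0 9, Mul 35 9 6, Sub 27 1 31] ;; While 27 bump_body ;; Blk [Mul 10 34 6]))
    (?R3, xs, ys) (11 * (t * t) + 16 * t + 8) ?Q"
  proof (rule runs_IfNZ[where k = "11 * (t * t) + 16 * t + 6"])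
    assume "0 < fst (?R3, xs, ys) 28"
    then have "is_threshold n t b r b" using z0 by (auto simp: is_threshold_def)
    then show "runs B (Blk [Mul 10 30 6]) (?R3, xs, ys) (11 * (t * t) + 16 * t + 6) ?Q"
      using B S R by (intro runs_Blk) (auto simp: c X_def)
  next
    assume "fst (?R3, xs, ys) 28 = 0"
    then have z: "drop (t - r) b = replicate r 0" using z0 by simp
    let ?R4 = "?R3(34 := n * X ^ (t - 1), 35 := X ^ (t - 1), 27 := t - r)"
    have "runs B (While 27 bump_body) (?R4, xs, ys) (t * (11 * t + 16) + 1)
      (\<lambda>(R', xs', ys'). ys' = ys \<and> params n t R' \<and> R' 31 = r \<and> (\<exists>z. is_threshold n t b r z \<and> R' 34 = num X z))"
      unfolding X_def by (rule runs_bump_loop) (use S R b r n B z in \<open>simp_all add: X_def\<close>)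
    then have "runs B (While 27 bump_body ;; Blk [Mul 10 34 6]) (?R4, xs, ys) (11 * (t * t) + 16 * t + 2) ?Q"
    proof (rule runs_Seq_le[where l = 1])
      fix R' :: "nat \<Rightarrow> nat" and xs' ys' :: "nat list"
    assume "case (R', xs', ys') of (R', xs', ys') \<Rightarrow> ys' = ys \<and> params n t R' \<and> R' 31 = r \<and>
        (\<exists>z. is_threshold n t b r z \<and> R' 34 = num X z)"
      then have a: "ys' = ys" "params n t R'" "R' 31 = r" "\<exists>z. is_threshold n t b r z \<and> R' 34 = num X z" by auto
      show "runs B (Blk [Mul 10 34 6]) (R', xs', ys') 1 ?Q"
        using B a by (intro runs_Blk) (simp_all add: paramsD[OF a(2)])
    qed (simp add: algebra_simps)
    then show "runs B (Blk [Mul 34 0 9, Mul 35 9 6, Sub 27 1 31] ;; While 27 bump_body ;; Blk [Mul 10 34 6])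
      (?R3, xs, ys) (11 * (t * t) + 16 * t + 6) ?Q"
      by (intro runs_Blk_Seq[where l = "11 * (t * t) + 16 * t + 2"]) (use B R in \<open>simp_all add: c\<close>)
  qed (use B in simp_all)
  have g2: "runs B (Blk [Div 28 30 33, Mul 28 28 33, Sub 28 30 28] ;;
    IfNZ 28 (Blk [Mul 10 30 6]) (Blk [Mul 34 0 9, Mul 35 9 6, Sub 27 1 31] ;; While 27 bump_body ;; Blk [Mul 10 34 6]))
    (?R2, xs, ys) (11 * (t * t) + 16 * t + 11) ?Q"
    by (rule runs_Blk_Seq[where l = "11 * (t * t) + 16 * t + 8"]) (use B R g in \<open>simp_all add: c md X_def[symmetric]\<close>)
  have "runs B threshold_prog (R, xs, ys) (11 * (t * t) + 20 * t + 14) ?Q"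
    unfolding threshold_prog_def
    by (rule runs_Seq[OF p, where l = "11 * (t * t) + 16 * t + 11"]) (use g2 in \<open>auto simp: algebra_simps\<close>)
  then show ?thesis by (simp add: X_def)
qed

text \<open>Adding the number of words before subtracting \<open>r\<close> prevents truncation; the
  remainder then wraps the position around. The final 1 passes to 1-based indices.\<close>

definition rank_out :: com where
  "rank_out = Blk [Sub 28 2 11, Add 28 28 2, Sub 28 28 31, Div 29 28 2, Mul 29 29 2, Sub 28 28 29, Add 28 28 6, Write 28]"

definition rank_prog :: com where
  "rank_prog = init_prog ;; read_prog ;; rot_prog ;; threshold_prog ;; eval_prog ;; rank_out"

lemma below_top:
  assumes "1 \<le> n" "1 \<le> t"
  shows "below n (n # replicate (t - 1) 0) = card (words n t)"
proof -
  have "rotate r w < n # replicate (t - 1) 0" if "w \<in> words n t" for w r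
  proof -
    have "rotate r w \<in> words n t" using that by simp
    then have l: "length (rotate r w) = t" "\<And>x. x \<in> set (rotate r w) \<Longrightarrow> x < n"
      using words_less by (auto simp only: length_in_words)
    then obtain d v where "rotate r w = d # v" using assms(2) by (cases "rotate r w") auto
    then show ?thesis using l(2)[of d] by simp
  qed
  then have "{w \<in> words n t. \<forall>r. rotate r w < n # replicate (t - 1) 0} = words n t" by auto
  then show ?thesis unfolding below_def using assms by simp
qed

text \<open>\<open>rank_correct\<close>, or \<open>window_zeros\<close> for the zero word, finds
  \<open>w\<close> at the computed position. As positions are unique, this is the given
  index.\<close>

lemma rank_value:
  assumes M: "M \<in> multisets n t" and n: "1 \<le> n" "1 \<le> t" and o: "occurs_at (G_down n t (n + t - 1)) M i"
    and w: "w = difference_rep M" and b: "length b = t" "r \<le> t"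
    and br: "w = replicate t 0 \<and> b = replicate t 0 \<and> r = t \<or>
      w \<noteq> replicate t 0 \<and> r < t \<and> b = rotate r w \<and> max_rot b \<and> (\<forall>q<r. rotate q w \<noteq> b)"
    and z: "is_threshold n t b r z"
  defines "N \<equiv> card (words n t)"
  shows "pren z" "i = Suc ((N + (N - below n z) - r) mod N)"
proof -
  have ww: "w \<in> words n t" using difference_rep_words[OF M n(1)] w by simp
  have N: "0 < N" unfolding N_def using ww finite_words by (auto simp: card_gt_0_iff)
  have *: "pren z \<and> cyclic_substring (root_concat (neck_list n t)) t (Suc ((N + (N - below n z) - r) mod N)) = w"
  proof (cases "w = replicate t 0")
    case True
    then have "b = replicate t 0" "r = t" using br by auto
    then have "z = n # replicate (t - 1) 0" using z by (simp add: is_threshold_def)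
    then have "below n z = N" "pren z" using below_top[OF n] max_rot_pren[OF max_rot_single] by (simp_all add: N_def)
    then show ?thesis using window_zeros[OF n] True \<open>r = t\<close> by (simp add: N_def)
  next
    case False
    then have r: "r < t" "b = rotate r w" "max_rot b" "\<And>q. q < r \<Longrightarrow> rotate q w \<noteq> b" using br by auto
    then have z': "if drop (t - r) b = replicate r 0
      then \<exists>p\<in>{1..t - r}. z = bump b p \<and> pren z \<and> (\<forall>q\<in>{p<..t - r}. \<not> pren (bump b q))
      else z = b" using z unfolding is_threshold_def by (metis less_irrefl)
    then have "pren z" using max_rot_pren[OF r(3)] by (auto split: if_splits)
    then show ?thesis using rank_correct[OF ww n r False z'] by (simp add: N_def)
  qed
  then show "pren z" by simp
  obtain p where p: "p < N" "i = Suc p" "cyclic_substring (root_concat (neck_list n t)) t (Suc p) = w"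
    using o w unfolding occurs_at_iff[OF n M] N_def by auto
  have "(N + (N - below n z) - r) mod N < N" using N by simp
  then have "p = (N + (N - below n z) - r) mod N"
    using position_unique[OF n, of p "(N + (N - below n z) - r) mod N"] p * by (simp add: N_def)
  then show "i = Suc ((N + (N - below n z) - r) mod N)" using p by simp
qed

lemma threshold_digits:
  assumes "is_threshold n t b r z" "length b = t" "\<forall>d\<in>set b. d < n" "1 \<le> t" "r \<le> t"
  shows "length z = t" "\<forall>d\<in>set z. d \<le> n"
proof -
  consider "z = b" | "z = n # replicate (t - 1) 0" | p where "z = bump b p" "1 \<le> p" "p \<le> length b"
    using assms by (auto simp: is_threshold_def split: if_splits)
  then have "length z = t \<and> (\<forall>d\<in>set z. d \<le> n)"
  proof cases
    case 3
    then show ?thesis using bump_le[OF assms(3), of p] length_bump[of p b] assms(2) by auto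
  qed (use assms in auto)
  then show "length z = t" "\<forall>d\<in>set z. d \<le> n" by auto
qed

lemma runs_rank:
  assumes n: "1 \<le> n" "1 \<le> t" and M: "M \<in> multisets n t" and o: "occurs_at (G_down n t (n + t - 1)) M i"
    and B: "2 * t + 50 \<le> B"
  shows "runs B rank_prog ((\<lambda>_. 0), n # t # sorted_list_of_multiset M, []) (250 * (n * t + t * t))
    (\<lambda>(R, xs, ys). ys = [i])"
proof -
  define w where "w = difference_rep M"
  have ww: "w \<in> words n t" using difference_rep_words[OF M n(1)] w_def by simp
  have B': "50 \<le> B" using B by simp
  define N where "N = card (words n t)"
  define T where "T = 65 * (n * t + t * t) + 8"
  define T1 where "T1 = 11 * (t * t) + 20 * t + 14 + T"
  define T2 where "T2 = 14 * t + 5 + T1"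
  define T3 where "T3 = 8 * t + 4 + T2"
  have time: "11 * t + 4 * n + 18 + T3 \<le> 250 * (n * t + t * t)"
  proof -
    have le: "1 \<le> t * t" "t \<le> t * t" "n \<le> n * t" using n by (auto simp: Suc_le_eq)
    have "65 * (n * t + t * t) = 65 * (n * t) + 65 * (t * t)" "250 * (n * t + t * t) = 250 * (n * t) + 250 * (t * t)" by simp_all
    then show ?thesis unfolding T3_def T2_def T1_def T_def using le by linarith
  qed
  let ?Q = "\<lambda>(R :: nat \<Rightarrow> nat, xs :: nat list, ys). ys = [i]"
  show ?thesis unfolding rank_prog_def
  proof (rule runs_Seq_le[OF runs_init[OF n B'], where l = T3])
    fix R :: "nat \<Rightarrow> nat" and xs' ys' :: "nat list"
    assume "case (R, xs', ys') of (R, xs', ys') \<Rightarrow> xs' = sorted_list_of_multiset M \<and> ys' = [] \<and> params n t R"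
    then have 1: "xs' = sorted_list_of_multiset M" "ys' = []" "params n t R" by auto
    show "runs B (read_prog ;; rot_prog ;; threshold_prog ;; eval_prog ;; rank_out)
      (R, xs', ys') T3 ?Q" unfolding 1(1,2)
    proof (rule runs_Seq_le[OF runs_read[OF 1(3) M B'], where l = T2])
      fix R :: "nat \<Rightarrow> nat" and xs' ys' :: "nat list"
    assume "case (R, xs', ys') of (R', xs', ys') \<Rightarrow> ys' = [] \<and> params n t R' \<and>
        R' 25 = num (base n t) (difference_rep M)"
      then have 2: "ys' = []" "params n t R" "R 25 = num (base n t) w" by (auto simp: w_def)
      show "runs B (rot_prog ;; threshold_prog ;; eval_prog ;; rank_out)
        (R, xs', ys') T2 ?Q" unfolding 2(1)
      proof (rule runs_Seq_le[OF runs_rot[OF 2(2,3) ww n B'], where l = T1])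
        fix R :: "nat \<Rightarrow> nat" and xs' ys' :: "nat list"
    assume a: "case (R, xs', ys') of (R', xs', ys') \<Rightarrow> ys' = [] \<and> params n t R' \<and>
          (w = replicate t 0 \<and> R' 30 = 0 \<and> R' 31 = t \<or>
          w \<noteq> replicate t 0 \<and> R' 31 < t \<and> R' 30 = num (base n t) (rotate (R' 31) w) \<and> max_rot (rotate (R' 31) w) \<and>
          (\<forall>q<R' 31. rotate q w \<noteq> rotate (R' 31) w))"
        define r where "r = R 31"
        define b where "b = (if w = replicate t 0 then w else rotate r w)"
        have 3: "ys' = []" "params n t R" "R 30 = num (base n t) b" "R 31 = r" "length b = t" "r \<le> t"
          "w = replicate t 0 \<and> b = replicate t 0 \<and> r = t \<or>
          w \<noteq> replicate t 0 \<and> r < t \<and> b = rotate r w \<and> max_rot b \<and> (\<forall>q<r. rotate q w \<noteq> b)"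
          using a ww by (auto simp: r_def b_def words_def)
        have bn: "\<forall>d\<in>set b. d < n" using words_less[OF ww] by (auto simp: b_def)
        show "runs B (threshold_prog ;; eval_prog ;; rank_out)
          (R, xs', ys') T1 ?Q" unfolding 3(1)
        proof (rule runs_Seq_le[OF runs_threshold[OF 3(2-5) bn 3(6) n B'], where l = T])
          fix R :: "nat \<Rightarrow> nat" and xs' ys' :: "nat list"
    assume "case (R, xs', ys') of (R', xs', ys') \<Rightarrow> ys' = [] \<and> params n t R' \<and> R' 31 = r \<and>
            (\<exists>z. is_threshold n t b r z \<and> R' 10 = num (base n t) z)"
          then obtain z where 4: "ys' = []" "params n t R" "R 31 = r" "is_threshold n t b r z" "R 10 = num (base n t) z"
            by auto
          note zd = threshold_digits[OF 4(4) 3(5) bn n(2) 3(6)]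
          note rv = rank_value[OF M n o w_def 3(5,6,7) 4(4)]
          have tv: "tval n (base n t) z = below n z"
            using tval_eq_below[OF rv(1) zd(1) n(2,1)] by (simp add: base_def)
          show "runs B (eval_prog ;; rank_out)
            (R, xs', ys') T ?Q" unfolding 4(1)
          proof (rule runs_Seq_le[OF runs_eval[OF 4(2,5) zd base_gt[OF n] B n(2,1)], where l = 8])
            fix R' :: "nat \<Rightarrow> nat" and xs'' ys' :: "nat list"
    assume "case (R', xs'', ys') of (R', xs'', ys') \<Rightarrow> xs'' = xs' \<and> ys' = [] \<and> same R R' \<and>
              R' 11 = tval n (base n t) z"
            then have 5: "ys' = []" "same R R'" "R' 11 = below n z" by (auto simp: tv)
            note c = paramsD[OF same_params[OF 5(2) 4(2)], folded N_def]
            have r: "R' 31 = r" using sameD[OF 5(2)] 4(3) by simp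
            have i: "i = Suc ((N - below n z + N - r) mod N)" using rv(2) by (simp add: N_def add.commute)
            show "runs B (rank_out)
              (R', xs'', ys') 8 ?Q"
              unfolding rank_out_def using B by (intro runs_Blk) (simp_all add: c 5 r i minus_div_mult_eq_mod)
          qed (simp add: T_def)
        qed (simp add: T1_def)
      qed (simp add: T2_def)
    qed (simp add: T3_def)
  qed (use time in simp)
qed

subsection \<open>Greedy search for a necklace\<close>

definition cur :: "nat list \<Rightarrow> nat \<Rightarrow> nat \<Rightarrow> nat list" where
  "cur b j e = take j b @ e # replicate (length b - Suc j) 0"

lemma cur_0:
  assumes "j < length b"
  shows "cur b j 0 = take j b @ replicate (length b - j) 0"
proof -
  have "length b - j = Suc (length b - Suc j)" using assms by simp
  then show ?thesis by (simp add: cur_def)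
qed

lemma cur_nth: "j < length b \<Longrightarrow> cur b j (b ! j) = take (Suc j) b @ replicate (length b - Suc j) 0"
  by (simp add: cur_def take_Suc_conv_app_nth)

lemma num_cur_Suc: "num X (cur b j (Suc e)) = num X (cur b j e) + X ^ (length b - Suc j)"
  by (simp add: cur_def num_append)

text \<open>A candidate not above \<open>b\<close> is a prenecklace, by \<open>pren_lower\<close>,
  and its count is at most \<open>below n b\<close>. A prenecklace above \<open>b\<close> counts at
  least \<open>below n b + period b\<close>. The test for a prenecklace is part of acceptance
  because \<open>tval\<close> is known to be a count for prenecklaces only.\<close>

lemma cur_accepted_iff:
  assumes b: "b \<in> necks n t" "below n b \<le> r" "r < below n b + period b" and j: "j < t" and n: "1 \<le> n" "1 \<le> t"
    and m: "m \<le> b ! j"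
  shows "tval n (base n t) (cur b j (Suc m)) \<le> r \<and> pren (cur b j (Suc m)) \<longleftrightarrow> m < b ! j"
proof -
  let ?c = "cur b j (Suc m)"
  have l: "length b = t" using b by (simp add: necks_length)
  have lc: "length ?c = t" using l j by (simp add: cur_def)
  have bs: "b = take j b @ b ! j # drop (Suc j) b" using l j by (simp add: id_take_nth_drop)
  have tv: "tval n (base n t) ?c = below n ?c" if "pren ?c"
    using tval_eq_below[OF that lc n(2,1)] by (simp add: base_def)
  show ?thesis
  proof (cases "m < b ! j")
    case True
    have "pren (take (Suc j) b)" using necks_max_rot[OF b(1)] by (intro pren_take max_rot_pren)
    then have "pren (take j b @ [b ! j])" using l j by (simp add: take_Suc_conv_app_nth)
    then have "pren (take j b @ [Suc m])" by (rule pren_lower) (use True in simp)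
    then have pc: "pren ?c" using pren_append_zeros[of "take j b @ [Suc m]"] by (simp add: cur_def)
    have "replicate (t - Suc j) 0 \<le> drop (Suc j) b" using l by (intro replicate_zero_le) simp
    then have "Suc m # replicate (t - Suc j) 0 \<le> b ! j # drop (Suc j) b" using True by auto
    then have "take j b @ Suc m # replicate (t - Suc j) 0 \<le> take j b @ b ! j # drop (Suc j) b"
      by (simp add: append_le_append_iff)
    then have "?c \<le> b" using bs l by (simp add: cur_def)
    then have "below n ?c \<le> below n b" using lc l by (intro below_mono) simp_all
    then show ?thesis using True pc tv b(2) by simp
  next
    case False
    then have "take j b @ b ! j # drop (Suc j) b < ?c"
      using m by (simp add: cur_def append_less_append_iff)
    then have "b < ?c" using bs by simp
    then have "below n b + period b \<le> below n ?c" using below_greater[OF b(1) lc _ n(2)] by simp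
    then show ?thesis using False tv b(3) by auto
  qed
qed

definition accept :: com where
  "accept = IfNZ 30 (Blk []) (Blk [Mul 31 10 6, Mul 32 11 6])"

text \<open>Register 30 adds the excess of the count over the target and the result of the
  prenecklace test, so it is 0 exactly if both conditions of \<open>cur_accepted_iff\<close>
  hold.\<close>

definition search_inner :: com where
  "search_inner = Blk [Add 10 31 29] ;; eval_prog ;; pren_check ;; Blk [Sub 30 11 26, Add 30 30 12] ;;
    accept ;; Blk [Sub 28 28 6]"

text \<open>There are always \<open>n\<close> rounds: once the symbol of the wanted necklace is
  reached, every further candidate is rejected and leaves registers 31 and 32 alone.\<close>

definition search_outer :: com where
  "search_outer = Blk [Mul 28 0 6] ;; While 28 search_inner ;; Blk [Div 29 29 3, Sub 27 27 6]"

definition search_prog :: com where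
  "search_prog = Blk [Const 31 0, Const 32 0, Mul 29 9 6, Mul 27 1 6] ;; While 27 search_outer"

text \<open>Data of the unranking program that outlive a search: the target, the length of the first
  piece, the running sum and the length of the second piece.\<close>

definition kept :: "(nat \<Rightarrow> nat) \<Rightarrow> (nat \<Rightarrow> nat) \<Rightarrow> bool" where
  "kept R R' \<longleftrightarrow> R' 26 = R 26 \<and> R' 33 = R 33 \<and> R' 35 = R 35 \<and> R' 36 = R 36"

lemma runs_search_inner:
  assumes S: "params n t R" and R: "R 26 = r" "R 29 = base n t ^ (t - Suc j)" "R 31 = num (base n t) (cur b j m)"
      "R 32 = below n (cur b j m)" "R 28 = Suc c"
    and b: "b \<in> necks n t" "below n b \<le> r" "r < below n b + period b" and j: "j < t" and n: "1 \<le> n" "1 \<le> t"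
    and m: "m \<le> b ! j" and B: "2 * t + 50 \<le> B"
  shows "runs B search_inner (R, xs, ys) (65 * (n * t + t * t) + 11 * t + 13)
    (\<lambda>(R', xs', ys'). ys' = ys \<and> params n t R' \<and> kept R R' \<and> R' 27 = R 27 \<and> R' 28 = c \<and> R' 29 = R 29 \<and>
      R' 31 = num (base n t) (cur b j (min (Suc m) (b ! j))) \<and> R' 32 = below n (cur b j (min (Suc m) (b ! j))))"
proof -
  define X where "X = base n t"
  let ?c = "cur b j (Suc m)"
  have l: "length b = t" using b by (simp add: necks_length)
  have lc: "length ?c = t" using l j by (simp add: cur_def)
  have bn: "\<forall>d\<in>set b. d < n" using words_less[OF necks_words[OF b(1)]] by blast
  then have "m < n" using m l j by (metis le_less_trans nth_mem)
  then have cn: "\<forall>d\<in>set ?c. d \<le> n" using bn by (auto simp: cur_def dest: in_set_takeD less_imp_le)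
  then have cX: "\<forall>d\<in>set ?c. d < base n t" using base_gt[OF n] by fastforce
  have nc: "R 31 + R 29 = num (base n t) ?c" using R l by (simp add: num_cur_Suc)
  note acc = cur_accepted_iff[OF b j n m]
  let ?Q = "\<lambda>(R', xs' :: nat list, ys'). ys' = ys \<and> params n t R' \<and> kept R R' \<and> R' 27 = R 27 \<and> R' 28 = c \<and> R' 29 = R 29 \<and>
      R' 31 = num (base n t) (cur b j (min (Suc m) (b ! j))) \<and> R' 32 = below n (cur b j (min (Suc m) (b ! j)))"
  let ?R1 = "R(10 := num (base n t) ?c)"
  have S1: "params n t ?R1" using S by simp
  have g1: "runs B (eval_prog ;; pren_check ;; Blk [Sub 30 11 26, Add 30 30 12] ;;
    accept ;; Blk [Sub 28 28 6]) (?R1, xs, ys)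
    (65 * (n * t + t * t) + (11 * t + 12)) ?Q"
  proof (rule runs_Seq_le[OF runs_eval[OF S1 _ lc cn base_gt[OF n] B n(2,1)], where l = "11 * t + 12"])
    fix R2 :: "nat \<Rightarrow> nat" and xs2 ys2 :: "nat list"
    assume "case (R2, xs2, ys2) of (R', xs', ys') \<Rightarrow> xs' = xs \<and> ys' = ys \<and> same ?R1 R' \<and> R' 11 = tval n (base n t) ?c"
    then have 2: "xs2 = xs" "ys2 = ys" "same ?R1 R2" "R2 11 = tval n (base n t) ?c" by auto
    have S2: "params n t R2" using same_params[OF 2(3) S1] .
    have R2: "R2 10 = num (base n t) ?c" using sameD[OF 2(3)] by simp
    show "runs B (pren_check ;; Blk [Sub 30 11 26, Add 30 30 12] ;;
      accept ;; Blk [Sub 28 28 6]) (R2, xs2, ys2) (11 * t + 12) ?Q"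
    proof (rule runs_Seq_le[OF runs_pren_check[OF S2 R2 lc cX], where l = 7])
      fix R3 :: "nat \<Rightarrow> nat" and xs3 ys3 :: "nat list"
      assume "case (R3, xs3, ys3) of (R', xs', ys') \<Rightarrow> xs' = xs2 \<and> ys' = ys2 \<and> same R2 R' \<and> R' 11 = R2 11 \<and> (R' 12 = 0 \<longleftrightarrow> pren ?c)"
      then have 3: "xs3 = xs" "ys3 = ys" "same R2 R3" "R3 11 = tval n (base n t) ?c" "R3 12 = 0 \<longleftrightarrow> pren ?c"
        using 2 by auto
      have s3: "same ?R1 R3" using same_trans[OF 2(3) 3(3)] .
      have S3: "params n t R3" using same_params[OF s3 S1] .
      note c3 = paramsD[OF S3]
      have e: "R3 10 = num (base n t) ?c" "R3 26 = r" "R3 27 = R 27" "R3 28 = Suc c" "R3 29 = R 29"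
        "R3 31 = num (base n t) (cur b j m)" "R3 32 = below n (cur b j m)" "kept R R3"
        using sameD[OF s3] R by (simp_all add: kept_def)
      let ?R4 = "R3(30 := (R3 11 - r) + R3 12)"
      have z: "(R3 11 - r) + R3 12 = 0 \<longleftrightarrow> m < b ! j" using acc 3(4,5) by auto
      have "runs B (accept ;; Blk [Sub 28 28 6]) (?R4, xs, ys) 5 ?Q"
      proof (rule runs_Seq_le[where k = 4 and l = 1])
        let ?P = "\<lambda>(R', xs' :: nat list, ys'). ys' = ys \<and> params n t R' \<and> kept R R' \<and> R' 27 = R 27 \<and> R' 28 = Suc c \<and> R' 29 = R 29 \<and>
          R' 31 = num (base n t) (cur b j (min (Suc m) (b ! j))) \<and> R' 32 = below n (cur b j (min (Suc m) (b ! j)))"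
        show "runs B accept (?R4, xs, ys) 4 ?P" unfolding accept_def
        proof (rule runs_IfNZ[where k = 2])
          assume "0 < fst (?R4, xs, ys) 30"
          then have "R3 11 - r + R3 12 \<noteq> 0" by auto
          then have "\<not> m < b ! j" using z by metis
          then have "min (Suc m) (b ! j) = m" using m by simp
          then show "runs B (Blk []) (?R4, xs, ys) 2 ?P"
            using S3 e by (intro runs_Blk) (simp_all add: kept_def)
        next
          assume "fst (?R4, xs, ys) 30 = 0"
          then have "R3 11 - r + R3 12 = 0" by simp
          then have "m < b ! j" using z by metis
          moreover have "tval n (base n t) ?c = below n ?c"
            using tval_eq_below[OF _ lc n(2,1)] acc \<open>m < b ! j\<close> by (simp add: base_def)
          moreover have "min (Suc m) (b ! j) = Suc m" using \<open>m < b ! j\<close> by simp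
          ultimately show "runs B (Blk [Mul 31 10 6, Mul 32 11 6]) (?R4, xs, ys) 2 ?P"
            using S3 e B 3(4) by (intro runs_Blk) (simp_all add: kept_def c3)
        qed (use B in simp_all)
        fix R5 :: "nat \<Rightarrow> nat" and xs5 ys5 :: "nat list"
        assume a: "?P (R5, xs5, ys5)"
        then have "params n t R5" by simp
        then show "runs B (Blk [Sub 28 28 6]) (R5, xs5, ys5) 1 ?Q"
          using a B by (intro runs_Blk) (simp_all add: kept_def paramsD[OF \<open>params n t R5\<close>])
      qed simp
      then show "runs B (Blk [Sub 30 11 26, Add 30 30 12] ;;
        accept ;; Blk [Sub 28 28 6]) (R3, xs3, ys3) 7 ?Q"
        using B by (intro runs_Blk_Seq[where l = 5]) (simp_all add: 3(1,2) e(2))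
    qed (use B in simp_all)
  qed simp_all
  show ?thesis unfolding search_inner_def
    by (rule runs_Blk_Seq[where l = "65 * (n * t + t * t) + (11 * t + 12)"]) (use B g1 nc in simp_all)
qed

lemma runs_search_outer:
  assumes S: "params n t R" and R: "R 26 = r" "R 29 = base n t ^ (t - Suc j)"
      "R 31 = num (base n t) (take j b @ replicate (t - j) 0)"
      "R 32 = below n (take j b @ replicate (t - j) 0)" "R 27 = Suc k"
    and b: "b \<in> necks n t" "below n b \<le> r" "r < below n b + period b" and j: "j < t" and n: "1 \<le> n" "1 \<le> t"
    and B: "2 * t + 50 \<le> B"
  shows "runs B search_outer (R, xs, ys) (n * (65 * (n * t + t * t) + 11 * t + 15) + 4)
    (\<lambda>(R', xs', ys'). ys' = ys \<and> params n t R' \<and> kept R R' \<and> R' 27 = k \<and> R' 29 = base n t ^ (t - Suc j) div base n t \<and>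
      R' 31 = num (base n t) (take (Suc j) b @ replicate (t - Suc j) 0) \<and>
      R' 32 = below n (take (Suc j) b @ replicate (t - Suc j) 0))"
proof -
  have l: "length b = t" using b by (simp add: necks_length)
  have bn: "b ! j < n" using words_less[OF necks_words[OF b(1)]] l j by simp
  define I where "I = (\<lambda>c (R', xs' :: nat list, ys'). ys' = ys \<and> params n t R' \<and> kept R R' \<and> R' 27 = Suc k \<and> R' 28 = c \<and>
    R' 29 = base n t ^ (t - Suc j) \<and> R' 31 = num (base n t) (cur b j (min (n - c) (b ! j))) \<and>
    R' 32 = below n (cur b j (min (n - c) (b ! j))))"
  have w: "runs B (While 28 search_inner) (R(28 := n), xs, ys) (n * (65 * (n * t + t * t) + 11 * t + 15) + 1) (I 0)"
  proof (rule runs_for'[where k = "65 * (n * t + t * t) + 11 * t + 13" and N = n and I = I])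
    show "I n (R(28 := n), xs, ys)" using S R cur_0[of j b] l j by (simp add: I_def kept_def)
    fix c R' xs' ys' assume c: "Suc c \<le> n" and I: "I (Suc c) (R', xs', ys')"
    define m where "m = min (n - Suc c) (b ! j)"
    have i: "ys' = ys" "params n t R'" "kept R R'" "R' 27 = Suc k" "R' 28 = Suc c" "R' 29 = base n t ^ (t - Suc j)"
      "R' 31 = num (base n t) (cur b j m)" "R' 32 = below n (cur b j m)" "R' 26 = r"
      using I R by (auto simp: I_def m_def kept_def)
    have mb: "m \<le> b ! j" by (simp add: m_def)
    have mS: "min (Suc m) (b ! j) = min (n - c) (b ! j)" using c by (auto simp: m_def min_def)
    show "runs B search_inner (R', xs', ys') (65 * (n * t + t * t) + 11 * t + 13) (I c)"
      by (rule runs_weaken[OF runs_search_inner[OF i(2,9,6,7,8,5) b j n mb B] order_refl])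
        (use i in \<open>auto simp: I_def kept_def mS\<close>)
  qed (use B in \<open>auto simp: I_def\<close>)
  have "runs B (While 28 search_inner ;; Blk [Div 29 29 3, Sub 27 27 6]) (R(28 := n), xs, ys)
    (n * (65 * (n * t + t * t) + 11 * t + 15) + 3)
    (\<lambda>(R', xs', ys'). ys' = ys \<and> params n t R' \<and> kept R R' \<and> R' 27 = k \<and> R' 29 = base n t ^ (t - Suc j) div base n t \<and>
      R' 31 = num (base n t) (take (Suc j) b @ replicate (t - Suc j) 0) \<and>
      R' 32 = below n (take (Suc j) b @ replicate (t - Suc j) 0))"
  proof (rule runs_Seq_le[OF w, where l = 2])
    fix R' xs' ys' assume "I 0 (R', xs', ys')"
    then have i: "ys' = ys" "params n t R'" "kept R R'" "R' 27 = Suc k" "R' 29 = base n t ^ (t - Suc j)"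
      "R' 31 = num (base n t) (take (Suc j) b @ replicate (t - Suc j) 0)"
      "R' 32 = below n (take (Suc j) b @ replicate (t - Suc j) 0)"
      using bn cur_nth[of j b] l j by (simp_all add: I_def min_def)
    show "runs B (Blk [Div 29 29 3, Sub 27 27 6]) (R', xs', ys') 2
      (\<lambda>(R', xs', ys'). ys' = ys \<and> params n t R' \<and> kept R R' \<and> R' 27 = k \<and> R' 29 = base n t ^ (t - Suc j) div base n t \<and>
      R' 31 = num (base n t) (take (Suc j) b @ replicate (t - Suc j) 0) \<and>
      R' 32 = below n (take (Suc j) b @ replicate (t - Suc j) 0))"
      using B i by (intro runs_Blk) (simp_all add: kept_def paramsD[OF i(2)])
  qed simp
  then show ?thesis unfolding search_outer_def
    by (intro runs_Blk_Seq[where l = "n * (65 * (n * t + t * t) + 11 * t + 15) + 3"]) (use B in \<open>simp_all add: paramsD[OF S]\<close>)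
qed

lemma runs_search:
  assumes S: "params n t R" and R: "R 26 = r"
    and b: "b \<in> necks n t" "below n b \<le> r" "r < below n b + period b" and n: "1 \<le> n" "1 \<le> t"
    and B: "2 * t + 50 \<le> B"
  shows "runs B search_prog (R, xs, ys) (102 * (n * t * (n * t + t * t)))
    (\<lambda>(R', xs', ys'). ys' = ys \<and> params n t R' \<and> kept R R' \<and> R' 31 = num (base n t) b \<and> R' 32 = below n b)"
proof -
  define X where "X = base n t"
  have l: "length b = t" using b by (simp add: necks_length)
  define I where "I = (\<lambda>k (R', xs' :: nat list, ys'). ys' = ys \<and> params n t R' \<and> kept R R' \<and> R' 27 = k \<and> k \<le> t \<and>
    (0 < k \<longrightarrow> R' 29 = X ^ (k - 1)) \<and> R' 31 = num X (take (t - k) b @ replicate k 0) \<and>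
    R' 32 = below n (take (t - k) b @ replicate k 0))"
  let ?R = "R(31 := 0, 32 := 0, 29 := X ^ (t - 1), 27 := t)"
  have w: "runs B (While 27 search_outer) (?R, xs, ys) (t * (n * (65 * (n * t + t * t) + 11 * t + 15) + 6) + 1)
    (\<lambda>(R', xs', ys'). ys' = ys \<and> params n t R' \<and> kept R R' \<and> R' 31 = num (base n t) b \<and> R' 32 = below n b)"
  proof (rule runs_for'[where k = "n * (65 * (n * t + t * t) + 11 * t + 15) + 4" and N = t and I = I])
    have "{w \<in> words n t. \<forall>r. rotate r w < replicate t 0} = {}"
      using replicate_zero_le[of _ t] by (auto simp: words_def not_less[symmetric])
    then have "below n (replicate t 0) = 0" unfolding below_def by (metis card.empty length_replicate)
    then show "I t (?R, xs, ys)" using S by (simp add: I_def kept_def)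
    fix k R' xs' ys' assume k: "Suc k \<le> t" and I: "I (Suc k) (R', xs', ys')"
    define j where "j = t - Suc k"
    have j: "t - Suc k = j" "t - k = Suc j" "j < t" "t - j = Suc k" "t - Suc j = k" using k by (auto simp: j_def)
    have i: "ys' = ys" "params n t R'" "kept R R'" "R' 27 = Suc k" "R' 29 = base n t ^ (t - Suc j)"
      "R' 31 = num (base n t) (take j b @ replicate (t - j) 0)"
      "R' 32 = below n (take j b @ replicate (t - j) 0)" "R' 26 = r"
      using I R by (auto simp: I_def j X_def kept_def)
    have "0 < k \<longrightarrow> X ^ k div X = X ^ (k - 1)" by (cases k) (simp_all add: X_def)
    then show "runs B search_outer (R', xs', ys') (n * (65 * (n * t + t * t) + 11 * t + 15) + 4) (I k)"
      by (intro runs_weaken[OF runs_search_outer[OF i(2,8,5,6,7,4) b j(3) n B] order_refl])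
        (use i k in \<open>auto simp: I_def kept_def j X_def\<close>)
  qed (use B l in \<open>auto simp: I_def X_def\<close>)
  have time: "t * (n * (65 * (n * t + t * t) + 11 * t + 15) + 6) + 5 \<le> 102 * (n * t * (n * t + t * t))"
  proof -
    define Z where "Z = n * t + t * t"
    have Z: "t \<le> Z" "1 \<le> Z" using n by (auto simp: Z_def Suc_le_eq trans_le_add2)
    \<comment> \<open>Lower-order terms are charged to the leading one, so the constants add up: 65
      + 11 + 15 = 91, then 91 + 6 = 97 and 97 + 5 = 102.\<close>
    have "65 * Z + 11 * t + 15 \<le> 91 * Z" using Z by linarith
    then have "n * (65 * Z + 11 * t + 15) \<le> n * (91 * Z)" by simp
    moreover have "1 \<le> n * Z" using Z n by (simp add: Suc_le_eq)
    moreover have "n * (91 * Z) = 91 * (n * Z)" by simp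
    ultimately have "n * (65 * Z + 11 * t + 15) + 6 \<le> 97 * (n * Z)" by linarith
    then have "t * (n * (65 * Z + 11 * t + 15) + 6) \<le> t * (97 * (n * Z))" by simp
    moreover have "t * (97 * (n * Z)) = 97 * (n * t * Z)" by simp
    moreover have "1 \<le> n * t * Z" using Z n by (simp add: Suc_le_eq)
    ultimately show ?thesis unfolding Z_def[symmetric] by linarith
  qed
  show ?thesis unfolding search_prog_def
    by (rule runs_Blk_Seq[where l = "t * (n * (65 * (n * t + t * t) + 11 * t + 15) + 6) + 1"])
      (use B w time in \<open>simp_all add: paramsD[OF S] X_def\<close>)
qed

subsection \<open>The unranking program\<close>

text \<open>Partial sums with a running total, since the output is printed in two pieces, a suffix
  of one necklace and a prefix of the next; \<open>psum_append\<close> joins them.\<close>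

fun psum :: "nat \<Rightarrow> nat list \<Rightarrow> nat list" where
  "psum a [] = []"
| "psum a (d # w) = (a + d) # psum (a + d) w"

lemma psum_append: "psum a (v @ w) = psum a v @ psum (a + sum_list v) w"
  by (induction v arbitrary: a) (auto simp: add.assoc)

lemma psum_eq: "psum a w = map (\<lambda>j. a + sum_list (take (Suc j) w)) [0..<length w]"
proof (induction w arbitrary: a)
  case (Cons d w)
  have "[0..<length (d # w)] = 0 # map Suc [0..<length w]" by (simp add: upt_conv_Cons map_Suc_upt del: upt_Suc)
  then show ?case using Cons by (simp add: add.assoc comp_def del: upt_Suc)
qed simp

lemma partial_sums_eq: "partial_sums w = psum 0 w"
  by (simp add: partial_sums_def psum_eq)

lemma psum_zeros: "psum a (replicate k 0) = replicate k a"
  by (induction k) auto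

definition print_body :: com where
  "print_body = Blk [Div 28 31 34, Mul 29 28 34, Sub 31 31 29, Div 34 34 3, Add 35 35 28, Write 35, Sub 27 27 6]"

lemma runs_print:
  assumes S: "params n t R" and v: "R 31 = num (base n t) v" "\<forall>d\<in>set v. d < base n t"
    and c: "R 27 = c" "c \<le> length v" and R: "0 < c \<Longrightarrow> R 34 = base n t ^ (length v - 1)" "R 35 = a"
    and B: "50 \<le> B"
  shows "runs B (While 27 print_body) (R, xs, ys) (9 * c + 1)
    (\<lambda>(R', xs', ys'). ys' = ys @ psum a (take c v) \<and> params n t R' \<and> R' 35 = a + sum_list (take c v) \<and>
      R' 32 = R 32 \<and> R' 33 = R 33)"
proof -
  define X where "X = base n t"
  have X0: "0 < X" by (simp add: X_def)
  define I where "I = (\<lambda>k (R', xs' :: nat list, ys'). ys' = ys @ psum a (take (c - k) v) \<and> params n t R' \<and>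
    R' 35 = a + sum_list (take (c - k) v) \<and> R' 32 = R 32 \<and> R' 33 = R 33 \<and> R' 27 = k \<and> k \<le> c \<and>
    R' 31 = num X (drop (c - k) v) \<and> (0 < k \<longrightarrow> R' 34 = X ^ (length v - Suc (c - k))))"
  show ?thesis
  proof (rule runs_for'[where k = 7 and N = c and I = I])
    show "I c (R, xs, ys)" using S v c R by (simp add: I_def X_def)
    fix k R' xs' ys' assume k: "Suc k \<le> c" and I: "I (Suc k) (R', xs', ys')"
    define j where "j = c - Suc k"
    have j: "c - Suc k = j" "c - k = Suc j" "j < length v" using k c by (auto simp: j_def)
    have i: "ys' = ys @ psum a (take j v)" "params n t R'" "R' 35 = a + sum_list (take j v)" "R' 32 = R 32"
      "R' 33 = R 33" "R' 27 = Suc k" "R' 31 = num X (drop j v)" "R' 34 = X ^ (length v - Suc j)"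
      using I unfolding I_def prod.case j(1) by auto
    have dv: "drop j v = v ! j # drop (Suc j) v" using j by (simp add: Cons_nth_drop_Suc)
    have less: "num X (drop (Suc j) v) < X ^ (length v - Suc j)"
      using num_less[of "drop (Suc j) v" X] v(2) by (metis X_def in_set_dropD length_drop)
    have nd: "num X (drop j v) = v ! j * X ^ (length v - Suc j) + num X (drop (Suc j) v)" unfolding dv by simp
    have q: "num X (drop j v) div X ^ (length v - Suc j) = v ! j"
      "num X (drop j v) - v ! j * X ^ (length v - Suc j) = num X (drop (Suc j) v)"
      unfolding nd using less X0 by simp_all
    have tk: "take (Suc j) v = take j v @ [v ! j]" using j by (simp add: take_Suc_conv_app_nth)
    have pw: "0 < k \<longrightarrow> X ^ (length v - Suc j) div X = X ^ (length v - Suc (Suc j))"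
    proof
      assume "0 < k"
      then have "length v - Suc j = Suc (length v - Suc (Suc j))" using k c by (simp add: j_def)
      then show "X ^ (length v - Suc j) div X = X ^ (length v - Suc (Suc j))" using X0 by simp
    qed
    show "runs B print_body (R', xs', ys') 7 (I k)" unfolding print_body_def
      using B k pw i(2) by (intro runs_Blk)
        (simp_all add: I_def j(2) i(1,3-) paramsD[OF i(2), folded X_def] q tk psum_append add.assoc)
  qed (use B in \<open>auto simp: I_def\<close>)
qed

abbreviation repeat_loop :: "nat \<Rightarrow> nat \<Rightarrow> com" where
  "repeat_loop a c \<equiv> While c (Blk [Write a, Sub c c 6])"

lemma runs_repeat:
  assumes "a \<noteq> c" "c \<noteq> 6" "a < B" "c < B" "50 \<le> B" "R 6 = 1"
  shows "runs B (repeat_loop a c) (R, xs, ys) (4 * R c + 1) (\<lambda>s. s = (R(c := 0), xs, ys @ replicate (R c) (R a)))"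
proof -
  define I where "I = (\<lambda>k s. k \<le> R c \<and> s = (R(c := k), xs, ys @ replicate (R c - k) (R a)))"
  show ?thesis
  proof (rule runs_for'[where k = 2 and N = "R c" and I = I])
    show "I (R c) (R, xs, ys)" by (simp add: I_def)
    show "\<And>n R' xs' ys'. I n (R', xs', ys') \<Longrightarrow> R' c = n" by (auto simp: I_def)
    show "(R', xs', ys') = (R(c := 0), xs, ys @ replicate (R c) (R a))" if "I 0 (R', xs', ys')" for R' xs' ys'
      using that by (simp add: I_def)
    fix k R' xs' ys' assume "Suc k \<le> R c" and I: "I (Suc k) (R', xs', ys')"
    then have "R c - k = Suc (R c - Suc k)" by simp
    then have e: "replicate (R c - k) (R a) = replicate (R c - Suc k) (R a) @ [R a]"
      by (simp only: replicate_Suc replicate_append_same)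
    show "runs B (Blk [Write a, Sub c c 6]) (R', xs', ys') 2 (I k)"
      using I assms by (intro runs_Blk) (auto simp: I_def fun_eq_iff e)
  qed (use assms in auto)
qed

text \<open>The difference word consists of \<open>Suc r\<close> zeros and the start of
  \<open>(n - 1) # replicate (t - 1) 0\<close>, so its partial sums are \<open>Suc r\<close> zeros
  followed by copies of \<open>n - 1\<close>.\<close>

definition unrank_last_prog :: com where
  "unrank_last_prog = Blk [Add 28 26 6, Const 29 0, Sub 30 0 6, Sub 27 27 6] ;; repeat_loop 29 28 ;; repeat_loop 30 27"

definition cut_prog :: com where
  "cut_prog = Blk [Add 33 26 6, Sub 33 33 32, Const 34 1, Mul 27 33 6] ;; pow_loop 34 27"

definition suffix_prog :: com where
  "suffix_prog = Blk [Div 28 31 34, Mul 28 28 34, Sub 31 31 28, Div 34 34 3, Const 35 0, Mul 27 33 6] ;; While 27 print_body"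

definition prefix_prog :: com where
  "prefix_prog = Blk [Mul 34 9 6, Mul 27 36 6] ;; While 27 print_body"

text \<open>\<open>below n b - 1\<close> is the last value in the interval of the next necklace, so
  a second search with this target finds it.\<close>

definition unrank_general_prog :: com where
  "unrank_general_prog = search_prog ;;
    cut_prog ;; suffix_prog ;; Blk [Sub 26 32 6, Sub 36 1 33] ;; search_prog ;; prefix_prog"

text \<open>Register 26 receives the number \<open>r\<close> of symbols after the index, and
  \<open>t - r\<close> in register 27 is nonzero exactly for the windows that reach the end of the
  sequence.\<close>

definition unrank_prog :: com where
  "unrank_prog = init_prog ;; Blk [Read 25, Sub 26 2 25, Sub 27 1 26] ;;
    IfNZ 27 unrank_last_prog unrank_general_prog"

lemma runs_unrank_last:
  assumes S: "params n t R" and R: "R 26 = r" "R 27 = t - r" and r: "r < t" and n: "1 \<le> n" and B: "50 \<le> B"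
  shows "runs B unrank_last_prog (R, xs, ys) (4 * t + 6)
    (\<lambda>(R', xs', ys'). ys' = ys @ psum 0 (replicate (Suc r) 0 @ take (t - Suc r) ((n - 1) # replicate (t - 1) 0)))"
proof -
  note c = paramsD[OF S]
  let ?R1 = "R(28 := Suc r, 29 := 0, 30 := n - 1, 27 := t - Suc r)"
  have out: "replicate (Suc r) 0 @ replicate (t - Suc r) (n - 1)
    = psum 0 (replicate (Suc r) 0 @ take (t - Suc r) ((n - 1) # replicate (t - 1) 0))"
  proof (cases "t - Suc r")
    case (Suc k)
    then have "take (t - Suc r) ((n - 1) # replicate (t - 1) 0) = (n - 1) # replicate k 0" by (simp add: min_def)
    then show ?thesis using Suc by (simp add: psum_append psum_zeros sum_list_replicate del: replicate_Suc)
        (simp add: psum_zeros)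
  qed (simp add: psum_zeros del: replicate_Suc)
  have 1: "runs B (repeat_loop 29 28) (?R1, xs, ys) (4 * Suc r + 1)
    (\<lambda>s. s = (?R1(28 := 0), xs, ys @ replicate (Suc r) 0))"
    using runs_repeat[of 29 28 B ?R1 xs ys] B c by simp
  have 2: "runs B (repeat_loop 30 27) (?R1(28 := 0), xs, ys @ replicate (Suc r) 0) (4 * (t - Suc r) + 1)
    (\<lambda>s. s = (?R1(28 := 0, 27 := 0), xs, (ys @ replicate (Suc r) 0) @ replicate (t - Suc r) (n - 1)))"
    using runs_repeat[of 30 27 B "?R1(28 := 0)" xs "ys @ replicate (Suc r) 0"] B c by (simp add: fun_upd_twist)
  have 3: "runs B (repeat_loop 29 28 ;; repeat_loop 30 27) (?R1, xs, ys) (4 * t + 2)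
    (\<lambda>(R', xs', ys'). ys' = ys @ psum 0 (replicate (Suc r) 0 @ take (t - Suc r) ((n - 1) # replicate (t - 1) 0)))"
  proof (rule runs_Seq[OF 1, where l = "4 * (t - Suc r) + 1"])
    fix s' assume s': "s' = (?R1(28 := 0), xs, ys @ replicate (Suc r) 0)"
    show "runs B (repeat_loop 30 27) s' (4 * (t - Suc r) + 1)
      (\<lambda>(R', xs', ys'). ys' = ys @ psum 0 (replicate (Suc r) 0 @ take (t - Suc r) ((n - 1) # replicate (t - 1) 0)))"
      unfolding s' by (rule runs_weaken[OF 2 order_refl]) (use out in auto)
  qed (use r in simp)
  show ?thesis unfolding unrank_last_prog_def
    by (rule runs_Blk_Seq[where l = "4 * t + 2"]) (use B R 3 r in \<open>simp_all add: c\<close>)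
qed

lemma runs_unrank_general:
  assumes S: "params n t R" and R: "R 26 = r" and n: "1 \<le> n" "1 \<le> t" and B: "2 * t + 50 \<le> B"
    and b: "b \<in> necks n t" "b' \<in> necks n t" "below n b \<le> r" "r < below n b + period b"
      "below n b' + period b' = below n b" "r + 1 - below n b \<le> t"
  shows "runs B unrank_general_prog (R, xs, ys) (204 * (n * t * (n * t + t * t)) + 22 * t + 17)
    (\<lambda>(R', xs', ys'). ys' = ys @ psum 0 (drop (t - (r + 1 - below n b)) b @ take (t - (r + 1 - below n b)) b'))"
proof -
  define X where "X = base n t"
  have X0: "0 < X" by (simp add: X_def)
  have l: "length b = t" "length b' = t" using b by (auto simp: necks_length)
  have dig: "\<forall>d\<in>set b. d < X" "\<forall>d\<in>set b'. d < X"
    using words_less[OF necks_words] b(1,2) base_gt[OF n] by (fastforce simp: X_def)+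
  define len where "len = r + 1 - below n b"
  have len: "0 < len" "len \<le> t" using b by (auto simp: len_def)
  define y where "y = drop (t - len) b"
  have y: "length y = len" "\<forall>d\<in>set y. d < X" using len l dig by (auto simp: y_def dest: in_set_dropD)
  have "b' \<noteq> []" using l n by auto
  then have pb: "1 \<le> period b'" by (rule per_spec)
  define TS where "TS = 102 * (n * t * (n * t + t * t))"
  have B': "50 \<le> B" using B by simp
  let ?Q = "\<lambda>(R' :: nat \<Rightarrow> nat, xs' :: nat list, ys'). ys' = ys @ psum 0 (y @ take (t - len) b')"
  have "runs B unrank_general_prog (R, xs, ys) (TS + (TS + 22 * t + 17)) ?Q"
    unfolding unrank_general_prog_def
  proof (rule runs_Seq_le[OF runs_search[OF S R b(1,3,4) n B, folded TS_def], where l = "TS + 22 * t + 17"])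
    fix R1 :: "nat \<Rightarrow> nat" and xs1 ys1 :: "nat list"
    assume "case (R1, xs1, ys1) of (R', xs', ys') \<Rightarrow> ys' = ys \<and> params n t R' \<and> kept R R' \<and>
      R' 31 = num (base n t) b \<and> R' 32 = below n b"
    then have 1: "ys1 = ys" "params n t R1" "R1 26 = r" "R1 31 = num X b" "R1 32 = below n b"
      using R by (auto simp: kept_def X_def)
    note c1 = paramsD[OF 1(2), folded X_def]
    let ?R2 = "R1(33 := len, 34 := 1, 27 := len)"
    let ?R3 = "?R2(27 := 0, 34 := X ^ len)"
    have "runs B (pow_loop 34 27) (?R2, xs1, ys) (4 * len + 1) (\<lambda>s. s = (?R3, xs1, ys))"
      using runs_pow[of 34 27 B ?R2 xs1 ys] B c1 by simp
    then have p: "runs B cut_prog (R1, xs1, ys1)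
      (4 * t + 5) (\<lambda>s. s = (?R3, xs1, ys))"
      unfolding cut_prog_def using len B by (intro runs_Blk_Seq[where l = "4 * len + 1"]) (simp_all add: c1 1 len_def)
    show "runs B (cut_prog ;; suffix_prog ;; Blk [Sub 26 32 6, Sub 36 1 33] ;; search_prog ;; prefix_prog)
      (R1, xs1, ys1) (TS + 22 * t + 17) ?Q"
    proof (rule runs_Seq[OF p, where l = "TS + 18 * t + 12"])
      fix s' assume s': "s' = (?R3, xs1, ys)"
      have md: "num X b - num X b div X ^ len * X ^ len = num X y"
        using num_div_mod(2)[OF dig(1) _ X0, of "t - len"] l len by (simp add: minus_div_mult_eq_mod y_def)
      have pw: "X ^ len div X = X ^ (len - 1)" using len X0 by (cases len) simp_all
      let ?R4 = "?R3(28 := num X b div X ^ len * X ^ len, 31 := num X y, 34 := X ^ (len - 1), 35 := 0, 27 := len)"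
      have "runs B (While 27 print_body) (?R4, xs1, ys) (9 * len + 1)
        (\<lambda>(R', xs', ys'). ys' = ys @ psum 0 (take len y) \<and> params n t R' \<and> R' 35 = 0 + sum_list (take len y) \<and>
        R' 32 = ?R4 32 \<and> R' 33 = ?R4 33)"
        by (rule runs_print) (use 1(2) y B' in \<open>simp_all add: X_def\<close>)
      then have q: "runs B suffix_prog
        s' (9 * t + 7) (\<lambda>(R', xs', ys'). ys' = ys @ psum 0 y \<and> params n t R' \<and> R' 35 = sum_list y \<and>
        R' 32 = below n b \<and> R' 33 = len)"
        unfolding s' suffix_prog_def using B len y by (intro runs_Blk_Seq[where l = "9 * len + 1"]) (simp_all add: c1 1 md pw)
      show "runs B (suffix_prog ;; Blk [Sub 26 32 6, Sub 36 1 33] ;; search_prog ;; prefix_prog)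
        s' (TS + 18 * t + 12) ?Q"
      proof (rule runs_Seq_le[OF q, where l = "TS + 9 * t + 5"])
        fix R5 :: "nat \<Rightarrow> nat" and xs5 ys5 :: "nat list"
        assume "case (R5, xs5, ys5) of (R', xs', ys') \<Rightarrow> ys' = ys @ psum 0 y \<and> params n t R' \<and> R' 35 = sum_list y \<and>
          R' 32 = below n b \<and> R' 33 = len"
        then have 5: "ys5 = ys @ psum 0 y" "params n t R5" "R5 35 = sum_list y" "R5 32 = below n b" "R5 33 = len" by auto
        note c5 = paramsD[OF 5(2), folded X_def]
        let ?R6 = "R5(26 := below n b - 1, 36 := t - len)"
        have S6: "params n t ?R6" using 5 by simp
        have R6: "?R6 26 = below n b - 1" by simp
        have b6: "below n b' \<le> below n b - 1" "below n b - 1 < below n b' + period b'" using b(5) pb by linarith+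
        have g: "runs B (search_prog ;; prefix_prog) (?R6, xs5, ys5)
          (TS + 9 * t + 3) ?Q"
        proof (rule runs_Seq_le[OF runs_search[OF S6 R6 b(2) b6 n B, folded TS_def], where l = "9 * t + 3"])
          fix R7 :: "nat \<Rightarrow> nat" and xs7 ys7 :: "nat list"
          assume "case (R7, xs7, ys7) of (R', xs', ys') \<Rightarrow> ys' = ys5 \<and> params n t R' \<and> kept ?R6 R' \<and>
            R' 31 = num (base n t) b' \<and> R' 32 = below n b'"
          then have 7: "ys7 = ys @ psum 0 y" "params n t R7" "R7 35 = sum_list y" "R7 36 = t - len" "R7 31 = num X b'"
            using 5 by (auto simp: kept_def X_def)
          note c7 = paramsD[OF 7(2), folded X_def]
          let ?R8 = "R7(34 := X ^ (t - 1), 27 := t - len)"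
          have "runs B (While 27 print_body) (?R8, xs7, ys7) (9 * (t - len) + 1)
            (\<lambda>(R', xs', ys'). ys' = ys7 @ psum (sum_list y) (take (t - len) b') \<and> params n t R' \<and>
            R' 35 = sum_list y + sum_list (take (t - len) b') \<and> R' 32 = ?R8 32 \<and> R' 33 = ?R8 33)"
            by (rule runs_print) (use 7 l dig B' in \<open>simp_all add: X_def\<close>)
          then have "runs B (While 27 print_body) (?R8, xs7, ys7) (9 * t + 1) ?Q"
            by (rule runs_weaken) (auto simp: 7 psum_append)
          then show "runs B (prefix_prog) (R7, xs7, ys7) (9 * t + 3) ?Q"
            unfolding prefix_prog_def using B by (intro runs_Blk_Seq[where l = "9 * t + 1"]) (simp_all add: c7 7)
        qed simp
        show "runs B (Blk [Sub 26 32 6, Sub 36 1 33] ;; search_prog ;; prefix_prog)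
          (R5, xs5, ys5) (TS + 9 * t + 5) ?Q"
          using B g by (intro runs_Blk_Seq[where l = "TS + 9 * t + 3"]) (simp_all add: c5 5)
      qed simp
    qed simp
  qed simp
  then show ?thesis
    by (rule runs_weaken) (auto simp: TS_def y_def len_def)
qed

lemma runs_unrank:
  assumes n: "1 \<le> n" "1 \<le> t" and M: "M \<in> multisets n t" and o: "occurs_at (G_down n t (n + t - 1)) M i"
    and B: "2 * t + 50 \<le> B"
  shows "runs B unrank_prog ((\<lambda>_. 0), [n, t, i], []) (310 * (n * t * (n * t + t * t)))
    (\<lambda>(R, xs, ys). ys = sorted_list_of_multiset M)"
proof -
  define w where "w = difference_rep M"
  define N where "N = card (words n t)"
  obtain p where p: "p < N" "i = Suc p" "cyclic_substring (root_concat (neck_list n t)) t (Suc p) = w"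
    using o unfolding occurs_at_iff[OF n M] N_def w_def by auto
  define r where "r = N - i"
  have r: "r < N" "N - 1 - r = p" "N - i = r" using p by (auto simp: r_def)
  have B': "50 \<le> B" using B by simp
  have sl: "sorted_list_of_multiset M = psum 0 w"
    unfolding w_def by (simp add: partial_sums_eq[symmetric] partial_sums_difference_rep)
  let ?Q = "\<lambda>(R :: nat \<Rightarrow> nat, xs :: nat list, ys). ys = psum 0 w"
  define Z where "Z = n * t * (n * t + t * t)"
  have time: "(11 * t + 4 * n + 18) + (204 * Z + 22 * t + 22) \<le> 310 * Z"
  proof -
    have "1 \<le> n * t" "1 \<le> n * t + t * t" using n by (auto simp: Suc_le_eq)
    then have "n * t \<le> Z" "1 \<le> Z" unfolding Z_def by (auto simp: Suc_le_eq)
    moreover have "n \<le> n * t" "t \<le> n * t" using n by (auto simp: Suc_le_eq)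
    ultimately show ?thesis by linarith
  qed
  have "runs B unrank_prog ((\<lambda>_. 0), n # t # [i], []) (310 * Z) ?Q"
    unfolding unrank_prog_def
  proof (rule runs_Seq_le[OF runs_init[OF n B'], where l = "204 * Z + 22 * t + 22"])
    fix R :: "nat \<Rightarrow> nat" and xs' ys' :: "nat list"
    assume "case (R, xs', ys') of (R, xs', ys') \<Rightarrow> xs' = [i] \<and> ys' = [] \<and> params n t R"
    then have 1: "xs' = [i]" "ys' = []" "params n t R" by auto
    note c = paramsD[OF 1(3), folded N_def]
    let ?R = "R(25 := i, 26 := r, 27 := t - r)"
    have S: "params n t ?R" using 1 by simp
    have "runs B (IfNZ 27 unrank_last_prog unrank_general_prog) (?R, [], []) (204 * Z + 22 * t + 19) ?Q"
    proof (rule runs_IfNZ[where k = "204 * Z + 22 * t + 17"])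
      assume "0 < fst (?R, [] :: nat list, [] :: nat list) 27"
      then have rt: "r < t" by simp
      have "w = replicate (Suc r) 0 @ take (t - Suc r) ((n - 1) # replicate (t - 1) 0)"
        using unrank_last[OF n rt] r p by (simp add: N_def)
      then show "runs B unrank_last_prog (?R, [], []) (204 * Z + 22 * t + 17) ?Q"
        using runs_weaken[OF runs_unrank_last[OF S _ _ rt n(1) B', of "[]" "[]"], of _ ?Q] by simp
    next
      assume "fst (?R, [] :: nat list, [] :: nat list) 27 = 0"
      then have rt: "t \<le> r" by simp
      obtain b b' where b: "b \<in> necks n t" "b' \<in> necks n t" "below n b \<le> r" "r < below n b + period b"
        "below n b' + period b' = below n b" "r + 1 - below n b \<le> t"
        "w = drop (t - (r + 1 - below n b)) b @ take (t - (r + 1 - below n b)) b'"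
        using unrank_general[OF n rt] r p unfolding N_def by metis
      show "runs B unrank_general_prog (?R, [], []) (204 * Z + 22 * t + 17) ?Q"
      proof -
        have "runs B unrank_general_prog (?R, [], []) (204 * Z + 22 * t + 17) (\<lambda>(R', xs', ys').
          ys' = [] @ psum 0 (drop (t - (r + 1 - below n b)) b @ take (t - (r + 1 - below n b)) b'))"
          unfolding Z_def by (rule runs_unrank_general[OF S _ n B b(1-6)]) simp
        then show ?thesis unfolding b(7) by simp
      qed
    qed (use B in simp_all)
    then show "runs B (Blk [Read 25, Sub 26 2 25, Sub 27 1 26] ;; IfNZ 27 unrank_last_prog unrank_general_prog)
      (R, xs', ys') (204 * Z + 22 * t + 22) ?Q"
      using B by (intro runs_Blk_Seq[where l = "204 * Z + 22 * t + 19"]) (simp_all add: 1 c r)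
  qed (use time in simp)
  then show ?thesis by (simp add: sl Z_def)
qed

theorem theorem4:
  shows "(\<forall>n t :: nat. n \<ge> 1 \<longrightarrow> t \<ge> 1 \<longrightarrow> universal_cycle n t (G_down n t (n + t - 1)))
    \<and> (\<exists>P. \<exists>C :: real. ranks_within P (\<lambda>n t. G_down n t (n + t - 1))
          (\<lambda>n t. C * real n ^ 2 * real t ^ 3) (\<lambda>n t. C * real n * real t ^ 3))
    \<and> (\<exists>P. \<exists>C :: real. unranks_within P (\<lambda>n t. G_down n t (n + t - 1))
          (\<lambda>n t. C * real n ^ 2 * real t ^ 4 * log_factor n) (\<lambda>n t. C * real n * real t ^ 3))"
proof (intro conjI exI allI impI)
  show "universal_cycle n t (G_down n t (n + t - 1))" if "n \<ge> 1" "t \<ge> 1" for n t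
    using universal_cycle_G_down that by simp
  \<comment> \<open>Origin of 620: unranking takes at most
    \<open>310 * (n * t * (n * t + t * t))\<close> steps, and \<open>n * t * (n * t + t * t)\<close>
    is at most \<open>2 * (n ^ 2 * t ^ 3)\<close>. The same constant covers the ranking time and the
    \<open>2 * t + 50\<close> registers.\<close>
  have le: "n * t \<le> n ^ 2 * t ^ 3" "t * t \<le> n ^ 2 * t ^ 3" "n * t * (n * t + t * t) \<le> 2 * (n ^ 2 * t ^ 3)"
    "n ^ 2 * t ^ 3 \<le> n ^ 2 * t ^ 4" "2 * t + 50 \<le> 620 * (n * t ^ 3)"
    if n: "1 \<le> n" "1 \<le> t" for n t :: nat
  proof -
    have t: "t \<le> t ^ 3" "t ^ 2 \<le> t ^ 3" "t ^ 3 \<le> t ^ 4" "1 \<le> t ^ 3" and n2: "n \<le> n ^ 2" "1 \<le> n ^ 2"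
      using n by (auto intro: self_le_power power_increasing)
    show "n * t \<le> n ^ 2 * t ^ 3" using mult_mono[OF n2(1) t(1)] by simp
    show "t * t \<le> n ^ 2 * t ^ 3" using mult_mono[OF n2(2) t(2)] by (simp add: power2_eq_square)
    have "n * t * (n * t + t * t) = n ^ 2 * t ^ 2 + n * t ^ 3"
      by (simp add: power2_eq_square power3_eq_cube algebra_simps)
    moreover have "n ^ 2 * t ^ 2 \<le> n ^ 2 * t ^ 3" "n * t ^ 3 \<le> n ^ 2 * t ^ 3" using t n2 by simp_all
    ultimately show "n * t * (n * t + t * t) \<le> 2 * (n ^ 2 * t ^ 3)" by linarith
    show "n ^ 2 * t ^ 3 \<le> n ^ 2 * t ^ 4" using t by simp
    have "t ^ 3 \<le> n * t ^ 3" using n by simp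
    then show "2 * t + 50 \<le> 620 * (n * t ^ 3)" using t by linarith
  qed
  show "ranks_within (compile 0 rank_prog) (\<lambda>n t. G_down n t (n + t - 1))
    (\<lambda>n t. 620 * real n ^ 2 * real t ^ 3) (\<lambda>n t. 620 * real n * real t ^ 3)"
    unfolding ranks_within_def
  proof (intro allI impI ballI)
    fix n t M i assume n: "1 \<le> n" "1 \<le> (t::nat)" and M: "M \<in> multisets n t"
      and o: "occurs_at (G_down n t (n + t - 1)) M i"
    have T: "250 * (n * t + t * t) \<le> 620 * (n ^ 2 * t ^ 3)" using le[OF n] by simp
    show "computes_within (compile 0 rank_prog) (n # t # sorted_list_of_multiset M) [i]
      (620 * real n ^ 2 * real t ^ 3) (620 * real n * real t ^ 3)"
    proof (rule runs_computes)
      show "runs (2 * t + 50) rank_prog ((\<lambda>_. 0), n # t # sorted_list_of_multiset M, [])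
        (250 * (n * t + t * t)) (\<lambda>(R, is, os). os = [i])"
        using runs_rank[OF n M o order_refl] .
      show "real (250 * (n * t + t * t)) \<le> 620 * real n ^ 2 * real t ^ 3"
        using of_nat_mono[OF T, where 'a = real] by simp
      show "real (2 * t + 50) \<le> 620 * real n * real t ^ 3"
        using of_nat_mono[OF le(5)[OF n], where 'a = real] by simp
    qed
  qed
  show "unranks_within (compile 0 unrank_prog) (\<lambda>n t. G_down n t (n + t - 1))
    (\<lambda>n t. 620 * real n ^ 2 * real t ^ 4 * log_factor n) (\<lambda>n t. 620 * real n * real t ^ 3)"
    unfolding unranks_within_def
  proof (intro allI impI ballI)
    fix n t M i assume n: "1 \<le> n" "1 \<le> (t::nat)" and M: "M \<in> multisets n t"
      and o: "occurs_at (G_down n t (n + t - 1)) M i"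
    have T: "310 * (n * t * (n * t + t * t)) \<le> 620 * (n ^ 2 * t ^ 4)" using le(3,4)[OF n] by linarith
    show "computes_within (compile 0 unrank_prog) [n, t, i] (sorted_list_of_multiset M)
      (620 * real n ^ 2 * real t ^ 4 * log_factor n) (620 * real n * real t ^ 3)"
    proof (rule runs_computes)
      show "runs (2 * t + 50) unrank_prog ((\<lambda>_. 0), [n, t, i], [])
        (310 * (n * t * (n * t + t * t))) (\<lambda>(R, is, os). os = sorted_list_of_multiset M)"
        using runs_unrank[OF n M o order_refl] .
      have "real (310 * (n * t * (n * t + t * t))) \<le> 620 * real n ^ 2 * real t ^ 4 * 1"
        using of_nat_mono[OF T, where 'a = real] by simp
      also have "\<dots> \<le> 620 * real n ^ 2 * real t ^ 4 * log_factor n"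
        by (intro mult_left_mono) (simp_all add: log_factor_def)
      finally show "real (310 * (n * t * (n * t + t * t))) \<le> 620 * real n ^ 2 * real t ^ 4 * log_factor n" .
      show "real (2 * t + 50) \<le> 620 * real n * real t ^ 3"
        using of_nat_mono[OF le(5)[OF n], where 'a = real] by simp
    qed
  qed
qed

end
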